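(* Assume the standing setup in the context, and assume the random shift $\hat\sigma$ together with the potential $\varphi$ is fine. Then there exists a random conformal measure $\nu=(\nu_x)_{x\in X}\in\mathcal P_m(\Omega)$, i.e. there is a measurable function $X\ni x\mapsto\lambda_x\in(0,+\infty)$ such that $\mathcal L_x^*\nu_{\theta(x)}=\lambda_x\nu_x$ for $m$-a.e. $x\in X$. In addition, $\operatorname{ess\,sup}_{x\in X}|\log\lambda_x|<\infty$.
   Context: Standing setup. $(X,\mathcal F,m)$ is a complete probability space and $\theta:X\to X$ is an invertible measurable map preserving $m$. $E=\mathbb N=\{0,1,2,\dots\}$, and $X\ni x\mapsto A(x)=(A_{ij}(x))_{i,j\in E}$ is a measurable map into $\{0,1\}$-valued matrices. For $x\in X$ and $n\ge 0$, $E_x^n$ is the set of words $\omega_0\omega_1\cdots\omega_n\in E^{n+1}$ with $A_{\omega_i\omega_{i+1}}(\theta^i(x))=1$ for $0\le i\le n-1$; for $F\subset E$, $F_x^n$ is the set of words in $E_x^n$ all of whose letters lie in $F$; $E_x^\infty$ is the set of $\omega\in E^{\mathbb N}$ with $A_{\omega_i\omega_{i+1}}(\theta^i(x))=1$ for all $i\ge0$. For $\omega\in E_x^n$, $[\omega]_x=\{\tau\in E_x^\infty:\tau_0\cdots\tau_n=\omega\}$; for $F\subset E$, $[F]_x=\bigcup_{j\in F}[j]_x$, $[0,\dots,l]_x=[\{0,\dots,l\}]_x$, and complements $B^c$ are taken in $E_x^\infty$. $E^{\mathbb N}$ carries the metric $d(\omega,\tau)=e^{-\min\{n:\omega_n\neq\tau_n\}}$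 for $\omega\ne\tau$. $\sigma$ is the left shift, $\sigma_x=\sigma|_{E_x^\infty}:E_x^\infty\to E_{\theta(x)}^\infty$, $\sigma_x^n=\sigma_{\theta^{n-1}(x)}\circ\cdots\circ\sigma_x$. $\Omega=\bigcup_{x\in X}\{x\}\times E_x^\infty$ with the restriction of the product $\sigma$-algebra of $\mathcal F$ and the Borel sets of $E^{\mathbb N}$; $\hat\sigma:\Omega\to\Omega$, $\hat\sigma(x,\omega)=(\theta(x),\sigma_x(\omega))$; for $g:\Omega\to\mathbb R$, $g_x=g(x,\cdot)$ and $S_ng=\sum_{j=0}^{n-1}g\circ\hat\sigma^j$. $\hat\sigma$ is assumed topologically mixing: for all $a,b\in E$ there is $N$ such that for every $n\ge N$ and every $x\in X$ there is a word $\omega$ of length $n+1$ with $a\omega b\in E_x^{n+2}$. Finite range: for every $e\in E$ there is a finite $D_e\subset E$ with $\{j:A_{ej}(x)=1\}\subset D_e$ for $m$-a.e. $x$. Bounded access: for every $b\in E$ there is $b^*\in E$ such that for $m$-a.e. $x$ there is $a\le b^*$ with $A_{ab}(x)=1$. Fix $\alpha>0$. For $g:E_x^\infty\to\mathbb R$, $v_\alpha(g)=\sup\{|g(\tau)-g(\omega)|/d(\tau,\omega)^\alpha:\tau\ne\omega,\ \tau_0=\omega_0\}$; $\mathcal H_\alpha(E_x^\infty)$ is the space of bounded continuous $g$ with $v_\alpha(g)<\infty$, normed by $\|g\|_\alpha=\|g\|_\infty+v_\alpha(g)$. A summable potential is a measurable $\varphi:\Omega\to\mathbb R$ with each $\varphi_x$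 continuous, $V_\alpha(\varphi):=\operatorname{ess\,sup}_x v_\alpha(\varphi_x)<\infty$, such that for every $e\in E$ there are $0<c_e<C_e<\infty$ with $c_e\le e^{\varphi_x}\le C_e$ on $[e]_x$ for $m$-a.e. $x$, and $\lim_{l\to\infty}\operatorname{ess\,sup}_x\sup\mathcal L_x(1_{[0,\dots,l]_x^c})=0$. Here the transfer operator $\mathcal L_x$ maps bounded continuous $g$ on $E_x^\infty$ to functions on $E_{\theta(x)}^\infty$ by $\mathcal L_xg(\omega)=\sum_{e\in E:\,A_{e\omega_0}(x)=1}g(e\omega)e^{\varphi_x(e\omega)}$, and $\mathcal L_x^n=\mathcal L_{\theta^{n-1}(x)}\circ\cdots\circ\mathcal L_x$. Conditions: (A) for every $e\in E$ there is $M_e\in(0,\infty)$ with $M_e^{-1}\le\mathcal L_x1$ on $[e]_{\theta(x)}$ for $m$-a.e. $x$; (B) $\lim_{e\to\infty}\operatorname{ess\,sup}_x\sup_{[e]_{\theta(x)}}\mathcal L_x1=0$; (C) there are $0<\kappa<1/4$ and a finite $F\subset E$ with $\sup\mathcal L_x(1_{E_x^\infty\setminus[F]_x})\le\kappa\inf_{[F]_{\theta(x)}}\mathcal L_x1$ for $m$-a.e. $x$. The pair $(\hat\sigma,\varphi)$ is fine if $\varphi$ is summable and (A), (B), (C) hold. A random measure is a probability measure $\nu$ on $\Omega$ with marginal $m$ on $X$; its disintegrations $\nu_x$ are Borel probability measures on $E_x^\infty$. $\mathcal P_m(\Omega)$ denotes the set of random measures. $\mathcal L_x^*\nu_{\theta(x)}$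 is the measure $B\mapsto\int\mathcal L_x1_B\,d\nu_{\theta(x)}$ on $E_x^\infty$. A random conformal measure is $\nu\in\mathcal P_m(\Omega)$ for which there is measurable $\lambda:X\to(0,\infty)$ with $\mathcal L_x^*\nu_{\theta(x)}=\lambda_x\nu_x$ for $m$-a.e. $x$. *)

theory Defs
  imports "HOL-Analysis.Analysis" "HOL-Probability.Probability"
begin

text \<open>Conventions. The base space is a measure M on a type 'a; theta is the base map.
 The random matrix is A :: 'a => nat => nat => bool, A x i j meaning A_ij(x) = 1.
 Sequences in E^N are functions nat => nat, carrying the product topology of the
 discrete space nat (which is the topology of the metric d), hence its Borel sets.\<close>

definition seq_dist :: "(nat \<Rightarrow> nat) \<Rightarrow> (nat \<Rightarrow> nat) \<Rightarrow> real" where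
  "seq_dist \<tau> \<omega> = (if \<tau> = \<omega> then 0 else exp (- real (LEAST n. \<tau> n \<noteq> \<omega> n)))"

definition Einf :: "('a \<Rightarrow> 'a) \<Rightarrow> ('a \<Rightarrow> nat \<Rightarrow> nat \<Rightarrow> bool) \<Rightarrow> 'a \<Rightarrow> (nat \<Rightarrow> nat) set" where
  "Einf \<theta> A x = {\<omega>. \<forall>i. A ((\<theta> ^^ i) x) (\<omega> i) (\<omega> (Suc i))}"

definition Omega :: "('a \<Rightarrow> 'a) \<Rightarrow> ('a \<Rightarrow> nat \<Rightarrow> nat \<Rightarrow> bool) \<Rightarrow> ('a \<times> (nat \<Rightarrow> nat)) set" where
  "Omega \<theta> A = {(x, \<omega>). \<omega> \<in> Einf \<theta> A x}"

definition OmegaM :: "'a measure \<Rightarrow> ('a \<Rightarrow> 'a) \<Rightarrow> ('a \<Rightarrow> nat \<Rightarrow> nat \<Rightarrow> bool)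
    \<Rightarrow> ('a \<times> (nat \<Rightarrow> nat)) measure" where
  "OmegaM M \<theta> A = restrict_space (M \<Otimes>\<^sub>M (borel :: (nat \<Rightarrow> nat) measure)) (Omega \<theta> A)"

text \<open>Transfer operator L_x, applied to nonnegative (ennreal-valued) functions g on E_x^infinity;
 the result is a function on E_{theta x}^infinity. e # omega is written case_nat e omega.\<close>
definition transfer :: "('a \<Rightarrow> nat \<Rightarrow> nat \<Rightarrow> bool) \<Rightarrow> ('a \<Rightarrow> (nat \<Rightarrow> nat) \<Rightarrow> real) \<Rightarrow> 'a
    \<Rightarrow> ((nat \<Rightarrow> nat) \<Rightarrow> ennreal) \<Rightarrow> (nat \<Rightarrow> nat) \<Rightarrow> ennreal" where
  "transfer A \<phi> x g \<omega> =
     (\<Sum>e. if A x e (\<omega> 0) then g (case_nat e \<omega>) * ennreal (exp (\<phi> x (case_nat e \<omega>))) else 0)"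

definition holder_var :: "('a \<Rightarrow> 'a) \<Rightarrow> ('a \<Rightarrow> nat \<Rightarrow> nat \<Rightarrow> bool) \<Rightarrow> real \<Rightarrow> 'a
    \<Rightarrow> ((nat \<Rightarrow> nat) \<Rightarrow> real) \<Rightarrow> ereal" where
  "holder_var \<theta> A \<alpha> x g =
     (SUP p \<in> {(\<tau>, \<omega>). \<tau> \<in> Einf \<theta> A x \<and> \<omega> \<in> Einf \<theta> A x \<and> \<tau> \<noteq> \<omega> \<and> \<tau> 0 = \<omega> 0}.
        ereal (\<bar>g (fst p) - g (snd p)\<bar> / (seq_dist (fst p) (snd p) powr \<alpha>)))"

definition standing_setup :: "'a measure \<Rightarrow> ('a \<Rightarrow> 'a) \<Rightarrow> ('a \<Rightarrow> nat \<Rightarrow> nat \<Rightarrow> bool) \<Rightarrow> bool" where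
  "standing_setup M \<theta> A \<longleftrightarrow>
     prob_space M \<and> complete_measure M \<and>
     \<theta> \<in> M \<rightarrow>\<^sub>M M \<and> bij_betw \<theta> (space M) (space M) \<and>
     the_inv_into (space M) \<theta> \<in> M \<rightarrow>\<^sub>M M \<and> distr M M \<theta> = M \<and>
     (\<forall>i j. (\<lambda>x. A x i j) \<in> M \<rightarrow>\<^sub>M count_space UNIV) \<and>
     \<comment> \<open>topological mixing\<close>
     (\<forall>a b. \<exists>N. \<forall>n\<ge>N. \<forall>x \<in> space M. \<exists>w::nat \<Rightarrow> nat.
        w 0 = a \<and> w (n + 2) = b \<and> (\<forall>i < n + 2. A ((\<theta> ^^ i) x) (w i) (w (Suc i)))) \<and>
     \<comment> \<open>finite range\<close>
     (\<forall>e. \<exists>D. finite D \<and> (AE x in M. \<forall>j. A x e j \<longrightarrow> j \<in> D)) \<and>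
     \<comment> \<open>bounded access\<close>
     (\<forall>b. \<exists>b'. AE x in M. \<exists>a \<le> b'. A x a b)"

definition summable_potential :: "'a measure \<Rightarrow> ('a \<Rightarrow> 'a) \<Rightarrow> ('a \<Rightarrow> nat \<Rightarrow> nat \<Rightarrow> bool)
    \<Rightarrow> real \<Rightarrow> ('a \<Rightarrow> (nat \<Rightarrow> nat) \<Rightarrow> real) \<Rightarrow> bool" where
  "summable_potential M \<theta> A \<alpha> \<phi> \<longleftrightarrow>
     (\<lambda>p. \<phi> (fst p) (snd p)) \<in> borel_measurable (OmegaM M \<theta> A) \<and>
     (\<forall>x \<in> space M. continuous_on (Einf \<theta> A x) (\<phi> x)) \<and>
     esssup M (\<lambda>x. holder_var \<theta> A \<alpha> x (\<phi> x)) < \<infinity> \<and>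
     (\<forall>e. \<exists>c C. 0 < c \<and> c < C \<and>
        (AE x in M. \<forall>\<omega> \<in> Einf \<theta> A x. \<omega> 0 = e \<longrightarrow> c \<le> exp (\<phi> x \<omega>) \<and> exp (\<phi> x \<omega>) \<le> C)) \<and>
     (\<lambda>l. esssup M (\<lambda>x. SUP \<omega> \<in> Einf \<theta> A (\<theta> x).
        transfer A \<phi> x (indicator (Einf \<theta> A x - {\<tau>. \<tau> 0 \<le> l})) \<omega>)) \<longlonglongrightarrow> 0"

definition is_fine :: "'a measure \<Rightarrow> ('a \<Rightarrow> 'a) \<Rightarrow> ('a \<Rightarrow> nat \<Rightarrow> nat \<Rightarrow> bool)
    \<Rightarrow> real \<Rightarrow> ('a \<Rightarrow> (nat \<Rightarrow> nat) \<Rightarrow> real) \<Rightarrow> bool" where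
  "is_fine M \<theta> A \<alpha> \<phi> \<longleftrightarrow>
     summable_potential M \<theta> A \<alpha> \<phi> \<and>
     \<comment> \<open>(A)\<close>
     (\<forall>e. \<exists>Me::real. 0 < Me \<and>
        (AE x in M. \<forall>\<omega> \<in> Einf \<theta> A (\<theta> x). \<omega> 0 = e \<longrightarrow>
            ennreal (1 / Me) \<le> transfer A \<phi> x (\<lambda>_. 1) \<omega>)) \<and>
     \<comment> \<open>(B)\<close>
     ((\<lambda>e. esssup M (\<lambda>x. SUP \<omega> \<in> {\<omega> \<in> Einf \<theta> A (\<theta> x). \<omega> 0 = e}.
        transfer A \<phi> x (\<lambda>_. 1) \<omega>)) \<longlonglongrightarrow> 0) \<and>
     \<comment> \<open>(C)\<close>
     (\<exists>\<kappa>::real. \<exists>F::nat set. 0 < \<kappa> \<and> \<kappa> < 1/4 \<and> finite F \<and>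
        (AE x in M. (SUP \<omega> \<in> Einf \<theta> A (\<theta> x).
              transfer A \<phi> x (indicator (Einf \<theta> A x - {\<tau> \<in> Einf \<theta> A x. \<tau> 0 \<in> F})) \<omega>)
           \<le> ennreal \<kappa> * (INF \<omega> \<in> {\<omega> \<in> Einf \<theta> A (\<theta> x). \<omega> 0 \<in> F}. transfer A \<phi> x (\<lambda>_. 1) \<omega>)))"

definition random_measure :: "'a measure \<Rightarrow> ('a \<Rightarrow> 'a) \<Rightarrow> ('a \<Rightarrow> nat \<Rightarrow> nat \<Rightarrow> bool)
    \<Rightarrow> ('a \<times> (nat \<Rightarrow> nat)) measure \<Rightarrow> bool" where
  "random_measure M \<theta> A \<nu> \<longleftrightarrow>
     sets \<nu> = sets (OmegaM M \<theta> A) \<and> prob_space \<nu> \<and> distr \<nu> M fst = M"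

definition disintegration :: "'a measure \<Rightarrow> ('a \<Rightarrow> 'a) \<Rightarrow> ('a \<Rightarrow> nat \<Rightarrow> nat \<Rightarrow> bool)
    \<Rightarrow> ('a \<times> (nat \<Rightarrow> nat)) measure \<Rightarrow> ('a \<Rightarrow> (nat \<Rightarrow> nat) measure) \<Rightarrow> bool" where
  "disintegration M \<theta> A \<nu> \<nu>x \<longleftrightarrow>
     (\<forall>x \<in> space M. prob_space (\<nu>x x) \<and>
        sets (\<nu>x x) = sets (restrict_space (borel :: (nat \<Rightarrow> nat) measure) (Einf \<theta> A x))) \<and>
     (\<forall>B \<in> sets \<nu>. (\<lambda>x. emeasure (\<nu>x x) (Pair x -` B)) \<in> borel_measurable M \<and>
        emeasure \<nu> B = (\<integral>\<^sup>+ x. emeasure (\<nu>x x) (Pair x -` B) \<partial>M))"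

definition conformal_eq :: "'a measure \<Rightarrow> ('a \<Rightarrow> 'a) \<Rightarrow> ('a \<Rightarrow> nat \<Rightarrow> nat \<Rightarrow> bool)
    \<Rightarrow> ('a \<Rightarrow> (nat \<Rightarrow> nat) \<Rightarrow> real) \<Rightarrow> ('a \<Rightarrow> (nat \<Rightarrow> nat) measure) \<Rightarrow> ('a \<Rightarrow> real) \<Rightarrow> bool" where
  "conformal_eq M \<theta> A \<phi> \<nu>x lam \<longleftrightarrow>
     (AE x in M. \<forall>B \<in> sets (\<nu>x x).
        (\<integral>\<^sup>+ \<omega>. transfer A \<phi> x (indicator B) \<omega> \<partial>(\<nu>x (\<theta> x))) = ennreal (lam x) * emeasure (\<nu>x x) B)"

end

theory Submission
  imports Defs
begin

text \<open>Fix a typical \<^term>\<open>x\<close> and look at its forward orbit only. A random conformal measure gives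
  finite measures \<open>\<mu> k\<close> on the sequence spaces over the points of the orbit that are mapped to each
  other by the dual transfer operators (after absorbing the scalars). Up to normalization there is
  only one such sequence of bounded mass: if \<open>t\<close> is maximal with \<open>t \<mu> \<le> \<mu>'\<close>, then \<open>\<mu>' - t \<mu>\<close> is again
  such a sequence, and, if it does not vanish, a Harnack inequality for the iterated transfer operators
  bounds it below by a multiple of \<open>\<mu>\<close>, against the choice of \<open>t\<close>. Existence follows by compactness from
  the functionals \<open>g \<mapsto> L^n g(p_n) / L^n 1(p_n)\<close>. By uniqueness these converge without passing to
  subsequences, hence the limit depends measurably on \<^term>\<open>x\<close>, and the sequence over \<open>\<theta> x\<close> is the
  shifted sequence over \<^term>\<open>x\<close>, up to a scalar, which is \<open>\<lambda>_x\<close>.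

  The Harnack inequality rests on a finite set \<open>F\<close> of letters: the loops at the letter 0 give a
  growth rate \<open>c\<close> for the iterated operators, and \<open>F\<close> is taken so large that the transfer operator
  restricted to letters outside \<open>F\<close> has norm at most \<open>c/4\<close>.\<close>


section \<open>Measures on sequences\<close>

definition cyl :: "nat list \<Rightarrow> (nat \<Rightarrow> nat) set" where
  "cyl v = {\<omega>. \<forall>i<length v. \<omega> i = v ! i}"

lemma mem_cyl_iff_map: "\<omega> \<in> cyl v \<longleftrightarrow> map \<omega> [0..<length v] = v"
  unfolding cyl_def mem_Collect_eq by (subst list_eq_iff_nth_eq) simp

lemma cyl_Nil [simp]: "cyl [] = UNIV"
  by (simp add: cyl_def)

lemma cyl_snoc: "cyl (v @ [e]) = {\<omega> \<in> cyl v. \<omega> (length v) = e}"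
  by (auto simp: cyl_def nth_append less_Suc_eq)

lemma cyl_Cons: "cyl (e # v) = {\<omega>. \<omega> 0 = e \<and> (\<lambda>i. \<omega> (Suc i)) \<in> cyl v}"
  by (auto simp: cyl_def nth_Cons split: nat.splits)

lemma cyl_eq_UN_snoc: "cyl v = (\<Union>e. cyl (v @ [e]))"
  by (auto simp: cyl_snoc)

lemma disjoint_family_cyl_snoc: "disjoint_family (\<lambda>e. cyl (v @ [e]))"
  by (auto simp: disjoint_family_on_def cyl_snoc)

lemma cyl_Int: "length v \<le> length u \<Longrightarrow> cyl v \<inter> cyl u = (if take (length v) u = v then cyl u else {})"
  by (auto simp: cyl_def list_eq_iff_nth_eq)

lemma Int_stable_cyl: "Int_stable (insert {} (range cyl))"
proof (rule Int_stableI)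
  fix S T assume ST: "S \<in> insert {} (range cyl)" "T \<in> insert {} (range cyl)"
  have "cyl v \<inter> cyl u \<in> insert {} (range cyl)" for v u
    using cyl_Int[of v u] cyl_Int[of u v] by (cases "length v \<le> length u") (auto simp: Int_commute)
  with ST show "S \<inter> T \<in> insert {} (range cyl)" by auto
qed

lemma sets_borel_seq:
  "sets (borel :: (nat \<Rightarrow> nat) measure) = sets (PiM UNIV (\<lambda>_. count_space UNIV))"
  unfolding sets_PiM_equal_borel[symmetric]
  by (rule sets_PiM_cong) (simp_all add: sets_borel_eq_count_space)

lemma measurable_borel_seqI:
  assumes "\<And>i. (\<lambda>x. f x i) \<in> M \<rightarrow>\<^sub>M count_space UNIV"
  shows "f \<in> M \<rightarrow>\<^sub>M (borel :: (nat \<Rightarrow> nat) measure)"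
  unfolding measurable_cong_sets[OF refl sets_borel_seq]
  by (rule measurable_PiM_single') (use assms in auto)

lemma measurable_coord [measurable]: "(\<lambda>\<omega> :: nat \<Rightarrow> nat. \<omega> i) \<in> borel \<rightarrow>\<^sub>M count_space UNIV"
  unfolding measurable_cong_sets[OF sets_borel_seq refl] by measurable

lemma sets_Collect_coord [measurable]: "{\<omega> :: nat \<Rightarrow> nat. \<omega> i \<in> S} \<in> sets borel"
  using measurable_sets[OF measurable_coord[of i], of S] by (simp add: vimage_def)

lemma sets_cyl [measurable]: "cyl v \<in> sets borel"
proof -
  have "{\<omega> \<in> space borel. \<forall>i<length v. \<omega> i = v ! i} \<in> sets borel" by measurable
  then show ?thesis by (simp add: cyl_def)
qed

lemma sets_borel_eq_sigma_sets_cyl: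
  "sets (borel :: (nat \<Rightarrow> nat) measure) = sigma_sets UNIV (insert {} (range cyl))"
proof
  show "sigma_sets UNIV (insert {} (range cyl)) \<subseteq> sets (borel :: (nat \<Rightarrow> nat) measure)"
    using sets.sigma_sets_subset[of "insert {} (range cyl)" "borel :: (nat \<Rightarrow> nat) measure"] sets_cyl
    by (metis image_subsetI insert_subset sets.empty_sets space_borel)
  have coord: "{\<omega>. \<omega> i \<in> S} \<in> sigma_sets UNIV (insert {} (range cyl))" for i S
  proof -
    have "{\<omega>. \<omega> i \<in> S} = (\<Union>v\<in>{v. length v = Suc i \<and> v ! i \<in> S}. cyl v)"
      by (auto simp: mem_cyl_iff_map cyl_def simp del: upt_Suc
          intro!: exI[of _ "map _ [0..<Suc i]"])
    also have "\<dots> \<in> sigma_sets UNIV (insert {} (range cyl))"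
      by (rule sigma_sets_UNION) (auto intro: sigma_sets.Basic)
    finally show ?thesis .
  qed
  have "sets (PiM UNIV (\<lambda>_. count_space UNIV)) \<subseteq> sigma_sets UNIV (insert {} (range cyl))"
    unfolding sets_PiM_single by (simp, rule sigma_sets_mono) (auto simp: coord)
  then show "sets (borel :: (nat \<Rightarrow> nat) measure) \<subseteq> sigma_sets UNIV (insert {} (range cyl))"
    by (simp add: sets_borel_seq)
qed

lemma measure_eqI_cyl:
  assumes "sets M = sets borel" "sets N = sets borel" "emeasure M UNIV \<noteq> \<infinity>"
    and cyl_eq: "\<And>v. emeasure M (cyl v) = emeasure N (cyl v)"
  shows "M = N"
  by (rule measure_eqI_generator_eq[OF Int_stable_cyl, where \<Omega>=UNIV and A="\<lambda>_. UNIV"])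
    (use assms cyl_eq[of "[]"] range_eqI[of UNIV cyl "[]"]
      in \<open>auto simp: sets_borel_eq_sigma_sets_cyl\<close>)

lemma emeasure_cyl_eq_suminf:
  assumes "sets M = sets borel"
  shows "emeasure M (cyl v) = (\<Sum>e. emeasure M (cyl (v @ [e])))"
  using suminf_emeasure[of "\<lambda>e. cyl (v @ [e])" M] disjoint_family_cyl_snoc[of v]
    cyl_eq_UN_snoc[of v]
  by (simp add: assms image_subset_iff)

lemma measure_cyl_sums:
  assumes "finite_measure M" "sets M = sets borel"
  shows "(\<lambda>e. measure M (cyl (v @ [e]))) sums measure M (cyl v)"
  using finite_measure.finite_measure_UNION[OF assms(1), of "\<lambda>e. cyl (v @ [e])"]
    disjoint_family_cyl_snoc[of v] cyl_eq_UN_snoc[of v]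
  by (simp add: assms image_subset_iff)

lemma measure_cyl_tail:
  assumes "finite_measure M" "sets M = sets borel"
  shows "measure M {\<omega> \<in> cyl v. l < \<omega> (length v)}
      = measure M (cyl v) - (\<Sum>e\<le>l. measure M (cyl (v @ [e])))"
proof -
  interpret finite_measure M by fact
  have "{\<omega> \<in> cyl v. l < \<omega> (length v)} = cyl v - (\<Union>e\<le>l. cyl (v @ [e]))"
    by (auto simp: cyl_snoc not_le)
  moreover have "measure M (\<Union>e\<le>l. cyl (v @ [e])) = (\<Sum>e\<le>l. measure M (cyl (v @ [e])))"
    using disjoint_family_cyl_snoc[of v] assms(2)
    by (intro finite_measure_finite_Union) (auto simp: disjoint_family_on_def)
  ultimately show ?thesis
    using finite_measure_Diff[of "cyl v" "\<Union>e\<le>l. cyl (v @ [e])"] assms(2) by (auto simp: cyl_snoc)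
qed

lemma emeasure_cyl_le_of_longer:
  assumes "sets M = sets borel" "sets M' = sets borel"
    and cyl_le: "\<And>u. length u = n \<Longrightarrow> emeasure M (cyl u) \<le> c * emeasure M' (cyl u)"
    and "length v \<le> n"
  shows "emeasure M (cyl v) \<le> c * emeasure M' (cyl v)"
  using \<open>length v \<le> n\<close>
proof (induction "n - length v" arbitrary: v)
  case 0
  then show ?case using cyl_le by simp
next
  case (Suc d)
  then have "(\<Sum>e. emeasure M (cyl (v @ [e]))) \<le> (\<Sum>e. c * emeasure M' (cyl (v @ [e])))"
    by (intro suminf_le) auto
  then show ?case
    unfolding emeasure_cyl_eq_suminf[OF assms(1), of v] emeasure_cyl_eq_suminf[OF assms(2), of v]
    by simp
qed

lemma ennreal_le_of_exp_mult_le: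
  fixes a b :: ennreal
  assumes "d \<longlonglongrightarrow> 0" "\<forall>\<^sub>F n in sequentially. a \<le> ennreal (exp (d n)) * b"
  shows "a \<le> b"
proof -
  have "(\<lambda>n. ennreal (exp (d n))) \<longlonglongrightarrow> ennreal (exp 0)"
    by (intro tendsto_ennrealI tendsto_exp assms(1))
  then have "(\<lambda>n. ennreal (exp (d n)) * b) \<longlonglongrightarrow> 1 * b"
    by (intro tendsto_mult_ennreal tendsto_const) auto
  with assms(2) show ?thesis by (simp add: tendsto_lowerbound)
qed

lemma measure_eqI_cyl_asymp:
  assumes M: "sets M = sets borel" "emeasure M UNIV \<noteq> \<infinity>" and M': "sets M' = sets borel"
    and d: "d \<longlonglongrightarrow> 0"
    and cyl_le: "\<And>v. N \<le> length v \<Longrightarrow> emeasure M (cyl v)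
        \<le> ennreal (exp (d (length v))) * emeasure M' (cyl v)"
    and cyl_ge: "\<And>v. N \<le> length v \<Longrightarrow> emeasure M' (cyl v)
        \<le> ennreal (exp (d (length v))) * emeasure M (cyl v)"
  shows "M = M'"
proof (rule measure_eqI_cyl[OF M(1) M' M(2)], rule antisym)
  fix v
  show "emeasure M (cyl v) \<le> emeasure M' (cyl v)"
    by (rule ennreal_le_of_exp_mult_le[OF d], rule eventually_sequentiallyI[of "max N (length v)"],
        rule emeasure_cyl_le_of_longer[OF M(1) M']) (use cyl_le in auto)
  show "emeasure M' (cyl v) \<le> emeasure M (cyl v)"
    by (rule ennreal_le_of_exp_mult_le[OF d], rule eventually_sequentiallyI[of "max N (length v)"],
        rule emeasure_cyl_le_of_longer[OF M' M(1)]) (use cyl_ge in auto)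
qed


subsection \<open>Extension of cylinder contents\<close>

lemma sums_nonneg_le:
  fixes f :: "nat \<Rightarrow> real"
  assumes "\<And>i. 0 \<le> f i" "f sums s"
  shows "f i \<le> s"
  using sum_le_suminf[of f "{i}"] assms by (auto simp: sums_iff)

locale prob_cylinder_content =
  fixes m :: "nat list \<Rightarrow> real"
  assumes nonneg: "0 \<le> m v" and additive: "(\<lambda>e. m (v @ [e])) sums m v" and m_Nil: "m [] = 1"
begin

definition next_letter :: "nat list \<Rightarrow> nat pmf" where
  "next_letter v = (if m v = 0 then return_pmf 0 else embed_pmf (\<lambda>e. m (v @ [e]) / m v))"

lemma m_snoc_eq_0: "m v = 0 \<Longrightarrow> m (v @ [e]) = 0"
  using sums_nonneg_le[OF nonneg additive, of v e] nonneg[of "v @ [e]"] by simp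

lemma m_snoc_eq_mult_pmf: "m (v @ [e]) = m v * pmf (next_letter v) e"
proof (cases "m v = 0")
  case False
  have "(\<Sum>e. ennreal (m (v @ [e]) / m v)) = ennreal (m v / m v)"
    by (intro suminf_ennreal_eq sums_divide additive) (simp add: nonneg)
  then have "pmf (next_letter v) e = m (v @ [e]) / m v"
    using False by (simp add: next_letter_def pmf_embed_pmf nn_integral_count_space_nat nonneg)
  then show ?thesis using False by simp
qed (simp add: m_snoc_eq_0)

sublocale Ionescu_Tulcea "\<lambda>i \<omega>. measure_pmf (next_letter (map \<omega> [0..<i]))" "\<lambda>_. count_space UNIV"
proof
  fix i :: nat
  show "(\<lambda>\<omega>. measure_pmf (next_letter (map \<omega> [0..<i])))
      \<in> PiM {0..<i} (\<lambda>_. count_space UNIV) \<rightarrow>\<^sub>M subprob_algebra (count_space UNIV)"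
    by (simp add: count_space_PiM_finite space_subprob_algebra measure_pmf.subprob_space_axioms)
qed

lemma emeasure_eP_singleton:
  assumes \<omega>: "\<omega> \<in> extensional {0..<n}" and y: "y \<in> extensional {0..<Suc n}"
  shows "emeasure (eP n \<omega>) {y}
    = ennreal (pmf (next_letter (map y [0..<n])) (y n)) * indicator {restrict y {0..<n}} \<omega>"
proof -
  let ?y = "restrict y {0..<n}"
  have "fun_upd \<omega> n e = y \<longleftrightarrow> \<omega> = ?y \<and> e = y n" for e
  proof
    assume "fun_upd \<omega> n e = y"
    then have "y = fun_upd \<omega> n e" ..
    then show "\<omega> = ?y \<and> e = y n" using \<omega> by (auto simp: fun_eq_iff extensional_def)
  next
    assume "\<omega> = ?y \<and> e = y n"
    then show "fun_upd \<omega> n e = y" using y by (auto simp: fun_eq_iff extensional_def less_Suc_eq)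
  qed
  then have "(\<lambda>e. fun_upd \<omega> n e) -` {y} = {e. \<omega> = ?y \<and> e = y n}"
    by (simp add: vimage_def)
  then have "emeasure (eP n \<omega>) {y}
      = emeasure (measure_pmf (next_letter (map \<omega> [0..<n]))) {e. \<omega> = ?y \<and> e = y n}"
    using \<omega> y by (subst emeasure_eP) (simp_all add: count_space_PiM_finite PiE_def space_PiM)
  moreover have "map ?y [0..<n] = map y [0..<n]" by simp
  ultimately show ?thesis
    by (cases "\<omega> = ?y") (simp_all add: emeasure_pmf_single)
qed

lemma emeasure_C_singleton:
  "y \<in> extensional {0..<n} \<Longrightarrow> emeasure (C 0 n (\<lambda>_. undefined)) {y} = ennreal (m (map y [0..<n]))"
proof (induction n arbitrary: y)
  case 0
  then show ?case by (simp add: m_Nil PiM_empty)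
next
  case (Suc n)
  let ?C = "C 0 n (\<lambda>_. undefined)" and ?y = "restrict y {0..<n}"
  have sets_C_n: "sets ?C = sets (PiM {0..<n} (\<lambda>_. count_space UNIV))"
    by (subst sets_C) (auto simp: space_PiM)
  then have space_C_n: "space ?C = extensional {0..<n}"
    by (simp add: sets_eq_imp_space_eq[OF sets_C_n] space_PiM PiE_def)
  have map_y: "map ?y [0..<n] = map y [0..<n]" by simp
  have "eP n \<in> ?C \<rightarrow>\<^sub>M subprob_algebra (PiM {0..<Suc n} (\<lambda>_. count_space UNIV))"
    using measurable_eP[of n] by (simp cong: measurable_cong_sets add: sets_C_n)
  moreover have "space ?C \<noteq> {}" using Suc.prems by (auto simp: space_C_n intro: exI[of _ ?y])
  ultimately have "emeasure (C 0 (Suc n) (\<lambda>_. undefined)) {y} = (\<integral>\<^sup>+ \<omega>. emeasure (eP n \<omega>) {y} \<partial>?C)"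
    using emeasure_bind[of ?C "eP n" _ "{y}"] Suc.prems
    by (simp add: count_space_PiM_finite PiE_def)
  also have "\<dots> = (\<integral>\<^sup>+ \<omega>. ennreal (pmf (next_letter (map y [0..<n])) (y n)) * indicator {?y} \<omega> \<partial>?C)"
    using Suc.prems by (intro nn_integral_cong emeasure_eP_singleton) (simp_all add: space_C_n)
  also have "\<dots> = ennreal (pmf (next_letter (map y [0..<n])) (y n)) * ennreal (m (map y [0..<n]))"
    by (simp add: nn_integral_cmult_indicator sets_C_n count_space_PiM_finite PiE_def
        Suc.IH[OF restrict_extensional, of y, unfolded map_y] del: restrict_apply)
  also have "\<dots> = ennreal (m (map y [0..<Suc n]))"
    by (simp add: m_snoc_eq_mult_pmf mult.commute ennreal_mult nonneg)
  finally show ?case .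
qed

lemma emeasure_lim_cyl: "emeasure PF.lim (cyl v) = ennreal (m v)"
proof -
  define y where "y = restrict (\<lambda>i. v ! i) {0..<length v}"
  have y: "y \<in> extensional {0..<length v}" "map y [0..<length v] = v"
    unfolding y_def by simp (subst list_eq_iff_nth_eq, simp)
  then have sets_y: "{y} \<in> sets (PiM {0..<length v} (\<lambda>_. count_space UNIV))"
    by (simp add: count_space_PiM_finite PiE_def)
  have "restrict \<omega> {0..<length v} = y \<longleftrightarrow> \<omega> \<in> cyl v" for \<omega>
    unfolding cyl_def y_def fun_eq_iff by (auto simp: restrict_def split: if_splits)
  then have "cyl v = PF.emb UNIV {0..<length v} {y}" by (auto simp: prod_emb_def)
  then have "emeasure PF.lim (cyl v) = emeasure (CI {0..<length v}) {y}"
    using lim[OF _ sets_y] by simp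
  also have "\<dots> = emeasure (C 0 (length v) (\<lambda>_. undefined))
      (PF.emb {0..<length v} {0..<length v} {y})"
    by (rule emeasure_CI[OF order_refl sets_y])
  also have "PF.emb {0..<length v} {0..<length v} {y} = {y}"
    using y by (intro prod_emb_id) (auto simp: PiE_def)
  finally show ?thesis
    using emeasure_C_singleton[OF y(1)] y(2) by simp
qed

end

lemma cylinder_extension:
  fixes m :: "nat list \<Rightarrow> real"
  assumes nonneg: "\<And>v. 0 \<le> m v" and additive: "\<And>v. (\<lambda>e. m (v @ [e])) sums m v"
  obtains \<mu> where "sets \<mu> = sets borel" "\<And>v. emeasure \<mu> (cyl v) = ennreal (m v)"
proof (cases "m [] = 0")
  case True
  have "m v = 0" for v
  proof (induction v rule: rev_induct)
    case (snoc e v)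
    then show ?case using sums_nonneg_le[OF nonneg additive, of v e] nonneg[of "v @ [e]"] by simp
  qed (rule True)
  then show thesis by (intro that[of "null_measure borel"]) simp_all
next
  case False
  interpret prob_cylinder_content "\<lambda>v. m v / m []"
    by unfold_locales (use nonneg False in \<open>auto intro: sums_divide additive\<close>)
  have "sets PF.lim = sets borel"
    using PF.sets_lim by (simp add: sets_borel_seq)
  then show thesis
    using False assms(1)
    by (intro that[of "scale_measure (ennreal (m [])) PF.lim"])
      (simp_all add: emeasure_lim_cyl ennreal_mult[symmetric])
qed

lemma cylinder_limit_measure:
  assumes X: "\<forall>\<^sub>F i in sequentially. finite_measure (X i) \<and> sets (X i) = sets borel"
    and lim: "\<And>v. (\<lambda>i. measure (X i) (cyl v)) \<longlonglongrightarrow> m v"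
    and tight: "\<And>v. \<exists>\<tau>. \<tau> \<longlonglongrightarrow> 0 \<and>
      (\<forall>l. \<forall>\<^sub>F i in sequentially. measure (X i) {\<omega> \<in> cyl v. l < \<omega> (length v)} \<le> \<tau> l)"
  obtains \<mu> where "sets \<mu> = sets borel" "finite_measure \<mu>" "\<And>v. measure \<mu> (cyl v) = m v"
proof -
  have nonneg: "0 \<le> m v" for v by (rule LIMSEQ_le_const[OF lim]) simp
  have "(\<lambda>e. m (v @ [e])) sums m v" for v
  proof -
    obtain \<tau> where \<tau>: "\<tau> \<longlonglongrightarrow> 0"
      "\<And>l. \<forall>\<^sub>F i in sequentially. measure (X i) {\<omega> \<in> cyl v. l < \<omega> (length v)} \<le> \<tau> l"
      using tight by blast
    have lim_split: "(\<lambda>i. measure (X i) {\<omega> \<in> cyl v. l < \<omega> (length v)})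
        \<longlonglongrightarrow> m v - (\<Sum>e\<le>l. m (v @ [e]))" for l
    proof (rule Lim_transform_eventually)
      show "(\<lambda>i. measure (X i) (cyl v) - (\<Sum>e\<le>l. measure (X i) (cyl (v @ [e]))))
          \<longlonglongrightarrow> m v - (\<Sum>e\<le>l. m (v @ [e]))"
        by (intro tendsto_intros lim)
    qed (use X in \<open>auto elim!: eventually_mono simp: measure_cyl_tail\<close>)
    have "(\<lambda>l. m v - (\<Sum>e\<le>l. m (v @ [e]))) \<longlonglongrightarrow> 0"
    proof (rule tendsto_sandwich[OF always_eventually always_eventually tendsto_const \<tau>(1)];
      intro allI)
      fix l
      show "0 \<le> m v - (\<Sum>e\<le>l. m (v @ [e]))" by (rule LIMSEQ_le_const[OF lim_split]) simp
      show "m v - (\<Sum>e\<le>l. m (v @ [e])) \<le> \<tau> l" by (rule tendsto_upperbound[OF lim_split \<tau>(2)]) simp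
    qed
    from tendsto_diff[OF tendsto_const[of "m v"] this] show ?thesis by (simp add: sums_def_le)
  qed
  with nonneg obtain \<mu> where \<mu>: "sets \<mu> = sets borel" "\<And>v. emeasure \<mu> (cyl v) = ennreal (m v)"
    using cylinder_extension by blast
  have "finite_measure \<mu>"
    using \<mu>(2)[of "[]"] sets_eq_imp_space_eq[OF \<mu>(1)] by (intro finite_measureI) simp
  with \<mu> nonneg that show thesis by (simp add: measure_def)
qed

lemma eventually_bounded_pointwise_subseq:
  fixes X :: "nat \<Rightarrow> 'b :: countable \<Rightarrow> real"
  assumes "\<And>z. \<forall>\<^sub>F i in sequentially. X i z \<in> {a..b}"
  obtains s l where "strict_mono s" "\<And>z. (\<lambda>i. X (s i) z) \<longlonglongrightarrow> l z"
proof -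
  define Y where "Y i z = (if X i z \<in> {a..b} then X i z else a)" for i z
  have "a \<le> b" using eventually_happens[OF assms] by fastforce
  have "seq_compact (PiE UNIV (\<lambda>_::'b. {a..b}))"
    using compactin_PiE[of "\<lambda>_::'b. euclidean" UNIV "\<lambda>_. {a..b}"]
    by (intro compact_imp_seq_compact) (simp add: euclidean_product_topology)
  moreover have "Y i \<in> PiE UNIV (\<lambda>_::'b. {a..b})" for i using \<open>a \<le> b\<close> by (auto simp: Y_def)
  ultimately obtain l s where s: "strict_mono s" and l: "(Y \<circ> s) \<longlonglongrightarrow> l"
    unfolding seq_compact_def by metis
  have "(\<lambda>i. X (s i) z) \<longlonglongrightarrow> l z" for z
  proof (rule Lim_transform_eventually)
    show "(\<lambda>i. Y (s i) z) \<longlonglongrightarrow> l z"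
      using continuous_on_tendsto_compose[OF continuous_on_product_coordinates[of z] l] by simp
    show "\<forall>\<^sub>F i in sequentially. Y (s i) z = X (s i) z"
      by (rule eventually_subseq[OF s], rule eventually_mono[OF assms[of z]]) (simp add: Y_def)
  qed
  with s that show thesis by blast
qed


subsection \<open>Sums of measures\<close>

definition add_measure :: "'a measure \<Rightarrow> 'a measure \<Rightarrow> 'a measure" where
  "add_measure M N = measure_of (space M) (sets M) (\<lambda>B. emeasure M B + emeasure N B)"

lemma sets_add_measure [simp, measurable_cong]: "sets (add_measure M N) = sets M"
  by (simp add: add_measure_def)

lemma emeasure_add_measure:
  assumes "sets N = sets M" "B \<in> sets M"
  shows "emeasure (add_measure M N) B = emeasure M B + emeasure N B"
  unfolding add_measure_def
proof (rule emeasure_measure_of_sigma[OF sets.sigma_algebra_axioms _ _ assms(2)])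
  show "countably_additive (sets M) (\<lambda>B. emeasure M B + emeasure N B)"
  proof (rule countably_additiveI)
    fix Y :: "nat \<Rightarrow> 'a set" assume "range Y \<subseteq> sets M" "disjoint_family Y"
    then show "(\<Sum>i. emeasure M (Y i) + emeasure N (Y i))
        = emeasure M (\<Union>i. Y i) + emeasure N (\<Union>i. Y i)"
      using suminf_emeasure[of Y M] suminf_emeasure[of Y N] assms(1)
      by (simp add: suminf_add[symmetric] del: suminf_emeasure)
  qed
qed (simp add: positive_def)

lemma nn_integral_add_measure:
  assumes sets: "sets N = sets M" and "u \<in> borel_measurable M"
  shows "(\<integral>\<^sup>+ x. u x \<partial>add_measure M N) = (\<integral>\<^sup>+ x. u x \<partial>M) + (\<integral>\<^sup>+ x. u x \<partial>N)"
proof -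
  have measurable_eq: "borel_measurable (add_measure M N) = borel_measurable M"
    "borel_measurable N = borel_measurable M"
    by (rule measurable_cong_sets[OF _ refl], simp add: sets)+
  have space_eq: "space (add_measure M N) = space M" "space N = space M"
    by (rule sets_eq_imp_space_eq, simp add: sets)+
  from assms(2) show ?thesis
  proof (induction rule: borel_measurable_induct)
    case (cong f g)
    then have "(\<integral>\<^sup>+ x. f x \<partial>K) = (\<integral>\<^sup>+ x. g x \<partial>K)" if "space K = space M" for K
      using that by (intro nn_integral_cong) simp
    then show ?case using cong(4) by (simp add: space_eq)
  next
    case (set B)
    then show ?case by (simp add: emeasure_add_measure sets)
  next
    case (mult u c)
    then show ?case by (simp add: nn_integral_cmult distrib_left measurable_eq)
  next
    case (add u v)
    then show ?case by (simp add: nn_integral_add measurable_eq ac_simps)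
  next
    case (seq U)
    have SUP: "(\<integral>\<^sup>+ x. (SUP i. U i) x \<partial>K) = (SUP i. \<integral>\<^sup>+ x. U i x \<partial>K)"
      if "sets K = sets M" for K
      unfolding SUP_apply using seq(1)
      by (intro nn_integral_monotone_convergence_SUP seq(3))
        (simp add: measurable_cong_sets[OF that refl])
    have "incseq (\<lambda>i. \<integral>\<^sup>+ x. U i x \<partial>K)" for K
      using seq(3) by (auto simp: incseq_def le_fun_def intro!: nn_integral_mono)
    from ennreal_SUP_add[OF this this] show ?case
      unfolding SUP[OF refl] SUP[OF sets_add_measure] SUP[OF sets] seq(5) .
  qed
qed

lemma finite_measure_scale_measure:
  assumes "finite_measure M"
  shows "finite_measure (scale_measure (ennreal c) M)"
  using finite_measure.emeasure_finite[OF assms]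
  by (intro finite_measureI) (simp add: space_scale_measure ennreal_mult_eq_top_iff)

lemma add_measure_cancel_right:
  assumes "add_measure M N = add_measure M' N" "sets M = sets N" "sets M' = sets N"
    "finite_measure N"
  shows "M = M'"
proof (rule measure_eqI)
  interpret N: finite_measure N by fact
  fix B assume "B \<in> sets M"
  then have "emeasure M B + emeasure N B = emeasure M' B + emeasure N B"
    using emeasure_add_measure[of N M B] emeasure_add_measure[of N M' B] assms by simp
  then show "emeasure M B = emeasure M' B"
    using N.emeasure_finite by (simp add: ennreal_add_left_cancel add.commute[of _ "emeasure N B"])
qed (simp add: assms)

lemma diff_measure_of_cyl_le:
  assumes M: "finite_measure M" "sets M = sets borel"
    and N: "finite_measure N" "sets N = sets borel"
    and cyl_le: "\<And>v. measure N (cyl v) \<le> measure M (cyl v)"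
  obtains R where "finite_measure R" "sets R = sets borel" "M = add_measure R N"
proof -
  obtain R where R: "sets R = sets borel"
    "\<And>v. emeasure R (cyl v) = ennreal (measure M (cyl v) - measure N (cyl v))"
    by (rule cylinder_extension[of "\<lambda>v. measure M (cyl v) - measure N (cyl v)"])
      (use cyl_le in \<open>auto intro!: sums_diff measure_cyl_sums M N\<close>)
  have "finite_measure R"
    using R(2)[of "[]"] sets_eq_imp_space_eq[OF R(1)] by (intro finite_measureI) simp
  moreover have "M = add_measure R N"
  proof (rule measure_eqI_cyl)
    fix v
    show "emeasure M (cyl v) = emeasure (add_measure R N) (cyl v)"
      using cyl_le[of v] R M N
      by (simp add: emeasure_add_measure finite_measure.emeasure_eq_measure ennreal_plus[symmetric]
        del: ennreal_plus)
  qed (use M R finite_measure.emeasure_finite[OF M(1)] in auto)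
  ultimately show thesis using R(1) that by blast
qed


section \<open>Transfer operators and their duals\<close>

lemma mem_Einf_iff: "\<omega> \<in> Einf \<theta> A x \<longleftrightarrow> (\<forall>i. A ((\<theta> ^^ i) x) (\<omega> i) (\<omega> (Suc i)))"
  by (simp add: Einf_def)

lemma case_nat_in_Einf:
  assumes "\<omega> \<in> Einf \<theta> A (\<theta> x)" "A x e (\<omega> 0)"
  shows "case_nat e \<omega> \<in> Einf \<theta> A x"
  unfolding mem_Einf_iff
proof
  fix i show "A ((\<theta> ^^ i) x) (case_nat e \<omega> i) (case_nat e \<omega> (Suc i))"
    using assms by (cases i) (auto simp: mem_Einf_iff funpow_swap1)
qed

lemma transfer_eq_nn_integral:
  "transfer A \<phi> x g \<omega> =
     (\<integral>\<^sup>+ e. (if A x e (\<omega> 0) then g (case_nat e \<omega>) * ennreal (exp (\<phi> x (case_nat e \<omega>))) else 0)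
       \<partial>count_space UNIV)"
  by (simp add: transfer_def nn_integral_count_space_nat)

lemma transfer_add: "transfer A \<phi> x (\<lambda>\<tau>. g \<tau> + h \<tau>) \<omega> = transfer A \<phi> x g \<omega> + transfer A \<phi> x h \<omega>"
  unfolding transfer_eq_nn_integral
  by (subst nn_integral_add[symmetric]) (auto intro!: nn_integral_cong simp: distrib_right)

lemma transfer_cmult: "transfer A \<phi> x (\<lambda>\<tau>. c * g \<tau>) \<omega> = c * transfer A \<phi> x g \<omega>"
  unfolding transfer_eq_nn_integral
  by (subst nn_integral_cmult[symmetric]) (auto intro!: nn_integral_cong simp: mult.assoc)

lemma transfer_mono_Einf:
  assumes "\<omega> \<in> Einf \<theta> A (\<theta> x)" "\<And>\<tau>. \<tau> \<in> Einf \<theta> A x \<Longrightarrow> g \<tau> \<le> h \<tau>"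
  shows "transfer A \<phi> x g \<omega> \<le> transfer A \<phi> x h \<omega>"
  unfolding transfer_eq_nn_integral
  by (rule nn_integral_mono) (auto intro!: mult_right_mono assms(2) case_nat_in_Einf assms(1))

lemma transfer_ge_term:
  "A x e (\<omega> 0) \<Longrightarrow> g (case_nat e \<omega>) * ennreal (exp (\<phi> x (case_nat e \<omega>))) \<le> transfer A \<phi> x g \<omega>"
  unfolding transfer_def
  using sum_le_suminf[of "\<lambda>e. if A x e (\<omega> 0)
      then g (case_nat e \<omega>) * ennreal (exp (\<phi> x (case_nat e \<omega>))) else 0" "{e}"]
  by simp

lemma transfer_indicator_cyl_Cons:
  "transfer A \<phi> x (indicator (cyl (e # v))) \<omega> =
     (if A x e (\<omega> 0) then indicator (cyl v) \<omega> * ennreal (exp (\<phi> x (case_nat e \<omega>))) else 0)"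
proof -
  have "indicator (cyl (e # v)) (case_nat a \<omega>)
      = (if a = e then indicator (cyl v) \<omega> else (0::ennreal))" for a
    by (auto simp: cyl_Cons indicator_def)
  then have "transfer A \<phi> x (indicator (cyl (e # v))) \<omega> =
     (\<Sum>a. if a = e
        then if A x e (\<omega> 0) then indicator (cyl v) \<omega> * ennreal (exp (\<phi> x (case_nat e \<omega>))) else 0
        else 0)"
    unfolding transfer_def by (intro arg_cong[where f=suminf]) (auto simp: fun_eq_iff)
  also have "\<dots> =
     (if A x e (\<omega> 0) then indicator (cyl v) \<omega> * ennreal (exp (\<phi> x (case_nat e \<omega>))) else 0)"
    by (rule sums_unique[symmetric], rule sums_single)
  finally show ?thesis .
qed

primrec transfer_pow :: "('a \<Rightarrow> 'a) \<Rightarrow> ('a \<Rightarrow> nat \<Rightarrow> nat \<Rightarrow> bool) \<Rightarrow> ('a \<Rightarrow> (nat \<Rightarrow> nat) \<Rightarrow> real) \<Rightarrow> 'a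
    \<Rightarrow> nat \<Rightarrow> ((nat \<Rightarrow> nat) \<Rightarrow> ennreal) \<Rightarrow> (nat \<Rightarrow> nat) \<Rightarrow> ennreal" where
  "transfer_pow \<theta> A \<phi> x 0 u = u"
| "transfer_pow \<theta> A \<phi> x (Suc n) u = transfer A \<phi> ((\<theta> ^^ n) x) (transfer_pow \<theta> A \<phi> x n u)"

lemma transfer_pow_add:
  "transfer_pow \<theta> A \<phi> x (m + n) u = transfer_pow \<theta> A \<phi> ((\<theta> ^^ m) x) n (transfer_pow \<theta> A \<phi> x m u)"
  by (induction n) (auto simp: funpow_add add.commute)

lemma transfer_pow_cmult:
  "transfer_pow \<theta> A \<phi> x n (\<lambda>\<tau>. c * g \<tau>) = (\<lambda>\<omega>. c * transfer_pow \<theta> A \<phi> x n g \<omega>)"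
  by (induction n) (auto simp: transfer_cmult)

lemma transfer_pow_mono_Einf:
  assumes "\<omega> \<in> Einf \<theta> A ((\<theta> ^^ n) x)" "\<And>\<tau>. \<tau> \<in> Einf \<theta> A x \<Longrightarrow> g \<tau> \<le> h \<tau>"
  shows "transfer_pow \<theta> A \<phi> x n g \<omega> \<le> transfer_pow \<theta> A \<phi> x n h \<omega>"
  using assms(1)
proof (induction n arbitrary: \<omega>)
  case (Suc n)
  then have "\<omega> \<in> Einf \<theta> A (\<theta> ((\<theta> ^^ n) x))" by simp
  then show ?case unfolding transfer_pow.simps by (rule transfer_mono_Einf) (rule Suc.IH)
qed (use assms(2) in auto)


subsection \<open>Measurability\<close>

lemma measurable_case_nat_seq [measurable (raw)]:
  assumes [measurable]: "f \<in> M \<rightarrow>\<^sub>M count_space UNIV" "g \<in> M \<rightarrow>\<^sub>M (borel :: (nat \<Rightarrow> nat) measure)"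
  shows "(\<lambda>x. case_nat (f x) (g x)) \<in> M \<rightarrow>\<^sub>M (borel :: (nat \<Rightarrow> nat) measure)"
proof (rule measurable_borel_seqI)
  fix i show "(\<lambda>x. case_nat (f x) (g x) i) \<in> M \<rightarrow>\<^sub>M count_space UNIV"
    by (cases i) simp_all
qed

lemma measurable_transfer:
  assumes [measurable]: "u \<in> borel_measurable borel" "\<phi> x \<in> borel_measurable borel"
  shows "transfer A \<phi> x u \<in> borel_measurable borel"
  unfolding transfer_def[abs_def] by measurable

lemma measurable_transfer_pow:
  assumes "u \<in> borel_measurable borel" "\<And>i. \<phi> ((\<theta> ^^ i) x) \<in> borel_measurable borel"
  shows "transfer_pow \<theta> A \<phi> x n u \<in> borel_measurable borel"
  by (induction n) (auto intro!: measurable_transfer assms)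

lemma sets_Einf [measurable]: "Einf \<theta> A x \<in> sets borel"
proof -
  have "{\<omega> \<in> space borel. \<forall>i. A ((\<theta> ^^ i) x) (\<omega> i) (\<omega> (Suc i))} \<in> sets borel"
    by measurable
  then show ?thesis by (simp add: Einf_def)
qed

lemma Compl_Einf_eq_UN_cyl: "- Einf \<theta> A x = (\<Union>v\<in>{v. cyl v \<inter> Einf \<theta> A x = {}}. cyl v)"
proof (intro equalityI subsetI)
  fix \<omega> assume "\<omega> \<in> - Einf \<theta> A x"
  then obtain i where i: "\<not> A ((\<theta> ^^ i) x) (\<omega> i) (\<omega> (Suc i))" by (auto simp: mem_Einf_iff)
  define v where "v = map \<omega> [0..<Suc (Suc i)]"
  have "\<tau> i = \<omega> i \<and> \<tau> (Suc i) = \<omega> (Suc i)" if "\<tau> \<in> cyl v" for \<tau>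
    using that by (simp add: mem_cyl_iff_map v_def)
  with i have "cyl v \<inter> Einf \<theta> A x = {}" by (force simp: mem_Einf_iff)
  moreover have "\<omega> \<in> cyl v" by (simp add: mem_cyl_iff_map v_def)
  ultimately show "\<omega> \<in> (\<Union>v\<in>{v. cyl v \<inter> Einf \<theta> A x = {}}. cyl v)" by blast
qed auto

lemma AE_mem_iff_emeasure_Compl:
  fixes M :: "'a :: topological_space measure"
  assumes "sets M = sets borel" "S \<in> sets borel"
  shows "(AE \<omega> in M. \<omega> \<in> S) \<longleftrightarrow> emeasure M (- S) = 0"
  using assms sets_eq_imp_space_eq[OF assms(1)] by (intro AE_iff_measurable) auto

lemma AE_EinfI_cyl:
  assumes sets: "sets M = sets borel"
    and null: "\<And>v. cyl v \<inter> Einf \<theta> A x = {} \<Longrightarrow> emeasure M (cyl v) = 0"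
  shows "AE \<omega> in M. \<omega> \<in> Einf \<theta> A x"
proof -
  have "(\<Union>v\<in>{v. cyl v \<inter> Einf \<theta> A x = {}}. cyl v) \<in> null_sets M"
    by (intro null_sets_UN') (auto simp: null_sets_def sets null)
  then show ?thesis
    by (simp add: AE_mem_iff_emeasure_Compl sets Compl_Einf_eq_UN_cyl[symmetric] null_sets_def)
qed


subsection \<open>The dual operator\<close>

definition dual_transfer :: "('a \<Rightarrow> nat \<Rightarrow> nat \<Rightarrow> bool) \<Rightarrow> ('a \<Rightarrow> (nat \<Rightarrow> nat) \<Rightarrow> real) \<Rightarrow> 'a
    \<Rightarrow> (nat \<Rightarrow> nat) measure \<Rightarrow> (nat \<Rightarrow> nat) measure" where
  "dual_transfer A \<phi> x \<mu> =
     distr (density (\<mu> \<Otimes>\<^sub>M count_space UNIV)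
         (\<lambda>(\<omega>, e). if A x e (\<omega> 0) then ennreal (exp (\<phi> x (case_nat e \<omega>))) else 0))
       borel (\<lambda>(\<omega>, e). case_nat e \<omega>)"

lemma sets_dual_transfer [simp, measurable_cong]: "sets (dual_transfer A \<phi> x \<mu>) = sets borel"
  by (simp add: dual_transfer_def)

lemma space_dual_transfer [simp]: "space (dual_transfer A \<phi> x \<mu>) = UNIV"
  by (simp add: dual_transfer_def)

lemma nn_integral_dual_transfer:
  assumes [measurable_cong]: "sets \<mu> = sets borel"
    and [measurable]: "\<phi> x \<in> borel_measurable borel" "u \<in> borel_measurable borel"
  shows "(\<integral>\<^sup>+ \<omega>. u \<omega> \<partial>dual_transfer A \<phi> x \<mu>) = (\<integral>\<^sup>+ \<omega>. transfer A \<phi> x u \<omega> \<partial>\<mu>)"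
proof -
  interpret sigma_finite_measure "count_space UNIV :: nat measure"
    by (rule sigma_finite_measure_count_space)
  let ?w = "\<lambda>\<omega> e. if A x e (\<omega> 0) then ennreal (exp (\<phi> x (case_nat e \<omega>))) else 0"
  have "(\<integral>\<^sup>+ \<omega>. u \<omega> \<partial>dual_transfer A \<phi> x \<mu>)
      = (\<integral>\<^sup>+ (\<omega>, e). ?w \<omega> e * u (case_nat e \<omega>) \<partial>(\<mu> \<Otimes>\<^sub>M count_space UNIV))"
    unfolding dual_transfer_def by (simp add: nn_integral_distr nn_integral_density split_beta')
  also have "\<dots> = (\<integral>\<^sup>+ \<omega>. \<integral>\<^sup>+ e. ?w \<omega> e * u (case_nat e \<omega>) \<partial>count_space UNIV \<partial>\<mu>)"
    by (subst nn_integral_fst[symmetric]) (simp_all add: split_beta' cong: if_cong)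
  also have "\<dots> = (\<integral>\<^sup>+ \<omega>. transfer A \<phi> x u \<omega> \<partial>\<mu>)"
    unfolding transfer_eq_nn_integral by (auto intro!: nn_integral_cong simp: mult.commute)
  finally show ?thesis .
qed

lemma emeasure_dual_transfer:
  assumes "sets \<mu> = sets borel" "\<phi> x \<in> borel_measurable borel" "B \<in> sets borel"
  shows "emeasure (dual_transfer A \<phi> x \<mu>) B = (\<integral>\<^sup>+ \<omega>. transfer A \<phi> x (indicator B) \<omega> \<partial>\<mu>)"
  using nn_integral_dual_transfer[of \<mu> \<phi> x "indicator B" A] assms by simp

lemma dual_transfer_add_measure:
  assumes "sets \<mu> = sets borel" "sets \<nu> = sets borel" "\<phi> x \<in> borel_measurable borel"
  shows "dual_transfer A \<phi> x (add_measure \<mu> \<nu>)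
      = add_measure (dual_transfer A \<phi> x \<mu>) (dual_transfer A \<phi> x \<nu>)"
proof (rule measure_eqI)
  fix B :: "(nat \<Rightarrow> nat) set" assume "B \<in> sets (dual_transfer A \<phi> x (add_measure \<mu> \<nu>))"
  then have B: "B \<in> sets borel" by simp
  have "transfer A \<phi> x (indicator B) \<in> borel_measurable \<mu>"
    unfolding measurable_cong_sets[OF assms(1) refl] using B assms(3)
    by (intro measurable_transfer) auto
  then show "emeasure (dual_transfer A \<phi> x (add_measure \<mu> \<nu>)) B
      = emeasure (add_measure (dual_transfer A \<phi> x \<mu>) (dual_transfer A \<phi> x \<nu>)) B"
    using B assms by (simp add: emeasure_dual_transfer emeasure_add_measure nn_integral_add_measure)
qed simp

lemma dual_transfer_scale_measure:
  assumes "sets \<mu> = sets borel" "\<phi> x \<in> borel_measurable borel"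
  shows "dual_transfer A \<phi> x (scale_measure c \<mu>) = scale_measure c (dual_transfer A \<phi> x \<mu>)"
proof (rule measure_eqI)
  fix B :: "(nat \<Rightarrow> nat) set" assume "B \<in> sets (dual_transfer A \<phi> x (scale_measure c \<mu>))"
  then have B: "B \<in> sets borel" by simp
  have "transfer A \<phi> x (indicator B) \<in> borel_measurable \<mu>"
    unfolding measurable_cong_sets[OF assms(1) refl] using B assms(2)
    by (intro measurable_transfer) auto
  then show "emeasure (dual_transfer A \<phi> x (scale_measure c \<mu>)) B
      = emeasure (scale_measure c (dual_transfer A \<phi> x \<mu>)) B"
    using B assms by (simp add: emeasure_dual_transfer nn_integral_scale_measure)
qed simp

lemma AE_dual_transfer_Einf:
  assumes "sets \<mu> = sets borel" "\<phi> x \<in> borel_measurable borel" "AE \<omega> in \<mu>. \<omega> \<in> Einf \<theta> A (\<theta> x)"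
  shows "AE \<omega> in dual_transfer A \<phi> x \<mu>. \<omega> \<in> Einf \<theta> A x"
proof -
  have "emeasure (dual_transfer A \<phi> x \<mu>) (- Einf \<theta> A x)
      = (\<integral>\<^sup>+ \<omega>. transfer A \<phi> x (indicator (- Einf \<theta> A x)) \<omega> \<partial>\<mu>)"
    by (rule emeasure_dual_transfer) (use assms in auto)
  also have "\<dots> = (\<integral>\<^sup>+ \<omega>. 0 \<partial>\<mu>)"
    by (rule nn_integral_cong_AE, rule eventually_mono[OF assms(3)])
      (simp add: transfer_def case_nat_in_Einf cong: if_cong)
  finally show ?thesis by (simp add: AE_mem_iff_emeasure_Compl)
qed

primrec dual_transfer_pow :: "('a \<Rightarrow> 'a) \<Rightarrow> ('a \<Rightarrow> nat \<Rightarrow> nat \<Rightarrow> bool) \<Rightarrow> ('a \<Rightarrow> (nat \<Rightarrow> nat) \<Rightarrow> real) \<Rightarrow> 'a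
    \<Rightarrow> nat \<Rightarrow> (nat \<Rightarrow> nat) measure \<Rightarrow> (nat \<Rightarrow> nat) measure" where
  "dual_transfer_pow \<theta> A \<phi> x 0 \<mu> = \<mu>"
| "dual_transfer_pow \<theta> A \<phi> x (Suc n) \<mu> = dual_transfer A \<phi> x (dual_transfer_pow \<theta> A \<phi> (\<theta> x) n \<mu>)"


section \<open>Conformal sequences along an orbit\<close>

definition conformal_upto :: "('a \<Rightarrow> 'a) \<Rightarrow> ('a \<Rightarrow> nat \<Rightarrow> nat \<Rightarrow> bool) \<Rightarrow> ('a \<Rightarrow> (nat \<Rightarrow> nat) \<Rightarrow> real) \<Rightarrow> 'a
    \<Rightarrow> nat \<Rightarrow> (nat \<Rightarrow> (nat \<Rightarrow> nat) measure) \<Rightarrow> bool" where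
  "conformal_upto \<theta> A \<phi> x n \<mu> \<longleftrightarrow>
     (\<forall>k\<le>n. finite_measure (\<mu> k) \<and> sets (\<mu> k) = sets borel
       \<and> (AE \<omega> in \<mu> k. \<omega> \<in> Einf \<theta> A ((\<theta> ^^ k) x))) \<and>
     (\<forall>k<n. \<mu> k = dual_transfer A \<phi> ((\<theta> ^^ k) x) (\<mu> (Suc k)))"

definition conformal_seq :: "('a \<Rightarrow> 'a) \<Rightarrow> ('a \<Rightarrow> nat \<Rightarrow> nat \<Rightarrow> bool) \<Rightarrow> ('a \<Rightarrow> (nat \<Rightarrow> nat) \<Rightarrow> real) \<Rightarrow> 'a
    \<Rightarrow> (nat \<Rightarrow> (nat \<Rightarrow> nat) measure) \<Rightarrow> bool" where
  "conformal_seq \<theta> A \<phi> x \<mu> \<longleftrightarrow> (\<forall>n. conformal_upto \<theta> A \<phi> x n \<mu>)"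

definition bounded_conformal :: "('a \<Rightarrow> 'a) \<Rightarrow> ('a \<Rightarrow> nat \<Rightarrow> nat \<Rightarrow> bool)
    \<Rightarrow> ('a \<Rightarrow> (nat \<Rightarrow> nat) \<Rightarrow> real) \<Rightarrow> 'a \<Rightarrow> (nat \<Rightarrow> (nat \<Rightarrow> nat) measure) \<Rightarrow> bool" where
  "bounded_conformal \<theta> A \<phi> x \<mu> \<longleftrightarrow> conformal_seq \<theta> A \<phi> x \<mu> \<and> (\<exists>K. \<forall>k. measure (\<mu> k) UNIV \<le> K)"

lemma conformal_uptoD:
  assumes "conformal_upto \<theta> A \<phi> x n \<mu>" "k \<le> n"
  shows "finite_measure (\<mu> k)" "sets (\<mu> k) = sets borel" "AE \<omega> in \<mu> k. \<omega> \<in> Einf \<theta> A ((\<theta> ^^ k) x)"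
    "space (\<mu> k) = UNIV"
  using assms sets_eq_imp_space_eq[of "\<mu> k" borel] by (auto simp: conformal_upto_def)

lemma conformal_upto_eq:
  "conformal_upto \<theta> A \<phi> x n \<mu> \<Longrightarrow> k < n \<Longrightarrow> \<mu> k = dual_transfer A \<phi> ((\<theta> ^^ k) x) (\<mu> (Suc k))"
  by (simp add: conformal_upto_def)

lemma conformal_seq_iff:
  "conformal_seq \<theta> A \<phi> x \<mu> \<longleftrightarrow>
     (\<forall>k. finite_measure (\<mu> k) \<and> sets (\<mu> k) = sets borel
       \<and> (AE \<omega> in \<mu> k. \<omega> \<in> Einf \<theta> A ((\<theta> ^^ k) x)) \<and>
       \<mu> k = dual_transfer A \<phi> ((\<theta> ^^ k) x) (\<mu> (Suc k)))"
  unfolding conformal_seq_def conformal_upto_def by blast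

lemma conformal_seqD:
  assumes "conformal_seq \<theta> A \<phi> x \<mu>"
  shows "finite_measure (\<mu> k)" "sets (\<mu> k) = sets borel" "AE \<omega> in \<mu> k. \<omega> \<in> Einf \<theta> A ((\<theta> ^^ k) x)"
    "space (\<mu> k) = UNIV" "\<mu> k = dual_transfer A \<phi> ((\<theta> ^^ k) x) (\<mu> (Suc k))"
  using assms unfolding conformal_seq_iff
  by (blast, blast, blast, metis sets_eq_imp_space_eq space_borel, blast)

lemma conformal_upto_scale_measure:
  assumes "conformal_upto \<theta> A \<phi> x n \<mu>" and \<phi>: "\<And>k. \<phi> ((\<theta> ^^ k) x) \<in> borel_measurable borel"
  shows "conformal_upto \<theta> A \<phi> x n (\<lambda>k. scale_measure (ennreal c) (\<mu> k))"
  unfolding conformal_upto_def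
proof (intro conjI allI impI)
  fix k assume k: "k \<le> n"
  note \<mu> = conformal_uptoD[OF assms(1) k]
  show "finite_measure (scale_measure (ennreal c) (\<mu> k))"
    by (rule finite_measure_scale_measure[OF \<mu>(1)])
  show "sets (scale_measure (ennreal c) (\<mu> k)) = sets borel" by (simp add: \<mu>)
  show "AE \<omega> in scale_measure (ennreal c) (\<mu> k). \<omega> \<in> Einf \<theta> A ((\<theta> ^^ k) x)"
    using \<mu>(2,3) by (simp add: AE_mem_iff_emeasure_Compl)
next
  fix k assume k: "k < n"
  then show "scale_measure (ennreal c) (\<mu> k)
      = dual_transfer A \<phi> ((\<theta> ^^ k) x) (scale_measure (ennreal c) (\<mu> (Suc k)))"
    using conformal_upto_eq[OF assms(1) k] conformal_uptoD(2)[OF assms(1), of "Suc k"] \<phi>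
    by (simp add: dual_transfer_scale_measure)
qed

lemma conformal_seq_scale_measure:
  "\<lbrakk>conformal_seq \<theta> A \<phi> x \<mu>; \<And>k. \<phi> ((\<theta> ^^ k) x) \<in> borel_measurable borel\<rbrakk>
     \<Longrightarrow> conformal_seq \<theta> A \<phi> x (\<lambda>k. scale_measure (ennreal c) (\<mu> k))"
  unfolding conformal_seq_def by (blast intro: conformal_upto_scale_measure)

lemma conformal_seq_shift:
  "conformal_seq \<theta> A \<phi> x \<mu> \<Longrightarrow> conformal_seq \<theta> A \<phi> (\<theta> x) (\<lambda>k. \<mu> (Suc k))"
  unfolding conformal_seq_iff by (metis funpow_simps_right(2) comp_apply)

lemma bounded_conformal_shift:
  assumes \<mu>: "bounded_conformal \<theta> A \<phi> x \<mu>" and \<phi>: "\<And>k. \<phi> ((\<theta> ^^ k) (\<theta> x)) \<in> borel_measurable borel"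
    and "0 \<le> c"
  shows "bounded_conformal \<theta> A \<phi> (\<theta> x) (\<lambda>k. scale_measure (ennreal c) (\<mu> (Suc k)))"
proof -
  obtain K where "\<And>k. measure (\<mu> k) UNIV \<le> K" using \<mu> by (auto simp: bounded_conformal_def)
  then have "measure (scale_measure (ennreal c) (\<mu> (Suc k))) UNIV \<le> c * K" for k
    using \<open>0 \<le> c\<close> by (simp add: mult_left_mono)
  moreover have "conformal_seq \<theta> A \<phi> (\<theta> x) (\<lambda>k. scale_measure (ennreal c) (\<mu> (Suc k)))"
    using \<mu> \<phi> by (intro conformal_seq_scale_measure conformal_seq_shift)
      (auto simp: bounded_conformal_def)
  ultimately show ?thesis unfolding bounded_conformal_def by blast
qed

lemma conformal_seq_diff:
  assumes \<mu>: "conformal_seq \<theta> A \<phi> x \<mu>" and \<mu>': "conformal_seq \<theta> A \<phi> x \<mu>'"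
    and \<phi>: "\<And>k. \<phi> ((\<theta> ^^ k) x) \<in> borel_measurable borel"
    and cyl_le: "\<And>k v. measure (\<mu> k) (cyl v) \<le> measure (\<mu>' k) (cyl v)"
  obtains \<nu> where "conformal_seq \<theta> A \<phi> x \<nu>" "\<And>k. \<mu>' k = add_measure (\<nu> k) (\<mu> k)"
proof -
  note \<mu>_props = conformal_seqD[OF \<mu>] and \<mu>'_props = conformal_seqD[OF \<mu>']
  have "\<exists>R. finite_measure R \<and> sets R = sets borel \<and> \<mu>' k = add_measure R (\<mu> k)" for k
    using diff_measure_of_cyl_le[OF \<mu>'_props(1,2) \<mu>_props(1,2) cyl_le] by metis
  then obtain \<nu> where \<nu>: "\<And>k. finite_measure (\<nu> k)" "\<And>k. sets (\<nu> k) = sets borel"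
    and \<mu>'_eq: "\<And>k. \<mu>' k = add_measure (\<nu> k) (\<mu> k)" by metis
  have "conformal_seq \<theta> A \<phi> x \<nu>"
    unfolding conformal_seq_iff
  proof (intro allI conjI \<nu>)
    fix k
    have "emeasure (\<mu>' k) (- Einf \<theta> A ((\<theta> ^^ k) x)) = 0"
      using \<mu>'_props(3)[of k] by (simp add: AE_mem_iff_emeasure_Compl \<mu>'_props(2))
    then show "AE \<omega> in \<nu> k. \<omega> \<in> Einf \<theta> A ((\<theta> ^^ k) x)"
      by (simp add: AE_mem_iff_emeasure_Compl \<mu>'_eq emeasure_add_measure \<mu>_props(2) \<nu>(2))
    have "add_measure (\<nu> k) (\<mu> k) = dual_transfer A \<phi> ((\<theta> ^^ k) x)
        (add_measure (\<nu> (Suc k)) (\<mu> (Suc k)))"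
      using \<mu>'_props(5)[of k] by (simp only: \<mu>'_eq)
    also have "\<dots> = add_measure (dual_transfer A \<phi> ((\<theta> ^^ k) x) (\<nu> (Suc k))) (\<mu> k)"
      using \<mu>_props(5)[of k] by (simp add: dual_transfer_add_measure \<nu>(2) \<mu>_props(2) \<phi>)
    finally show "\<nu> k = dual_transfer A \<phi> ((\<theta> ^^ k) x) (\<nu> (Suc k))"
      by (rule add_measure_cancel_right) (simp_all add: \<nu>(2) \<mu>_props(1,2))
  qed
  with \<mu>'_eq that show thesis by blast
qed


section \<open>Harnack inequality\<close>

text \<open>A growth rate \<open>c\<close> of the operators would give the bounds \<open>w * c ^ m\<close> in \<open>access\<close> and \<open>c / 4\<close>
  outside \<open>F\<close>; the potential is normalized to \<open>c = 1\<close>.\<close>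

locale fine_orbit =
  fixes \<theta> :: "'a \<Rightarrow> 'a" and A :: "'a \<Rightarrow> nat \<Rightarrow> nat \<Rightarrow> bool" and \<phi> :: "'a \<Rightarrow> (nat \<Rightarrow> nat) \<Rightarrow> real"
    and x :: 'a
    and D \<eta> :: "nat \<Rightarrow> real" and C w :: real and N :: nat and F :: "nat set"
    and p :: "nat \<Rightarrow> nat \<Rightarrow> nat"
  assumes phi_measurable: "\<phi> ((\<theta> ^^ k) x) \<in> borel_measurable borel"
    and finite_range: "finite {j. A ((\<theta> ^^ k) x) e j}"
    and distortion: "\<lbrakk>\<tau> \<in> Einf \<theta> A ((\<theta> ^^ k) x); \<omega> \<in> Einf \<theta> A ((\<theta> ^^ k) x); \<forall>i\<le>r. \<tau> i = \<omega> i\<rbrakk>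
        \<Longrightarrow> \<phi> ((\<theta> ^^ k) x) \<tau> \<le> \<phi> ((\<theta> ^^ k) x) \<omega> + D r"
    and D_nonneg: "0 \<le> D r" and D_summable: "summable D"
    and transfer_one_le: "\<omega> \<in> Einf \<theta> A ((\<theta> ^^ Suc k) x) \<Longrightarrow>
        transfer A \<phi> ((\<theta> ^^ k) x) (\<lambda>_. 1) \<omega> \<le> ennreal C"
    and transfer_outside_le: "\<omega> \<in> Einf \<theta> A ((\<theta> ^^ Suc k) x) \<Longrightarrow>
        transfer A \<phi> ((\<theta> ^^ k) x) (indicator {\<tau>. \<tau> 0 \<notin> F}) \<omega> \<le> ennreal (1/4)"
    and transfer_tail_le: "\<omega> \<in> Einf \<theta> A ((\<theta> ^^ Suc k) x) \<Longrightarrow>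
        transfer A \<phi> ((\<theta> ^^ k) x) (indicator {\<tau>. l < \<tau> 0}) \<omega> \<le> ennreal (\<eta> l)"
    and eta_nonneg: "0 \<le> \<eta> l" and eta_tendsto: "\<eta> \<longlonglongrightarrow> 0"
    and access: "\<lbrakk>N \<le> m; f \<in> F; \<omega> \<in> Einf \<theta> A ((\<theta> ^^ (m + k)) x); \<omega> 0 \<in> F\<rbrakk>
        \<Longrightarrow> ennreal w \<le> transfer_pow \<theta> A \<phi> ((\<theta> ^^ k) x) m (indicator {\<tau>. \<tau> 0 = f}) \<omega>"
    and base_point: "p k \<in> Einf \<theta> A ((\<theta> ^^ k) x)" "p k 0 \<in> F"
    and C_ge_1: "1 \<le> C" and w_pos: "0 < w"
begin

abbreviation E :: "nat \<Rightarrow> (nat \<Rightarrow> nat) set" where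
  "E k \<equiv> Einf \<theta> A ((\<theta> ^^ k) x)"

abbreviation L :: "nat \<Rightarrow> ((nat \<Rightarrow> nat) \<Rightarrow> ennreal) \<Rightarrow> (nat \<Rightarrow> nat) \<Rightarrow> ennreal" where
  "L k \<equiv> transfer A \<phi> ((\<theta> ^^ k) x)"

abbreviation Lpow :: "nat \<Rightarrow> nat \<Rightarrow> ((nat \<Rightarrow> nat) \<Rightarrow> ennreal) \<Rightarrow> (nat \<Rightarrow> nat) \<Rightarrow> ennreal" where
  "Lpow k \<equiv> transfer_pow \<theta> A \<phi> ((\<theta> ^^ k) x)"

abbreviation inF :: "(nat \<Rightarrow> nat) set" where
  "inF \<equiv> {\<tau>. \<tau> 0 \<in> F}"

definition dist_const :: real where
  "dist_const = exp (\<Sum>r. D r)"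

definition harnack_const :: real where
  "harnack_const = 4 / 3 * C * dist_const / w"
  \<comment> \<open>the solution of \<open>h = dist_const / w * C + h / 4\<close>\<close>

lemma dist_const_pos: "0 < dist_const" and harnack_const_pos: "0 < harnack_const"
  using C_ge_1 w_pos by (auto simp: dist_const_def harnack_const_def)

lemma Lpow_add: "Lpow k (m + n) u = Lpow (m + k) n (Lpow k m u)"
  by (simp add: transfer_pow_add funpow_add)

lemma Lpow_Suc: "Lpow k (Suc m) u = L (m + k) (Lpow k m u)"
  by (simp add: funpow_add)

lemma measurable_Lpow: "u \<in> borel_measurable borel \<Longrightarrow> Lpow k m u \<in> borel_measurable borel"
  using phi_measurable[of "_ + k"] by (intro measurable_transfer_pow) (auto simp: funpow_add)

lemma Lpow_mono: "\<omega> \<in> E (m + k) \<Longrightarrow> (\<And>\<tau>. \<tau> \<in> E k \<Longrightarrow> g \<tau> \<le> h \<tau>) \<Longrightarrow> Lpow k m g \<omega> \<le> Lpow k m h \<omega>"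
  by (rule transfer_pow_mono_Einf) (auto simp: funpow_add)

lemma Lpow_one_le: "\<omega> \<in> E (m + k) \<Longrightarrow> Lpow k m (\<lambda>_. 1) \<omega> \<le> ennreal (C ^ m)"
proof (induction m arbitrary: \<omega>)
  case (Suc m)
  have "Lpow k (Suc m) (\<lambda>_. 1) \<omega> \<le> L (m + k) (\<lambda>_. ennreal (C ^ m) * 1) \<omega>"
    unfolding Lpow_Suc using Suc by (intro transfer_mono_Einf[where \<theta>=\<theta>]) auto
  also have "\<dots> = ennreal (C ^ m) * L (m + k) (\<lambda>_. 1) \<omega>" by (rule transfer_cmult)
  also have "\<dots> \<le> ennreal (C ^ m) * ennreal C"
    using Suc.prems by (intro mult_left_mono transfer_one_le) auto
  also have "\<dots> = ennreal (C ^ Suc m)"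
    using C_ge_1 by (simp add: ennreal_mult[symmetric] mult.commute)
  finally show ?case .
qed simp

lemma Lpow_indicator_le: "\<omega> \<in> E (m + k) \<Longrightarrow> Lpow k m (indicator B) \<omega> \<le> ennreal (C ^ m)"
  by (rule order_trans[OF Lpow_mono Lpow_one_le]) (auto simp: indicator_def)

lemma weight_distortion:
  assumes "\<tau> \<in> E (Suc k)" "\<omega> \<in> E (Suc k)" "\<forall>i\<le>r. \<tau> i = \<omega> i" "A ((\<theta> ^^ k) x) e (\<tau> 0)"
  shows "ennreal (exp (\<phi> ((\<theta> ^^ k) x) (case_nat e \<tau>)))
    \<le> ennreal (exp (D (Suc r))) * ennreal (exp (\<phi> ((\<theta> ^^ k) x) (case_nat e \<omega>)))"
proof -
  have "A ((\<theta> ^^ k) x) e (\<omega> 0)" using assms by auto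
  then have "\<phi> ((\<theta> ^^ k) x) (case_nat e \<tau>) \<le> \<phi> ((\<theta> ^^ k) x) (case_nat e \<omega>) + D (Suc r)"
    using assms by (intro distortion case_nat_in_Einf) (auto split: nat.splits)
  then show ?thesis
    by (simp add: ennreal_mult[symmetric] exp_add[symmetric] add.commute)
qed

lemma Lpow_cyl_distortion:
  assumes "length v \<le> Suc r + m" "\<tau> \<in> E (m + k)" "\<omega> \<in> E (m + k)" "\<forall>i\<le>r. \<tau> i = \<omega> i"
  shows "Lpow k m (indicator (cyl v)) \<tau>
    \<le> ennreal (exp (\<Sum>i=Suc r..<Suc (r + m). D i)) * Lpow k m (indicator (cyl v)) \<omega>"
  using assms
proof (induction m arbitrary: r \<tau> \<omega>)
  case 0
  then have "\<tau> \<in> cyl v \<longleftrightarrow> \<omega> \<in> cyl v" by (auto simp: cyl_def)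
  then show ?case by (auto simp: indicator_def)
next
  case (Suc m)
  let ?u = "Lpow k m (indicator (cyl v))"
    and ?e = "\<lambda>e \<omega>. ennreal (exp (\<phi> ((\<theta> ^^ (m + k)) x) (case_nat e \<omega>)))"
  let ?d = "exp (\<Sum>i=Suc (Suc r)..<Suc (Suc r + m). D i)"
  let ?d' = "exp (\<Sum>i=Suc r..<Suc (r + Suc m). D i)"
  have E: "\<tau> \<in> E (Suc (m + k))" "\<omega> \<in> E (Suc (m + k))" "\<tau> 0 = \<omega> 0" using Suc.prems by auto
  have "?d' = ?d * exp (D (Suc r))"
    by (subst sum.atLeast_Suc_lessThan) (auto simp: exp_add)
  then have d': "ennreal ?d' = ennreal ?d * ennreal (exp (D (Suc r)))"
    by (simp only: ennreal_mult[OF exp_ge_zero exp_ge_zero])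
  have "(if A ((\<theta> ^^ (m + k)) x) e (\<tau> 0) then ?u (case_nat e \<tau>) * ?e e \<tau> else 0)
     \<le> ennreal ?d' * (if A ((\<theta> ^^ (m + k)) x) e (\<omega> 0) then ?u (case_nat e \<omega>) * ?e e \<omega> else 0)" for e
  proof (cases "A ((\<theta> ^^ (m + k)) x) e (\<omega> 0)")
    case True
    then have "?u (case_nat e \<tau>) \<le> ennreal ?d * ?u (case_nat e \<omega>)"
      using Suc.prems E by (intro Suc.IH case_nat_in_Einf) (auto split: nat.splits)
    moreover have "?e e \<tau> \<le> ennreal (exp (D (Suc r))) * ?e e \<omega>"
      by (rule weight_distortion) (use E True Suc.prems in auto)
    ultimately have "?u (case_nat e \<tau>) * ?e e \<tau>
        \<le> (ennreal ?d * ?u (case_nat e \<omega>)) * (ennreal (exp (D (Suc r))) * ?e e \<omega>)"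
      by (rule mult_mono) auto
    also have "\<dots> = ennreal ?d' * (?u (case_nat e \<omega>) * ?e e \<omega>)"
      unfolding d' by (simp only: ac_simps)
    finally show ?thesis using True E(3) by simp
  qed (simp add: E(3))
  then show ?case
    unfolding Lpow_Suc transfer_eq_nn_integral
    by (subst nn_integral_cmult[symmetric]) (auto intro: nn_integral_mono)
qed

lemma Lpow_cyl_regular:
  assumes "length v \<le> m" "\<tau> \<in> E (m + k)" "\<omega> \<in> E (m + k)" "\<tau> 0 = \<omega> 0"
  shows "Lpow k m (indicator (cyl v)) \<tau> \<le> ennreal dist_const * Lpow k m (indicator (cyl v)) \<omega>"
proof -
  have "(\<Sum>i=Suc 0..<Suc (0 + m). D i) \<le> (\<Sum>i. D i)"
    using D_summable D_nonneg by (intro sum_le_suminf) auto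
  then have "ennreal (exp (\<Sum>i=Suc 0..<Suc (0 + m). D i)) \<le> ennreal dist_const"
    by (simp add: dist_const_def)
  then show ?thesis
    using assms by (intro order_trans[OF Lpow_cyl_distortion[of v 0] mult_right_mono]) auto
qed

lemma Lpow_cyl_le_of_inF:
  assumes "length v \<le> i" "N \<le> j" and \<omega>: "\<omega> \<in> E (i + k)" "\<omega> 0 \<in> F"
    and \<omega>': "\<omega>' \<in> E (j + (i + k))" "\<omega>' 0 \<in> F"
  shows "Lpow k i (indicator (cyl v)) \<omega>
      \<le> ennreal (dist_const / w) * Lpow k (i + j) (indicator (cyl v)) \<omega>'"
proof -
  let ?u = "Lpow k i (indicator (cyl v))"
  have "?u \<omega> * ennreal w \<le> ?u \<omega> * Lpow (i + k) j (indicator {\<tau>. \<tau> 0 = \<omega> 0}) \<omega>'"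
    using assms by (intro mult_left_mono access) auto
  also have "\<dots> = Lpow (i + k) j (\<lambda>\<tau>. ?u \<omega> * indicator {\<tau>. \<tau> 0 = \<omega> 0} \<tau>) \<omega>'"
    by (simp add: transfer_pow_cmult)
  also have "\<dots> \<le> Lpow (i + k) j (\<lambda>\<tau>. ennreal dist_const * ?u \<tau>) \<omega>'"
  proof (rule Lpow_mono[OF \<omega>'(1)])
    fix \<tau> assume "\<tau> \<in> E (i + k)"
    then show "?u \<omega> * indicator {\<tau>. \<tau> 0 = \<omega> 0} \<tau> \<le> ennreal dist_const * ?u \<tau>"
      using assms by (auto simp: indicator_def intro: Lpow_cyl_regular)
  qed
  also have "\<dots> = ennreal dist_const * Lpow k (i + j) (indicator (cyl v)) \<omega>'"
    by (simp add: transfer_pow_cmult Lpow_add)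
  finally have "ennreal (1 / w) * (?u \<omega> * ennreal w)
      \<le> ennreal (1 / w) * (ennreal dist_const * Lpow k (i + j) (indicator (cyl v)) \<omega>')"
    by (rule mult_left_mono) simp
  then show ?thesis
    using w_pos dist_const_pos
    by (simp add: mult.commute[of "?u \<omega>"] mult.assoc[symmetric] ennreal_mult[symmetric])
qed

lemma transfer_le_of_inF:
  assumes "\<omega> \<in> E (Suc k)"
    and in_F: "\<And>\<tau>. \<tau> \<in> E k \<Longrightarrow> \<tau> 0 \<in> F \<Longrightarrow> u \<tau> \<le> a" and bound: "\<And>\<tau>. \<tau> \<in> E k \<Longrightarrow> u \<tau> \<le> b"
  shows "L k u \<omega> \<le> a * ennreal C + b * ennreal (1/4)"
proof -
  let ?out = "indicator {\<tau>. \<tau> 0 \<notin> F} :: (nat \<Rightarrow> nat) \<Rightarrow> ennreal"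
  have "L k u \<omega> \<le> L k (\<lambda>\<tau>. a * 1 + b * ?out \<tau>) \<omega>"
  proof (rule transfer_mono_Einf[where \<theta>=\<theta>])
    fix \<tau> assume "\<tau> \<in> E k"
    then show "u \<tau> \<le> a * 1 + b * ?out \<tau>"
      using in_F[of \<tau>] bound[of \<tau>] by (cases "\<tau> 0 \<in> F") (auto intro: add_increasing)
  qed (use assms(1) in simp)
  also have "\<dots> = a * L k (\<lambda>_. 1) \<omega> + b * L k ?out \<omega>"
    by (simp only: transfer_add transfer_cmult)
  also have "\<dots> \<le> a * ennreal C + b * ennreal (1/4)"
    using assms(1) by (intro add_mono mult_left_mono transfer_one_le transfer_outside_le) auto
  finally show ?thesis .
qed

lemma harnack:
  assumes v: "length v \<le> m" and \<omega>: "\<omega> \<in> E (m + k)" and \<omega>': "\<omega>' \<in> E (m + N + k)" "\<omega>' 0 \<in> F"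
  shows "Lpow k m (indicator (cyl v)) \<omega> \<le> ennreal ((1/4) ^ (m - length v) * C ^ length v)
    + ennreal harnack_const * Lpow k (m + N) (indicator (cyl v)) \<omega>'"
proof -
  define y where "y = Lpow k (m + N) (indicator (cyl v)) \<omega>'"
  define err where "err i = (1/4) ^ (i - length v) * C ^ length v" for i
  have err_nonneg: "0 \<le> err i" for i using C_ge_1 by (simp add: err_def)
  have "Lpow k i (indicator (cyl v)) \<omega> \<le> ennreal (err i) + ennreal harnack_const * y"
    if "length v \<le> i" "i \<le> m" "\<omega> \<in> E (i + k)" for i \<omega>
    using that
  proof (induction i arbitrary: \<omega> rule: dec_induct)
    case base
    then show ?case using Lpow_indicator_le[of \<omega> "length v" k]
      by (simp add: err_def add_increasing2)
  next
    case (step i)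
    have "Lpow k (Suc i) (indicator (cyl v)) \<omega>
        \<le> ennreal (dist_const / w) * y * ennreal C
          + (ennreal (err i) + ennreal harnack_const * y) * ennreal (1/4)"
      unfolding Lpow_Suc
    proof (rule transfer_le_of_inF)
      fix \<tau> assume "\<tau> \<in> E (i + k)" "\<tau> 0 \<in> F"
      then show "Lpow k i (indicator (cyl v)) \<tau> \<le> ennreal (dist_const / w) * y"
        using Lpow_cyl_le_of_inF[of v i "m + N - i" \<tau> k \<omega>'] step \<omega>'
        by (simp add: y_def add.commute add.left_commute)
    qed (use step in auto)
    also have "\<dots> = ennreal (err i) * ennreal (1/4)
        + (ennreal (dist_const / w) * ennreal C + ennreal harnack_const * ennreal (1/4)) * y"
      by (simp add: algebra_simps)
    also have "ennreal (err i) * ennreal (1/4) = ennreal (err (Suc i))"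
      using step by (subst ennreal_mult[symmetric])
        (simp_all add: err_nonneg, simp add: err_def Suc_diff_le)
    also have "ennreal (dist_const / w) * ennreal C + ennreal harnack_const * ennreal (1/4)
        = ennreal harnack_const"
      using dist_const_pos w_pos C_ge_1 harnack_const_pos
      by (simp add: ennreal_mult[symmetric] ennreal_plus[symmetric] harnack_const_def field_simps
        del: ennreal_plus)
    finally show ?case .
  qed
  from this[OF v order_refl \<omega>] show ?thesis by (simp add: y_def err_def)
qed

end


section \<open>Uniqueness of bounded conformal sequences\<close>

lemma ex_maximal_multiple:
  fixes a b :: "'i \<Rightarrow> real"
  assumes "\<And>i. 0 \<le> a i" "\<And>i. 0 \<le> b i" "0 < a j"
  shows "\<exists>t\<ge>0. (\<forall>i. t * a i \<le> b i) \<and> (\<forall>s. (\<forall>i. s * a i \<le> b i) \<longrightarrow> s \<le> t)"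
proof -
  define t where "t = (INF i\<in>{i. 0 < a i}. b i / a i)"
  have nonempty: "{i. 0 < a i} \<noteq> {}" using assms(3) by blast
  have "t * a i \<le> b i" for i
  proof (cases "a i = 0")
    case False
    then have "0 < a i" using assms(1)[of i] by simp
    then have "t \<le> b i / a i"
      unfolding t_def using assms by (intro cINF_lower bdd_belowI2[of _ 0]) auto
    then show ?thesis using \<open>0 < a i\<close> by (simp add: field_simps)
  qed (use assms in simp)
  moreover have "s \<le> t" if "\<And>i. s * a i \<le> b i" for s
    unfolding t_def using that by (intro cINF_greatest nonempty) (simp add: field_simps)
  moreover from this[of 0] have "0 \<le> t" using assms(2) by simp
  ultimately show ?thesis by blast
qed

context fine_orbit begin

abbreviation conformal :: "nat \<Rightarrow> (nat \<Rightarrow> (nat \<Rightarrow> nat) measure) \<Rightarrow> bool" where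
  "conformal \<equiv> conformal_upto \<theta> A \<phi> x"

abbreviation bdd_conformal :: "(nat \<Rightarrow> (nat \<Rightarrow> nat) measure) \<Rightarrow> bool" where
  "bdd_conformal \<equiv> bounded_conformal \<theta> A \<phi> x"

lemma bounded_imp_conformal: "bdd_conformal \<mu> \<Longrightarrow> conformal n \<mu>"
  by (simp add: bounded_conformal_def conformal_seq_def)

lemma nn_integral_conformal:
  assumes \<mu>: "conformal n \<mu>" and "m + k \<le> n" and u: "u \<in> borel_measurable borel"
  shows "(\<integral>\<^sup>+ \<omega>. u \<omega> \<partial>\<mu> k) = (\<integral>\<^sup>+ \<omega>. Lpow k m u \<omega> \<partial>\<mu> (m + k))"
  using \<open>m + k \<le> n\<close>
proof (induction m)
  case (Suc m)
  have "(\<integral>\<^sup>+ \<omega>. u \<omega> \<partial>\<mu> k) = (\<integral>\<^sup>+ \<omega>. Lpow k m u \<omega> \<partial>dual_transfer A \<phi> ((\<theta> ^^ (m + k)) x)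
      (\<mu> (Suc (m + k))))"
    using Suc conformal_upto_eq[OF \<mu>, of "m + k"] by simp
  also have "\<dots> = (\<integral>\<^sup>+ \<omega>. Lpow k (Suc m) u \<omega> \<partial>\<mu> (Suc m + k))"
    using Suc.prems conformal_uptoD(2)[OF \<mu>, of "Suc (m + k)"]
    by (simp add: nn_integral_dual_transfer measurable_Lpow[OF u] phi_measurable Lpow_Suc
      del: transfer_pow.simps)
  finally show ?case .
qed simp

lemma emeasure_conformal:
  assumes "conformal n \<mu>" "m + k \<le> n" "B \<in> sets borel"
  shows "emeasure (\<mu> k) B = (\<integral>\<^sup>+ \<omega>. Lpow k m (indicator B) \<omega> \<partial>\<mu> (m + k))"
  using nn_integral_conformal[OF assms(1,2), of "indicator B"] conformal_uptoD(2)[OF assms(1), of k]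
    assms(2,3) by simp

lemma measure_conformal_le:
  assumes \<mu>: "conformal n \<mu>" and n: "m + k \<le> n" and B: "B \<in> sets borel" "B' \<in> sets borel"
    and "0 \<le> c"
    and transfer_le: "\<And>\<omega>. \<omega> \<in> E (m + k) \<Longrightarrow> Lpow k m (indicator B) \<omega> \<le> ennreal c * indicator B' \<omega>"
  shows "measure (\<mu> k) B \<le> c * measure (\<mu> (m + k)) B'"
proof -
  note \<mu>_props = conformal_uptoD[OF \<mu> n]
  interpret k: finite_measure "\<mu> k" by (rule conformal_uptoD[OF \<mu>]) (use n in simp)
  interpret mk: finite_measure "\<mu> (m + k)" by (rule \<mu>_props)
  have "emeasure (\<mu> k) B \<le> (\<integral>\<^sup>+ \<omega>. ennreal c * indicator B' \<omega> \<partial>\<mu> (m + k))"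
    unfolding emeasure_conformal[OF \<mu> n B(1)]
    using \<mu>_props(3) by (intro nn_integral_mono_AE) (auto elim!: eventually_mono intro: transfer_le)
  also have "\<dots> = ennreal c * emeasure (\<mu> (m + k)) B'"
    using B \<mu>_props(2) by (simp add: nn_integral_cmult_indicator)
  finally show ?thesis
    using \<open>0 \<le> c\<close> by (simp add: k.emeasure_eq_measure mk.emeasure_eq_measure
      ennreal_mult[symmetric])
qed

lemma measure_conformal_ge:
  assumes \<mu>: "conformal n \<mu>" and n: "m + k \<le> n" and B: "B \<in> sets borel" "B' \<in> sets borel"
    and "0 \<le> c"
    and transfer_le: "\<And>\<omega>. \<omega> \<in> E (m + k) \<Longrightarrow> ennreal c * indicator B' \<omega> \<le> Lpow k m (indicator B) \<omega>"
  shows "c * measure (\<mu> (m + k)) B' \<le> measure (\<mu> k) B"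
proof -
  note \<mu>_props = conformal_uptoD[OF \<mu> n]
  interpret k: finite_measure "\<mu> k" by (rule conformal_uptoD[OF \<mu>]) (use n in simp)
  interpret mk: finite_measure "\<mu> (m + k)" by (rule \<mu>_props)
  have "ennreal c * emeasure (\<mu> (m + k)) B' = (\<integral>\<^sup>+ \<omega>. ennreal c * indicator B' \<omega> \<partial>\<mu> (m + k))"
    using B \<mu>_props(2) by (simp add: nn_integral_cmult_indicator)
  also have "\<dots> \<le> emeasure (\<mu> k) B"
    unfolding emeasure_conformal[OF \<mu> n B(1)]
    using \<mu>_props(3) by (intro nn_integral_mono_AE) (auto elim!: eventually_mono intro: transfer_le)
  finally show ?thesis
    using \<open>0 \<le> c\<close> by (simp add: k.emeasure_eq_measure mk.emeasure_eq_measure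
      ennreal_mult[symmetric])
qed

lemma measure_le_mass: "conformal n \<mu> \<Longrightarrow> k \<le> n \<Longrightarrow> measure (\<mu> k) B \<le> measure (\<mu> k) UNIV"
  using finite_measure.bounded_measure[OF conformal_uptoD(1)] conformal_uptoD(4) by metis

lemma mass_le_pow:
  "conformal n \<mu> \<Longrightarrow> m + k \<le> n \<Longrightarrow> measure (\<mu> k) UNIV \<le> C ^ m * measure (\<mu> (m + k)) UNIV"
  using C_ge_1 by (intro measure_conformal_le)
    (auto intro: Lpow_indicator_le simp del: indicator_UNIV)

lemma inF_ge:
  assumes \<mu>: "conformal n \<mu>" and "N \<le> m" "m + k \<le> n"
  shows "w * measure (\<mu> (m + k)) inF \<le> measure (\<mu> k) inF"
proof (rule measure_conformal_ge[OF \<mu> \<open>m + k \<le> n\<close>])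
  fix \<omega> assume \<omega>: "\<omega> \<in> E (m + k)"
  have "Lpow k m (indicator {\<tau>. \<tau> 0 = p 0 0}) \<omega> \<le> Lpow k m (indicator inF) \<omega>"
    using base_point(2)[of 0] by (intro Lpow_mono[OF \<omega>]) (auto simp: indicator_def)
  with access[OF \<open>N \<le> m\<close> base_point(2)[of 0] \<omega>]
  show "ennreal w * indicator inF \<omega> \<le> Lpow k m (indicator inF) \<omega>"
    by (cases "\<omega> 0 \<in> F") auto
qed (use w_pos in auto)

lemma mass_le_inF_add:
  assumes \<mu>: "conformal n \<mu>" and k: "Suc k \<le> n"
  shows "measure (\<mu> k) UNIV \<le> measure (\<mu> k) inF + 1 / 4 * measure (\<mu> (Suc k)) UNIV"
proof -
  note \<mu>_props = conformal_uptoD[OF \<mu> Suc_leD[OF k]]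
  interpret finite_measure "\<mu> k" by (rule \<mu>_props)
  have "measure (\<mu> k) UNIV = measure (\<mu> k) inF + measure (\<mu> k) {\<tau>. \<tau> 0 \<in> - F}"
    by (subst finite_measure_Union[symmetric])
      (auto simp: \<mu>_props intro!: arg_cong[where f="measure (\<mu> k)"])
  moreover have "measure (\<mu> k) {\<tau>. \<tau> 0 \<in> - F} \<le> 1 / 4 * measure (\<mu> (1 + k)) UNIV"
    using transfer_outside_le[of _ k] k by (intro measure_conformal_le[OF \<mu>]) auto
  ultimately show ?thesis by simp
qed

lemma mass_le_inF_of_far:
  assumes \<mu>: "conformal n \<mu>" and "N + k \<le> j" "j \<le> n"
  shows "w * measure (\<mu> j) UNIV \<le> 4 / 3 * measure (\<mu> k) inF
      + w * measure (\<mu> n) UNIV * (1/4) ^ (n - j)"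
  using \<open>j \<le> n\<close> \<open>N + k \<le> j\<close>
proof (induction j rule: inc_induct)
  case (step j)
  let ?R = "w * measure (\<mu> n) UNIV * (1/4) ^ (n - Suc j)"
  have "w * measure (\<mu> j) inF \<le> measure (\<mu> k) inF"
    using inF_ge[OF \<mu>, of "j - k" k] step by simp
  moreover have "w * measure (\<mu> j) UNIV
      \<le> w * measure (\<mu> j) inF + 1 / 4 * (w * measure (\<mu> (Suc j)) UNIV)"
    using mult_left_mono[OF mass_le_inF_add[OF \<mu>, of j], of w] step w_pos
    by (simp add: algebra_simps)
  moreover have "w * measure (\<mu> (Suc j)) UNIV \<le> 4 / 3 * measure (\<mu> k) inF + ?R" using step by simp
  moreover have "n - j = Suc (n - Suc j)" using step by simp
  ultimately show ?case by simp
qed simp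

lemma mass_le_inF:
  assumes \<mu>: "conformal n \<mu>" and "k \<le> j" "N + j \<le> n"
  shows "w * measure (\<mu> j) UNIV \<le> C ^ N
      * (4 / 3 * measure (\<mu> k) inF + w * measure (\<mu> n) UNIV * (1/4) ^ (n - (N + j)))"
proof -
  have "w * measure (\<mu> j) UNIV \<le> C ^ N * (w * measure (\<mu> (N + j)) UNIV)"
    using mass_le_pow[OF \<mu> \<open>N + j \<le> n\<close>] w_pos by (simp add: mult.left_commute)
  also have "\<dots> \<le> C ^ N * (4 / 3 * measure (\<mu> k) inF
      + w * measure (\<mu> n) UNIV * (1/4) ^ (n - (N + j)))"
    using assms C_ge_1 by (intro mult_left_mono mass_le_inF_of_far) auto
  finally show ?thesis .
qed

lemma harnack_measure:
  assumes \<mu>: "conformal (m + k) \<mu>" and \<nu>: "conformal (m + N + k) \<nu>" and v: "length v \<le> m"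
  shows "measure (\<mu> k) (cyl v) * measure (\<nu> (m + N + k)) inF \<le>
    measure (\<mu> (m + k)) UNIV * ((1/4) ^ (m - length v) * C ^ length v * measure (\<nu> (m + N + k)) inF
      + harnack_const * measure (\<nu> k) (cyl v))"
proof -
  let ?err = "(1/4) ^ (m - length v) * C ^ length v" and ?z = "emeasure (\<mu> (m + k)) UNIV"
    and ?y = "Lpow k (m + N) (indicator (cyl v))" and ?\<nu> = "\<nu> (m + N + k)"
  note \<mu>_props = conformal_uptoD[OF \<mu> order_refl] and \<nu>_props = conformal_uptoD[OF \<nu> order_refl]
  have finite: "finite_measure (\<mu> k)" "finite_measure (\<nu> k)"
    using conformal_uptoD(1)[OF \<mu>, of k] conformal_uptoD(1)[OF \<nu>, of k] by simp_all
  have measurable: "?y \<in> borel_measurable ?\<nu>" "(indicator inF :: _ \<Rightarrow> ennreal) \<in> borel_measurable ?\<nu>"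
    unfolding measurable_cong_sets[OF \<nu>_props(2) refl]
    by (intro measurable_Lpow) auto
  have pointwise_le: "emeasure (\<mu> k) (cyl v) \<le> ?z * (ennreal ?err + ennreal harnack_const * ?y \<omega>')"
    if "\<omega>' \<in> E (m + N + k)" "\<omega>' 0 \<in> F" for \<omega>'
  proof -
    have "emeasure (\<mu> k) (cyl v) \<le> (\<integral>\<^sup>+ \<omega>. ennreal ?err + ennreal harnack_const * ?y \<omega>' \<partial>\<mu> (m + k))"
      unfolding emeasure_conformal[OF \<mu> order_refl sets_cyl]
      using \<mu>_props(3) by (intro nn_integral_mono_AE)
        (auto elim!: eventually_mono intro: harnack v that)
    then show ?thesis by (simp add: \<mu>_props(4) mult.commute)
  qed
  have "emeasure (\<mu> k) (cyl v) * emeasure ?\<nu> inF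
      = (\<integral>\<^sup>+ \<omega>'. emeasure (\<mu> k) (cyl v) * indicator inF \<omega>' \<partial>?\<nu>)"
    by (subst nn_integral_cmult_indicator) (auto simp: \<nu>_props)
  also have "\<dots> \<le> (\<integral>\<^sup>+ \<omega>'. ?z * (ennreal ?err * indicator inF \<omega>'
      + ennreal harnack_const * ?y \<omega>') \<partial>?\<nu>)"
    using \<nu>_props(3)
  proof (intro nn_integral_mono_AE, elim eventually_mono)
    fix \<omega>' assume "\<omega>' \<in> E (m + N + k)"
    then show "emeasure (\<mu> k) (cyl v) * indicator inF \<omega>'
        \<le> ?z * (ennreal ?err * indicator inF \<omega>' + ennreal harnack_const * ?y \<omega>')"
      using pointwise_le[of \<omega>'] by (cases "\<omega>' 0 \<in> F") auto
  qed
  also have "\<dots> = ?z * (ennreal ?err * emeasure ?\<nu> inF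
      + ennreal harnack_const * emeasure (\<nu> k) (cyl v))"
    using emeasure_conformal[OF \<nu>, of "m + N" k "cyl v"] measurable \<nu>_props(2)
    by (simp add: nn_integral_cmult nn_integral_add)
  finally show ?thesis
    using C_ge_1 harnack_const_pos
    by (simp add: finite_measure.emeasure_eq_measure \<mu>_props \<nu>_props finite ennreal_mult'[symmetric]
      ennreal_plus[symmetric] del: ennreal_plus)
qed

definition mass_const :: real where
  "mass_const = 4 * C ^ N / (3 * w)"

lemma mass_const_pos: "0 < mass_const"
  using C_ge_1 w_pos by (simp add: mass_const_def)

lemma bounded_mass_le_inF:
  assumes \<mu>: "bdd_conformal \<mu>" and "k \<le> j"
  shows "measure (\<mu> j) UNIV \<le> mass_const * measure (\<mu> k) inF"
proof -
  obtain K where K: "\<And>n. measure (\<mu> n) UNIV \<le> K" using \<mu> by (auto simp: bounded_conformal_def)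
  have "w * measure (\<mu> j) UNIV \<le> C ^ N * (4 / 3 * measure (\<mu> k) inF + w * K * (1/4) ^ i)" for i
  proof -
    have "w * measure (\<mu> j) UNIV \<le> C ^ N
        * (4 / 3 * measure (\<mu> k) inF + w * measure (\<mu> (i + (N + j))) UNIV * (1/4) ^ i)"
      using mass_le_inF[OF bounded_imp_conformal[OF \<mu>] \<open>k \<le> j\<close>, of "i + (N + j)"] by simp
    also have "\<dots> \<le> C ^ N * (4 / 3 * measure (\<mu> k) inF + w * K * (1/4) ^ i)"
      using K w_pos C_ge_1 by (intro mult_left_mono add_left_mono mult_right_mono) auto
    finally show ?thesis .
  qed
  moreover have "(\<lambda>i. C ^ N * (4 / 3 * measure (\<mu> k) inF + w * K * (1/4) ^ i))
      \<longlonglongrightarrow> C ^ N * (4 / 3 * measure (\<mu> k) inF + w * K * 0)"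
    by (intro tendsto_intros LIMSEQ_power_zero) simp
  ultimately have "w * measure (\<mu> j) UNIV \<le> C ^ N * (4 / 3 * measure (\<mu> k) inF + w * K * 0)"
    by (intro LIMSEQ_le_const) auto
  then show ?thesis using w_pos by (simp add: mass_const_def field_simps)
qed

lemma bounded_mass_le:
  assumes \<mu>: "bdd_conformal \<mu>" and "k \<le> j"
  shows "measure (\<mu> j) UNIV \<le> mass_const * measure (\<mu> k) UNIV"
  using bounded_mass_le_inF[OF assms]
    measure_le_mass[OF bounded_imp_conformal[OF \<mu>] order_refl, of k inF] mass_const_pos
  by (meson mult_left_mono less_imp_le order_trans)

lemma bounded_mass_ratio_le:
  assumes \<mu>: "bdd_conformal \<mu>" and \<nu>: "bdd_conformal \<nu>"
  defines "R \<equiv> 2 * harnack_const * mass_const * C ^ N"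
  shows "\<forall>\<^sub>F m in sequentially.
    measure (\<nu> 0) UNIV * measure (\<mu> m) UNIV \<le> R * measure (\<mu> 0) UNIV * measure (\<nu> m) UNIV"
proof -
  have "(\<lambda>m. (1/4) ^ m * mass_const) \<longlonglongrightarrow> 0 * mass_const"
    by (intro tendsto_intros LIMSEQ_power_zero) simp
  then have "\<forall>\<^sub>F m in sequentially. (1/4) ^ m * mass_const < 1 / 2"
    by (rule order_tendstoD) simp
  then show ?thesis
  proof eventually_elim
    case (elim m)
    let ?f = "measure (\<mu> (m + N)) inF" and ?y = "\<lambda>k. measure (\<nu> k) UNIV"
      and ?z = "\<lambda>k. measure (\<mu> k) UNIV"
    have "(1/4) ^ m * ?y m \<le> (1/4) ^ m * (mass_const * ?y 0)"
      using bounded_mass_le[OF \<nu>] by (intro mult_left_mono) auto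
    also have "\<dots> \<le> 1 / 2 * ?y 0"
      using mult_right_mono[OF less_imp_le[OF elim], of "?y 0"] by (simp add: mult.assoc)
    finally have "(1/4) ^ m * ?y m * ?f \<le> 1 / 2 * ?y 0 * ?f" by (intro mult_right_mono) auto
    moreover have "?y 0 * ?f \<le> ?y m * ((1/4) ^ m * ?f + harnack_const * ?z 0)"
      using harnack_measure[OF bounded_imp_conformal[OF \<nu>] bounded_imp_conformal[OF \<mu>], of "[]" m 0]
      by simp
    ultimately have y0: "?y 0 * ?f \<le> 2 * harnack_const * ?z 0 * ?y m" by (simp add: algebra_simps)
    have "?z m \<le> C ^ N * ?z (m + N)"
      using mass_le_pow[OF bounded_imp_conformal[OF \<mu>] order_refl, of m N]
      by (simp add: add.commute)
    also have "\<dots> \<le> C ^ N * (mass_const * ?f)"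
      using bounded_mass_le_inF[OF \<mu> order_refl, of "m + N"] C_ge_1 by (intro mult_left_mono) auto
    finally have "?y 0 * ?z m \<le> ?y 0 * (C ^ N * (mass_const * ?f))" by (rule mult_left_mono) simp
    also have "\<dots> = C ^ N * mass_const * (?y 0 * ?f)" by (simp only: ac_simps)
    also have "\<dots> \<le> C ^ N * mass_const * (2 * harnack_const * ?z 0 * ?y m)"
      using C_ge_1 mass_const_pos by (intro mult_left_mono y0) auto
    finally show ?case by (simp add: R_def mult_ac)
  qed
qed

lemma bounded_measure_cyl_le_add:
  assumes \<mu>: "bdd_conformal \<mu>" and \<nu>: "bdd_conformal \<nu>" "0 < measure (\<nu> 0) UNIV"
    and v: "length v \<le> m"
    and ratio: "measure (\<mu> (m + N + k)) UNIV \<le> R * measure (\<nu> (m + N + k)) UNIV" and "0 \<le> R"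
  shows "measure (\<mu> k) (cyl v) \<le> measure (\<mu> (m + k)) UNIV * ((1/4) ^ (m - length v) * C ^ length v)
    + C ^ N * R * mass_const * harnack_const * measure (\<nu> k) (cyl v)"
proof -
  note \<mu>_conformal = bounded_imp_conformal[OF \<mu>] and \<nu>_conformal = bounded_imp_conformal[OF \<nu>(1)]
  let ?f = "measure (\<nu> (m + N + k)) inF" and ?err = "(1/4) ^ (m - length v) * C ^ length v"
  have \<nu>_le: "measure (\<nu> (m + N + k)) UNIV \<le> mass_const * ?f"
    by (rule bounded_mass_le_inF[OF \<nu>(1) order_refl])
  have "0 < C ^ (m + N + k) * measure (\<nu> (m + N + k)) UNIV"
    using mass_le_pow[OF \<nu>_conformal order_refl, of 0 "m + N + k"] \<nu>(2) by simp
  then have "0 < measure (\<nu> (m + N + k)) UNIV" using C_ge_1 by (simp add: zero_less_mult_iff)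
  then have "0 < mass_const * ?f" using \<nu>_le by (rule less_le_trans)
  then have f_pos: "0 < ?f" using mass_const_pos by (simp add: zero_less_mult_iff)
  have "measure (\<mu> (m + k)) UNIV \<le> C ^ N * measure (\<mu> (m + N + k)) UNIV"
    using mass_le_pow[OF \<mu>_conformal order_refl, of "m + k" N] by (simp add: add_ac)
  also have "\<dots> \<le> C ^ N * (R * (mass_const * ?f))"
    using C_ge_1 \<open>0 \<le> R\<close> by (intro mult_left_mono order_trans[OF ratio] \<nu>_le) auto
  finally have \<mu>_le: "measure (\<mu> (m + k)) UNIV \<le> C ^ N * R * mass_const * ?f" by (simp add: mult_ac)
  have "measure (\<mu> k) (cyl v) * ?f \<le> measure (\<mu> (m + k)) UNIV
      * (?err * ?f + harnack_const * measure (\<nu> k) (cyl v))"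
    by (rule harnack_measure[OF \<mu>_conformal \<nu>_conformal v])
  also have "\<dots> = measure (\<mu> (m + k)) UNIV * (?err * ?f)
      + measure (\<mu> (m + k)) UNIV * (harnack_const * measure (\<nu> k) (cyl v))"
    by (rule distrib_left)
  also have "\<dots> \<le> measure (\<mu> (m + k)) UNIV * (?err * ?f)
      + C ^ N * R * mass_const * ?f * (harnack_const * measure (\<nu> k) (cyl v))"
    using \<mu>_le harnack_const_pos by (intro add_left_mono mult_right_mono) auto
  finally have "measure (\<mu> k) (cyl v) * ?f \<le> (measure (\<mu> (m + k)) UNIV * ?err
      + C ^ N * R * mass_const * harnack_const * measure (\<nu> k) (cyl v)) * ?f"
    by (simp add: algebra_simps)
  then show ?thesis using f_pos by simp
qed

lemma bounded_dominated:
  assumes \<mu>: "bdd_conformal \<mu>" "0 < measure (\<mu> 0) UNIV"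
    and \<nu>: "bdd_conformal \<nu>" "0 < measure (\<nu> 0) UNIV"
  obtains S where "0 < S" "\<And>k v. measure (\<mu> k) (cyl v) \<le> S * measure (\<nu> k) (cyl v)"
proof -
  define R where "R = 2 * harnack_const * mass_const * C ^ N
      * measure (\<mu> 0) UNIV / measure (\<nu> 0) UNIV"
  define S where "S = C ^ N * R * mass_const * harnack_const"
  have R: "0 < R" using harnack_const_pos mass_const_pos C_ge_1 \<mu>(2) \<nu>(2) by (simp add: R_def)
  then have S: "0 < S" using mass_const_pos harnack_const_pos C_ge_1 by (simp add: S_def)
  have ratio: "\<forall>\<^sub>F n in sequentially. measure (\<mu> n) UNIV \<le> R * measure (\<nu> n) UNIV"
    using bounded_mass_ratio_le[OF \<mu>(1) \<nu>(1)]
    by eventually_elim (use \<nu>(2) in \<open>simp add: R_def field_simps\<close>)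
  obtain K where K: "\<And>k. measure (\<mu> k) UNIV \<le> K" using \<mu>(1) by (auto simp: bounded_conformal_def)
  have "measure (\<mu> k) (cyl v) \<le> S * measure (\<nu> k) (cyl v)" for k v
  proof (rule tendsto_lowerbound)
    have "(\<lambda>m. K * ((1/4) ^ m * C ^ length v) + S * measure (\<nu> k) (cyl v))
        \<longlonglongrightarrow> K * (0 * C ^ length v) + S * measure (\<nu> k) (cyl v)"
      by (intro tendsto_intros LIMSEQ_power_zero) simp
    then show "(\<lambda>m. K * ((1/4) ^ m * C ^ length v) + S * measure (\<nu> k) (cyl v))
        \<longlonglongrightarrow> S * measure (\<nu> k) (cyl v)" by simp
    have "\<forall>\<^sub>F m in sequentially. measure (\<mu> (m + (length v + N + k))) UNIV
        \<le> R * measure (\<nu> (m + (length v + N + k))) UNIV"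
      by (rule eventually_compose_filterlim[OF ratio filterlim_add_const_nat_at_top])
    then show "\<forall>\<^sub>F m in sequentially. measure (\<mu> k) (cyl v)
        \<le> K * ((1/4) ^ m * C ^ length v) + S * measure (\<nu> k) (cyl v)"
    proof eventually_elim
      case (elim m)
      then have "measure (\<mu> k) (cyl v)
          \<le> measure (\<mu> (m + length v + k)) UNIV * ((1/4) ^ m * C ^ length v)
            + S * measure (\<nu> k) (cyl v)"
        using bounded_measure_cyl_le_add[OF \<mu>(1) \<nu>, of v "m + length v" k R] R
        by (simp add: S_def add_ac)
      also have "\<dots> \<le> K * ((1/4) ^ m * C ^ length v) + S * measure (\<nu> k) (cyl v)"
        using K C_ge_1 by (intro add_right_mono mult_right_mono) auto
      finally show ?case .
    qed
  qed simp
  with S that show thesis by blast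
qed

lemma bounded_diff:
  assumes \<mu>: "bdd_conformal \<mu>" and \<mu>': "bdd_conformal \<mu>'" and "0 \<le> t"
    and cyl_le: "\<And>k v. t * measure (\<mu> k) (cyl v) \<le> measure (\<mu>' k) (cyl v)"
  obtains \<nu> where "bdd_conformal \<nu>"
    "\<And>k B. B \<in> sets borel \<Longrightarrow> measure (\<mu>' k) B = measure (\<nu> k) B + t * measure (\<mu> k) B"
proof -
  obtain K where \<mu>s: "conformal_seq \<theta> A \<phi> x \<mu>" and \<mu>'s: "conformal_seq \<theta> A \<phi> x \<mu>'"
    and K: "\<And>k. measure (\<mu>' k) UNIV \<le> K" using \<mu> \<mu>' by (auto simp: bounded_conformal_def)
  obtain \<nu> where \<nu>: "conformal_seq \<theta> A \<phi> x \<nu>"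
    "\<And>k. \<mu>' k = add_measure (\<nu> k) (scale_measure (ennreal t) (\<mu> k))"
    using conformal_seq_diff[OF conformal_seq_scale_measure[OF \<mu>s phi_measurable] \<mu>'s
        phi_measurable, of t] cyl_le \<open>0 \<le> t\<close> by auto
  note \<mu>_props = conformal_seqD[OF \<mu>s] and \<mu>'_props = conformal_seqD[OF \<mu>'s]
    and \<nu>_props = conformal_seqD[OF \<nu>(1)]
  have \<mu>'_eq: "measure (\<mu>' k) B = measure (\<nu> k) B + t * measure (\<mu> k) B" if "B \<in> sets borel" for k B
  proof -
    have "emeasure (\<mu>' k) B = emeasure (\<nu> k) B + ennreal t * emeasure (\<mu> k) B"
      using that unfolding \<nu>(2) by (subst emeasure_add_measure)
        (simp_all add: \<mu>_props(2) \<nu>_props(2))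
    then show ?thesis
      using \<open>0 \<le> t\<close> by (simp add: finite_measure.emeasure_eq_measure \<mu>_props(1) \<mu>'_props(1)
        \<nu>_props(1) ennreal_mult[symmetric] ennreal_plus[symmetric] del: ennreal_plus)
  qed
  have "measure (\<nu> k) UNIV \<le> K" for k
  proof -
    have "measure (\<nu> k) UNIV \<le> measure (\<mu>' k) UNIV" using \<open>0 \<le> t\<close> by (simp add: \<mu>'_eq)
    also have "\<dots> \<le> K" by (rule K)
    finally show ?thesis .
  qed
  with \<nu>(1) \<mu>'_eq that show thesis by (auto simp: bounded_conformal_def)
qed

theorem bounded_conformal_unique:
  assumes \<mu>: "bdd_conformal \<mu>" "measure (\<mu> 0) UNIV = 1"
    and \<mu>': "bdd_conformal \<mu>'" "measure (\<mu>' 0) UNIV = 1"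
  shows "\<mu> = \<mu>'"
proof -
  let ?a = "\<lambda>\<mu> i. measure (\<mu> (fst i)) (cyl (snd i))"
  obtain t where t: "0 \<le> t" "\<And>i. t * ?a \<mu> i \<le> ?a \<mu>' i"
    and maximal: "\<And>s. \<forall>i. s * ?a \<mu> i \<le> ?a \<mu>' i \<Longrightarrow> s \<le> t"
    using ex_maximal_multiple[of "?a \<mu>" "?a \<mu>'" "(0, [])"] \<mu>(2) by auto
  obtain \<nu> where \<nu>: "bdd_conformal \<nu>"
    and \<mu>'_eq: "\<And>k B. B \<in> sets borel \<Longrightarrow> measure (\<mu>' k) B = measure (\<nu> k) B + t * measure (\<mu> k) B"
    using bounded_diff[OF \<mu>(1) \<mu>'(1) t(1)] t(2)[of "(_, _)"] by (metis fst_conv snd_conv)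
  have \<nu>_0: "measure (\<nu> 0) UNIV = 0"
  proof (rule ccontr)
    assume "measure (\<nu> 0) UNIV \<noteq> 0"
    then have "0 < measure (\<nu> 0) UNIV" by (simp add: less_le)
    then obtain S where S: "0 < S" "\<And>k v. measure (\<mu> k) (cyl v) \<le> S * measure (\<nu> k) (cyl v)"
      using bounded_dominated[OF \<mu>(1) _ \<nu>] \<mu>(2) by (metis zero_less_one)
    have "t + 1 / S \<le> t"
    proof (rule maximal, intro allI)
      fix i show "(t + 1 / S) * ?a \<mu> i \<le> ?a \<mu>' i"
        using S(2)[of "fst i" "snd i"] S(1) \<mu>'_eq[of "cyl (snd i)" "fst i"]
        by (simp add: field_simps)
    qed
    then show False using S(1) by simp
  qed
  then have "t = 1" using \<mu>'_eq[of UNIV 0] \<mu>(2) \<mu>'(2) by simp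
  have \<nu>_null: "measure (\<nu> k) B = 0" for k B
    using bounded_mass_le[OF \<nu>, of 0 k] measure_le_mass[OF bounded_imp_conformal[OF \<nu>], of k k B]
    by (simp add: \<nu>_0 order_antisym)
  show ?thesis
  proof
    fix k
    note \<mu>_props = conformal_uptoD[OF bounded_imp_conformal[OF \<mu>(1)] order_refl]
      and \<mu>'_props = conformal_uptoD[OF bounded_imp_conformal[OF \<mu>'(1)] order_refl]
    show "\<mu> k = \<mu>' k"
      using \<mu>'_eq[of "cyl _" k] \<open>t = 1\<close> finite_measure.emeasure_finite[OF \<mu>_props(1)]
      by (intro measure_eqI_cyl) (simp_all add: \<mu>_props(1,2) \<mu>'_props(1,2) \<nu>_null
        finite_measure.emeasure_eq_measure)
  qed
qed

end


section \<open>Existence of bounded conformal sequences\<close>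

lemma tendsto_of_subsubseq:
  fixes X :: "nat \<Rightarrow> 'b :: topological_space"
  assumes "\<And>r :: nat \<Rightarrow> nat. strict_mono r \<Longrightarrow> \<exists>s. strict_mono s \<and> (\<lambda>i. X (r (s i))) \<longlonglongrightarrow> l"
  shows "X \<longlonglongrightarrow> l"
proof (rule topological_tendstoI, rule ccontr)
  fix S assume S: "open S" "l \<in> S" and "\<not> (\<forall>\<^sub>F n in sequentially. X n \<in> S)"
  then obtain r :: "nat \<Rightarrow> nat" where r: "strict_mono r" "\<And>n. X (r n) \<notin> S"
    using not_eventually_sequentiallyD by blast
  obtain s where "(\<lambda>i. X (r (s i))) \<longlonglongrightarrow> l" using assms[OF r(1)] by blast
  from topological_tendstoD[OF this S] show False using r(2) by simp
qed

lemma measure_eq_0_if_AE_disjoint: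
  assumes "sets M = sets borel" "S \<in> sets borel" "AE \<omega> in M. \<omega> \<in> S" "B \<inter> S = {}"
  shows "measure M B = 0"
proof -
  have "emeasure M B \<le> emeasure M (- S)" by (rule emeasure_mono) (use assms in auto)
  then show ?thesis using assms by (simp add: AE_mem_iff_emeasure_Compl measure_def)
qed

context fine_orbit begin

lemma finite_measure_dual_transfer:
  assumes "finite_measure \<rho>" "sets \<rho> = sets borel" "AE \<omega> in \<rho>. \<omega> \<in> E (Suc k)"
  shows "finite_measure (dual_transfer A \<phi> ((\<theta> ^^ k) x) \<rho>)"
proof (rule finite_measureI)
  have "emeasure (dual_transfer A \<phi> ((\<theta> ^^ k) x) \<rho>) UNIV = (\<integral>\<^sup>+ \<omega>. L k (indicator UNIV) \<omega> \<partial>\<rho>)"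
    by (rule emeasure_dual_transfer) (use assms phi_measurable in auto)
  also have "\<dots> \<le> (\<integral>\<^sup>+ \<omega>. ennreal C \<partial>\<rho>)"
    using assms(3) transfer_one_le by (intro nn_integral_mono_AE) (auto elim!: eventually_mono)
  also have "\<dots> < \<infinity>"
    using finite_measure.emeasure_finite[OF assms(1)]
    by (simp add: ennreal_mult_eq_top_iff less_top[symmetric])
  finally show "emeasure (dual_transfer A \<phi> ((\<theta> ^^ k) x) \<rho>)
      (space (dual_transfer A \<phi> ((\<theta> ^^ k) x) \<rho>)) \<noteq> \<infinity>"
    by simp
qed

lemma transfer_cyl_Cons_bounds:
  assumes \<tau>: "\<tau> \<in> cyl (e # v)" "\<tau> \<in> E k" and v: "v \<noteq> []" and \<omega>: "\<omega> \<in> E (Suc k)"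
  shows "L k (indicator (cyl (e # v))) \<omega>
      \<le> ennreal (exp (\<phi> ((\<theta> ^^ k) x) \<tau> + D (length v))) * indicator (cyl v) \<omega>"
    and "ennreal (exp (\<phi> ((\<theta> ^^ k) x) \<tau> - D (length v))) * indicator (cyl v) \<omega>
        \<le> L k (indicator (cyl (e # v))) \<omega>"
proof -
  let ?\<phi> = "\<phi> ((\<theta> ^^ k) x)"
  have bounds: "A ((\<theta> ^^ k) x) e (\<omega> 0)" "?\<phi> (case_nat e \<omega>) \<le> ?\<phi> \<tau> + D (length v)"
    "?\<phi> \<tau> \<le> ?\<phi> (case_nat e \<omega>) + D (length v)"
    if "\<omega> \<in> cyl v"
  proof -
    have agree: "case_nat e \<omega> i = \<tau> i" if "i \<le> length v" for i
      using \<tau>(1) \<open>\<omega> \<in> cyl v\<close> that by (cases i) (auto simp: cyl_Cons cyl_def)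
    have "A ((\<theta> ^^ k) x) (\<tau> 0) (\<tau> (Suc 0))" using \<tau>(2)
      by (auto simp: mem_Einf_iff dest: spec[of _ 0])
    then show "A ((\<theta> ^^ k) x) e (\<omega> 0)" using agree[of 0] agree[of "Suc 0"] v
      by (simp add: Suc_le_eq)
    with \<omega> have "case_nat e \<omega> \<in> E k" by (intro case_nat_in_Einf) auto
    then show "?\<phi> (case_nat e \<omega>) \<le> ?\<phi> \<tau> + D (length v)" "?\<phi> \<tau> \<le> ?\<phi> (case_nat e \<omega>) + D (length v)"
      using agree \<tau>(2) by (auto intro: distortion)
  qed
  show "L k (indicator (cyl (e # v))) \<omega> \<le> ennreal (exp (?\<phi> \<tau> + D (length v))) * indicator (cyl v) \<omega>"
    and "ennreal (exp (?\<phi> \<tau> - D (length v))) * indicator (cyl v) \<omega>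
        \<le> L k (indicator (cyl (e # v))) \<omega>"
    unfolding transfer_indicator_cyl_Cons using bounds
    by (cases "\<omega> \<in> cyl v"; auto intro!: ennreal_leI)+
qed

lemma dual_transfer_cyl_bounds:
  assumes \<rho>: "finite_measure \<rho>" "sets \<rho> = sets borel" "AE \<omega> in \<rho>. \<omega> \<in> E (Suc k)"
    and \<tau>: "\<tau> \<in> cyl (e # v)" "\<tau> \<in> E k" and v: "v \<noteq> []"
  defines "\<kappa> \<equiv> dual_transfer A \<phi> ((\<theta> ^^ k) x) \<rho>"
  shows "measure \<kappa> (cyl (e # v)) \<le> exp (\<phi> ((\<theta> ^^ k) x) \<tau> + D (length v)) * measure \<rho> (cyl v)"
    and "exp (\<phi> ((\<theta> ^^ k) x) \<tau> - D (length v)) * measure \<rho> (cyl v) \<le> measure \<kappa> (cyl (e # v))"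
proof -
  interpret \<rho>: finite_measure \<rho> by fact
  interpret \<kappa>: finite_measure \<kappa> unfolding \<kappa>_def by (rule finite_measure_dual_transfer[OF \<rho>])
  have \<kappa>: "emeasure \<kappa> (cyl (e # v)) = (\<integral>\<^sup>+ \<omega>. L k (indicator (cyl (e # v))) \<omega> \<partial>\<rho>)"
    unfolding \<kappa>_def by (rule emeasure_dual_transfer) (use \<rho> phi_measurable in auto)
  have integral: "(\<integral>\<^sup>+ \<omega>. ennreal c * indicator (cyl v) \<omega> \<partial>\<rho>) = ennreal c * emeasure \<rho> (cyl v)"
    for c
    using \<rho>(2) by (simp add: nn_integral_cmult_indicator)
  let ?b = "exp (\<phi> ((\<theta> ^^ k) x) \<tau> + D (length v))" and ?a = "exp (\<phi> ((\<theta> ^^ k) x) \<tau> - D (length v))"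
  have "emeasure \<kappa> (cyl (e # v)) \<le> ennreal ?b * emeasure \<rho> (cyl v)"
    unfolding \<kappa> integral[symmetric]
    by (rule nn_integral_mono_AE, rule eventually_mono[OF \<rho>(3)],
      rule transfer_cyl_Cons_bounds(1)[OF \<tau> v])
  then show "measure \<kappa> (cyl (e # v)) \<le> ?b * measure \<rho> (cyl v)"
    by (simp add: \<rho>.emeasure_eq_measure \<kappa>.emeasure_eq_measure ennreal_mult[symmetric])
  have "ennreal ?a * emeasure \<rho> (cyl v) \<le> emeasure \<kappa> (cyl (e # v))"
    unfolding \<kappa> integral[symmetric]
    by (rule nn_integral_mono_AE, rule eventually_mono[OF \<rho>(3)],
      rule transfer_cyl_Cons_bounds(2)[OF \<tau> v])
  then show "?a * measure \<rho> (cyl v) \<le> measure \<kappa> (cyl (e # v))"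
    by (simp add: \<rho>.emeasure_eq_measure \<kappa>.emeasure_eq_measure ennreal_mult[symmetric])
qed

lemma dual_transfer_limit_bounds:
  assumes \<rho>: "\<forall>\<^sub>F i in sequentially. finite_measure (\<rho> i) \<and> sets (\<rho> i) = sets borel
      \<and> (AE \<omega> in \<rho> i. \<omega> \<in> E (Suc k))"
    and lim: "\<And>v. (\<lambda>i. measure (\<rho> i) (cyl v)) \<longlonglongrightarrow> m' v"
    and lim_dual: "\<And>v. (\<lambda>i. measure (dual_transfer A \<phi> ((\<theta> ^^ k) x) (\<rho> i)) (cyl v)) \<longlonglongrightarrow> m v"
    and \<tau>: "\<tau> \<in> cyl (e # v)" "\<tau> \<in> E k" and v: "v \<noteq> []"
  shows "m (e # v) \<le> exp (\<phi> ((\<theta> ^^ k) x) \<tau> + D (length v)) * m' v"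
    and "exp (\<phi> ((\<theta> ^^ k) x) \<tau> - D (length v)) * m' v \<le> m (e # v)"
proof -
  show "m (e # v) \<le> exp (\<phi> ((\<theta> ^^ k) x) \<tau> + D (length v)) * m' v"
    by (rule tendsto_le[OF _ tendsto_mult_left[OF lim] lim_dual])
      (use \<rho> in \<open>auto elim!: eventually_mono simp: dual_transfer_cyl_bounds(1)[OF _ _ _ \<tau> v]\<close>)
  show "exp (\<phi> ((\<theta> ^^ k) x) \<tau> - D (length v)) * m' v \<le> m (e # v)"
    by (rule tendsto_le[OF _ lim_dual tendsto_mult_left[OF lim]])
      (use \<rho> in \<open>auto elim!: eventually_mono simp: dual_transfer_cyl_bounds(2)[OF _ _ _ \<tau> v]\<close>)
qed

lemma dual_transfer_limit_close:
  assumes \<rho>: "\<forall>\<^sub>F i in sequentially. finite_measure (\<rho> i) \<and> sets (\<rho> i) = sets borel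
      \<and> (AE \<omega> in \<rho> i. \<omega> \<in> E (Suc k))"
    and \<mu>': "finite_measure \<mu>'" "sets \<mu>' = sets borel" "AE \<omega> in \<mu>'. \<omega> \<in> E (Suc k)"
    and lim: "\<And>v. (\<lambda>i. measure (\<rho> i) (cyl v)) \<longlonglongrightarrow> measure \<mu>' (cyl v)"
    and lim_dual: "\<And>v. (\<lambda>i. measure (dual_transfer A \<phi> ((\<theta> ^^ k) x) (\<rho> i)) (cyl v)) \<longlonglongrightarrow> m v"
    and u: "2 \<le> length u" "cyl u \<inter> E k \<noteq> {}"
  defines "\<kappa> \<equiv> dual_transfer A \<phi> ((\<theta> ^^ k) x) \<mu>'" and "d \<equiv> exp (2 * D (length u - 1))"
  shows "m u \<le> d * measure \<kappa> (cyl u)" "measure \<kappa> (cyl u) \<le> d * m u"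
proof -
  obtain e v where ev: "u = e # v" "v \<noteq> []" using u(1) by (cases u; cases "tl u") auto
  from u(2) obtain \<tau> where \<tau>: "\<tau> \<in> cyl (e # v)" "\<tau> \<in> E k" by (auto simp: ev)
  let ?a = "exp (\<phi> ((\<theta> ^^ k) x) \<tau> - D (length v)) * measure \<mu>' (cyl v)"
  have upper: "exp (\<phi> ((\<theta> ^^ k) x) \<tau> + D (length v)) * measure \<mu>' (cyl v) = d * ?a"
    by (simp add: ev d_def mult.assoc[symmetric] exp_add[symmetric])
  note \<kappa>_bounds = dual_transfer_cyl_bounds[OF \<mu>' \<tau> ev(2), folded \<kappa>_def ev(1), unfolded upper]
  note m_bounds = dual_transfer_limit_bounds[OF \<rho> lim lim_dual \<tau> ev(2),
    folded ev(1), unfolded upper]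
  have "0 \<le> d" by (simp add: d_def)
  then have "d * ?a \<le> d * measure \<kappa> (cyl u)" "d * ?a \<le> d * m u"
    using \<kappa>_bounds(2) m_bounds(2) by (simp_all add: mult_left_mono)
  then show "m u \<le> d * measure \<kappa> (cyl u)" "measure \<kappa> (cyl u) \<le> d * m u"
    using \<kappa>_bounds(1) m_bounds(1) by linarith+
qed

text \<open>The image of a cylinder function under the transfer operator is not a cylinder function, so the
  limit cannot be taken cylinder by cylinder; on long cylinders it can, up to a factor close to 1.\<close>

lemma dual_transfer_cyl_limit:
  assumes \<rho>: "\<forall>\<^sub>F i in sequentially. finite_measure (\<rho> i) \<and> sets (\<rho> i) = sets borel
      \<and> (AE \<omega> in \<rho> i. \<omega> \<in> E (Suc k))"
    and \<mu>': "finite_measure \<mu>'" "sets \<mu>' = sets borel" "AE \<omega> in \<mu>'. \<omega> \<in> E (Suc k)"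
    and \<mu>: "finite_measure \<mu>" "sets \<mu> = sets borel" "AE \<omega> in \<mu>. \<omega> \<in> E k"
    and lim: "\<And>v. (\<lambda>i. measure (\<rho> i) (cyl v)) \<longlonglongrightarrow> measure \<mu>' (cyl v)"
    and lim_dual: "\<And>v. (\<lambda>i. measure (dual_transfer A \<phi> ((\<theta> ^^ k) x) (\<rho> i)) (cyl v))
        \<longlonglongrightarrow> measure \<mu> (cyl v)"
  shows "\<mu> = dual_transfer A \<phi> ((\<theta> ^^ k) x) \<mu>'"
proof -
  define \<kappa> where "\<kappa> = dual_transfer A \<phi> ((\<theta> ^^ k) x) \<mu>'"
  interpret \<mu>: finite_measure \<mu> by fact
  interpret \<kappa>: finite_measure \<kappa> unfolding \<kappa>_def by (rule finite_measure_dual_transfer[OF \<mu>'])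
  have sets_\<kappa>: "sets \<kappa> = sets borel" by (simp add: \<kappa>_def)
  have AE_\<kappa>: "AE \<omega> in \<kappa>. \<omega> \<in> E k"
    unfolding \<kappa>_def by (rule AE_dual_transfer_Einf) (use \<mu>' phi_measurable in auto)
  define d where "d n = 2 * D (n - 1)" for n
  have close: "measure \<mu> (cyl u) \<le> exp (d (length u)) * measure \<kappa> (cyl u)
      \<and> measure \<kappa> (cyl u) \<le> exp (d (length u)) * measure \<mu> (cyl u)" if "2 \<le> length u" for u
  proof (cases "cyl u \<inter> E k = {}")
    case True
    then show ?thesis
      using measure_eq_0_if_AE_disjoint[OF \<mu>(2) sets_Einf \<mu>(3)]
        measure_eq_0_if_AE_disjoint[OF sets_\<kappa> sets_Einf AE_\<kappa>] by simp
  next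
    case False
    then show ?thesis
      using dual_transfer_limit_close[OF \<rho> \<mu>' lim lim_dual that] by (simp add: \<kappa>_def d_def)
  qed
  have "(\<lambda>n. 2 * D (Suc n - 1)) \<longlonglongrightarrow> 2 * 0"
    using summable_LIMSEQ_zero[OF D_summable] by (intro tendsto_intros) simp
  then have "d \<longlonglongrightarrow> 0"
    unfolding d_def by (subst filterlim_sequentially_Suc[symmetric]) simp
  then show ?thesis
    unfolding \<kappa>_def[symmetric]
    by (intro measure_eqI_cyl_asymp[OF \<mu>(2) _ sets_\<kappa>, where N = 2])
      (use close in \<open>auto simp: \<mu>.emeasure_eq_measure \<kappa>.emeasure_eq_measure
        ennreal_mult[symmetric]\<close>)
qed

lemma conformal_first_letter_tail:
  assumes \<mu>: "conformal n \<mu>" "Suc k \<le> n"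
  shows "measure (\<mu> k) {\<omega>. l < \<omega> 0} \<le> \<eta> l * measure (\<mu> (Suc k)) UNIV"
proof -
  have "measure (\<mu> k) {\<omega>. \<omega> 0 \<in> {l<..}} \<le> \<eta> l * measure (\<mu> (1 + k)) UNIV"
    using transfer_tail_le[of _ k l] \<mu>(2) eta_nonneg by (intro measure_conformal_le[OF \<mu>(1)]) auto
  then show ?thesis by simp
qed

lemma conformal_next_letter_tail:
  assumes "v \<noteq> []"
  obtains b where "\<And>n \<mu> l. \<lbrakk>conformal n \<mu>; k \<le> n; b \<le> l\<rbrakk>
      \<Longrightarrow> measure (\<mu> k) {\<omega> \<in> cyl v. l < \<omega> (length v)} = 0"
proof -
  define S where "S = {j. A ((\<theta> ^^ (length v - 1)) ((\<theta> ^^ k) x)) (last v) j}"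
  have "finite S" unfolding S_def using finite_range[of "length v - 1 + k"]
    by (simp add: funpow_add)
  then obtain b where b: "S \<subseteq> {..b}" using finite_nat_iff_bounded_le by blast
  have next_in_S: "\<omega> (length v) \<in> S" if "\<omega> \<in> cyl v" "\<omega> \<in> E k" for \<omega>
  proof -
    have "A ((\<theta> ^^ (length v - 1)) ((\<theta> ^^ k) x)) (\<omega> (length v - 1)) (\<omega> (Suc (length v - 1)))"
      using that(2) by (simp add: mem_Einf_iff)
    then show ?thesis using that(1) \<open>v \<noteq> []\<close> by (simp add: S_def cyl_def last_conv_nth)
  qed
  show thesis
  proof (rule that)
    fix n \<mu> l assume \<mu>: "conformal n \<mu>" "k \<le> n" and "b \<le> l"
    have "{\<omega> \<in> cyl v. l < \<omega> (length v)} \<inter> E k = {}" using b next_in_S \<open>b \<le> l\<close> by fastforce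
    then show "measure (\<mu> k) {\<omega> \<in> cyl v. l < \<omega> (length v)} = 0"
      by (rule measure_eq_0_if_AE_disjoint[OF conformal_uptoD(2)[OF \<mu>] sets_Einf
        conformal_uptoD(3)[OF \<mu>]])
  qed
qed

lemma conformal_cyl_tail:
  "\<exists>\<tau>. \<tau> \<longlonglongrightarrow> 0 \<and> (\<forall>n \<mu> l. conformal n \<mu> \<longrightarrow> Suc k \<le> n \<longrightarrow> measure (\<mu> k) UNIV \<le> K \<longrightarrow>
     measure (\<mu> (Suc k)) UNIV \<le> K \<longrightarrow> measure (\<mu> k) {\<omega> \<in> cyl v. l < \<omega> (length v)} \<le> \<tau> l)"
proof (cases "v = []")
  case True
  have "measure (\<mu> k) {\<omega> \<in> cyl v. l < \<omega> (length v)} \<le> \<eta> l * K"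
    if "conformal n \<mu>" "Suc k \<le> n" "measure (\<mu> (Suc k)) UNIV \<le> K" for n \<mu> l
    using order_trans[OF conformal_first_letter_tail[OF that(1,2)]
      mult_left_mono[OF that(3) eta_nonneg]] True by simp
  moreover have "(\<lambda>l. \<eta> l * K) \<longlonglongrightarrow> 0" using tendsto_mult_right[OF eta_tendsto, of K] by simp
  ultimately show ?thesis by blast
next
  case False
  then obtain b where b: "\<And>n \<mu> l. \<lbrakk>conformal n \<mu>; k \<le> n; b \<le> l\<rbrakk>
      \<Longrightarrow> measure (\<mu> k) {\<omega> \<in> cyl v. l < \<omega> (length v)} = 0"
    using conformal_next_letter_tail by blast
  define \<tau> where "\<tau> l = (if b \<le> l then 0 else K)" for l
  have "\<tau> \<longlonglongrightarrow> 0"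
    by (rule tendsto_eventually, rule eventually_sequentiallyI[of b]) (simp add: \<tau>_def)
  moreover have "measure (\<mu> k) {\<omega> \<in> cyl v. l < \<omega> (length v)} \<le> \<tau> l"
    if "conformal n \<mu>" "Suc k \<le> n" "measure (\<mu> k) UNIV \<le> K" for n \<mu> l
    using b[OF that(1), of l] order_trans[OF measure_le_mass[OF that(1)] that(3)] that(2)
    by (simp add: \<tau>_def)
  ultimately show ?thesis by blast
qed

lemma conformal_seq_limit:
  assumes X: "\<And>i. conformal (q i) (X i)" and q: "filterlim q at_top sequentially"
    and \<mu>: "\<And>k. finite_measure (\<mu> k)" "\<And>k. sets (\<mu> k) = sets borel"
    and lim: "\<And>k v. (\<lambda>i. measure (X i k) (cyl v)) \<longlonglongrightarrow> measure (\<mu> k) (cyl v)"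
  shows "conformal_seq \<theta> A \<phi> x \<mu>"
proof -
  have ev: "\<forall>\<^sub>F i in sequentially. k \<le> q i" for k
    using q by (simp add: filterlim_at_top)
  have ev_measure: "\<forall>\<^sub>F i in sequentially. finite_measure (X i k) \<and> sets (X i k) = sets borel \<and>
      (AE \<omega> in X i k. \<omega> \<in> E k)" for k
    using ev[of k] by eventually_elim (use conformal_uptoD[OF X] in blast)
  have AE_\<mu>: "AE \<omega> in \<mu> k. \<omega> \<in> E k" for k
  proof (rule AE_EinfI_cyl[OF \<mu>(2)])
    fix v assume disjoint: "cyl v \<inter> E k = {}"
    have "\<forall>\<^sub>F i in sequentially. measure (X i k) (cyl v) = 0"
      using ev_measure[of k] by eventually_elim
        (use measure_eq_0_if_AE_disjoint[OF _ sets_Einf _ disjoint] in blast)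
    then have "measure (\<mu> k) (cyl v) = 0"
      by (rule tendsto_unique[OF _ lim tendsto_eventually, OF sequentially_bot])
    then show "emeasure (\<mu> k) (cyl v) = 0" by (simp add: finite_measure.emeasure_eq_measure \<mu>(1))
  qed
  show ?thesis
    unfolding conformal_seq_iff
  proof (intro allI conjI \<mu> AE_\<mu>)
    fix k
    have "\<forall>\<^sub>F i in sequentially. measure (X i k) (cyl v)
        = measure (dual_transfer A \<phi> ((\<theta> ^^ k) x) (X i (Suc k))) (cyl v)" for v
      using ev[of "Suc k"] by eventually_elim (use conformal_upto_eq[OF X, of k] in simp)
    then have "(\<lambda>i. measure (dual_transfer A \<phi> ((\<theta> ^^ k) x) (X i (Suc k))) (cyl v))
        \<longlonglongrightarrow> measure (\<mu> k) (cyl v)" for v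
      by (rule Lim_transform_eventually[OF lim])
    then show "\<mu> k = dual_transfer A \<phi> ((\<theta> ^^ k) x) (\<mu> (Suc k))"
      by (rule dual_transfer_cyl_limit[OF ev_measure \<mu> AE_\<mu> \<mu> AE_\<mu> lim])
  qed
qed

lemma conformal_compact:
  assumes X: "\<And>i. conformal (q i) (X i)" and q: "filterlim q at_top sequentially"
    and bound: "\<And>k. \<forall>\<^sub>F i in sequentially. measure (X i k) UNIV \<le> K"
  obtains s \<mu> where "strict_mono s" "bdd_conformal \<mu>"
    "\<And>k v. (\<lambda>i. measure (X (s i) k) (cyl v)) \<longlonglongrightarrow> measure (\<mu> k) (cyl v)"
proof -
  have ev: "\<forall>\<^sub>F i in sequentially. k \<le> q i \<and> measure (X i k) UNIV \<le> K" for k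
    using bound[of k] q by (simp add: filterlim_at_top eventually_conj)
  have "\<forall>\<^sub>F i in sequentially. measure (X i (fst z)) (cyl (snd z)) \<in> {0..K}" for z
    using ev[of "fst z"] by eventually_elim
      (use measure_le_mass[OF X] in \<open>force intro: order_trans\<close>)
  then obtain s l where s: "strict_mono s"
    and l: "\<And>z. (\<lambda>i. measure (X (s i) (fst z)) (cyl (snd z))) \<longlonglongrightarrow> l z"
    by (rule eventually_bounded_pointwise_subseq) (rule that)
  note ev_s = eventually_subseq[OF s ev]
  have "\<exists>\<mu>. sets \<mu> = sets borel \<and> finite_measure \<mu> \<and> (\<forall>v. measure \<mu> (cyl v) = l (k, v))" for k
  proof (rule cylinder_limit_measure[of "\<lambda>i. X (s i) k" "\<lambda>v. l (k, v)"])
    show "\<forall>\<^sub>F i in sequentially. finite_measure (X (s i) k) \<and> sets (X (s i) k) = sets borel"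
      using ev_s[of k] by eventually_elim (use conformal_uptoD(1,2)[OF X] in blast)
    fix v
    show "(\<lambda>i. measure (X (s i) k) (cyl v)) \<longlonglongrightarrow> l (k, v)" using l[of "(k, v)"] by simp
    obtain \<tau> where "\<tau> \<longlonglongrightarrow> 0" and \<tau>: "\<And>n \<mu> l. \<lbrakk>conformal n \<mu>; Suc k \<le> n; measure (\<mu> k) UNIV \<le> K;
        measure (\<mu> (Suc k)) UNIV \<le> K\<rbrakk> \<Longrightarrow> measure (\<mu> k) {\<omega> \<in> cyl v. l < \<omega> (length v)} \<le> \<tau> l"
      using conformal_cyl_tail[of k K v] by blast
    moreover have "\<forall>\<^sub>F i in sequentially. measure (X (s i) k) {\<omega> \<in> cyl v. j < \<omega> (length v)} \<le> \<tau> j"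
      for j
      using ev_s[of k] ev_s[of "Suc k"] by eventually_elim (use X \<tau> in blast)
    ultimately show "\<exists>\<tau>. \<tau> \<longlonglongrightarrow> 0 \<and>
        (\<forall>j. \<forall>\<^sub>F i in sequentially. measure (X (s i) k) {\<omega> \<in> cyl v. j < \<omega> (length v)} \<le> \<tau> j)"
          by blast
  qed blast
  then obtain \<mu> where \<mu>: "\<And>k. finite_measure (\<mu> k)" "\<And>k. sets (\<mu> k) = sets borel"
    and \<mu>_l: "\<And>k v. measure (\<mu> k) (cyl v) = l (k, v)" by metis
  have lim: "(\<lambda>i. measure (X (s i) k) (cyl v)) \<longlonglongrightarrow> measure (\<mu> k) (cyl v)" for k v
    using l[of "(k, v)"] by (simp add: \<mu>_l)
  have "conformal_seq \<theta> A \<phi> x \<mu>"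
    by (rule conformal_seq_limit[OF X filterlim_compose[OF q filterlim_subseq[OF s]] \<mu> lim])
  moreover have "measure (\<mu> k) UNIV \<le> K" for k
    using tendsto_upperbound[OF lim[of k "[]"], of K] eventually_conj_iff[THEN iffD1, OF ev_s[of k]]
    by simp
  ultimately have "bdd_conformal \<mu>" unfolding bounded_conformal_def by blast
  with s show thesis using lim by (rule that)
qed

definition pullback :: "nat \<Rightarrow> nat \<Rightarrow> (nat \<Rightarrow> nat) measure" where
  "pullback n k = dual_transfer_pow \<theta> A \<phi> ((\<theta> ^^ k) x) (n - k) (return borel (p n))"

definition normalized_pullback :: "nat \<Rightarrow> nat \<Rightarrow> (nat \<Rightarrow> nat) measure" where
  "normalized_pullback n k = scale_measure (ennreal (1 / measure (pullback n 0) UNIV))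
      (pullback n k)"

lemma pullback_self: "pullback n n = return borel (p n)"
  by (simp add: pullback_def)

lemma pullback_eq: "k < n \<Longrightarrow> pullback n k = dual_transfer A \<phi> ((\<theta> ^^ k) x) (pullback n (Suc k))"
  by (simp add: pullback_def Suc_diff_Suc[symmetric] del: Suc_diff_Suc)

lemma conformal_pullback: "conformal n (pullback n)"
proof -
  have "finite_measure (pullback n k) \<and> sets (pullback n k) = sets borel
      \<and> (AE \<omega> in pullback n k. \<omega> \<in> E k)"
    if "k \<le> n" for k
    using that
  proof (induction k rule: inc_induct)
    case base
    have "prob_space (return borel (p n))" by (rule prob_space_return) simp
    then show ?case
      using base_point(1)[of n] unfolding pullback_self
      by (subst AE_return) (auto intro: prob_space.finite_measure)
  next
    case (step k)
    then show ?case
      unfolding pullback_eq[OF step(2)] using phi_measurable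
      by (auto intro: finite_measure_dual_transfer AE_dual_transfer_Einf)
  qed
  then show ?thesis using pullback_eq by (simp add: conformal_upto_def)
qed

lemma pullback_inF_ge: "N \<le> n \<Longrightarrow> w \<le> measure (pullback n 0) inF"
  using inF_ge[OF conformal_pullback, of n 0 n] base_point(2)[of n]
  by (simp add: pullback_self measure_return)

lemma mass_pullback_pos: "N \<le> n \<Longrightarrow> 0 < measure (pullback n 0) UNIV"
  using pullback_inF_ge[of n] measure_le_mass[OF conformal_pullback, of 0 n inF] w_pos by simp

lemma mass_pullback_le:
  assumes n: "N + k \<le> n"
  shows "measure (pullback n k) UNIV \<le> 7 * C ^ N / (3 * w) * measure (pullback n 0) UNIV"
proof -
  let ?z = "measure (pullback n 0) UNIV"
  have "w * (1/4) ^ (n - (N + k)) \<le> w * 1" using w_pos by (intro mult_left_mono power_le_one) auto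
  also have "\<dots> \<le> ?z"
    using pullback_inF_ge[of n] measure_le_mass[OF conformal_pullback, of 0 n inF] n by simp
  finally have remainder: "w * (1/4) ^ (n - (N + k)) \<le> ?z" .
  have "w * measure (pullback n k) UNIV
      \<le> C ^ N * (4 / 3 * measure (pullback n 0) inF + w * (1/4) ^ (n - (N + k)))"
    using mass_le_inF[OF conformal_pullback le0 n] by (simp add: pullback_self measure_return)
  also have "\<dots> \<le> C ^ N * (4 / 3 * ?z + ?z)"
    using measure_le_mass[OF conformal_pullback, of 0 n inF] remainder C_ge_1
    by (intro mult_left_mono add_mono) auto
  finally show ?thesis using w_pos by (simp add: field_simps)
qed

lemma conformal_normalized_pullback: "conformal n (normalized_pullback n)"
  unfolding normalized_pullback_def
  by (rule conformal_upto_scale_measure[OF conformal_pullback phi_measurable])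

lemma mass_normalized_pullback_le:
  assumes "N + k \<le> n"
  shows "measure (normalized_pullback n k) UNIV \<le> 7 * C ^ N / (3 * w)"
  using mass_pullback_le[OF assms] mass_pullback_pos[of n] assms
  by (simp add: normalized_pullback_def divide_le_eq)

lemma mass_normalized_pullback: "N \<le> n \<Longrightarrow> measure (normalized_pullback n 0) UNIV = 1"
  using mass_pullback_pos[of n] by (simp add: normalized_pullback_def)

lemma normalized_pullback_subseq_tendsto:
  fixes r :: "nat \<Rightarrow> nat"
  assumes r: "strict_mono r"
  shows "\<exists>s \<mu>. strict_mono s \<and> bdd_conformal \<mu> \<and> measure (\<mu> 0) UNIV = 1 \<and>
    (\<forall>k v. (\<lambda>i. measure (normalized_pullback (r (s i)) k) (cyl v)) \<longlonglongrightarrow> measure (\<mu> k) (cyl v))"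
proof (rule conformal_compact[of r "\<lambda>i. normalized_pullback (r i)"])
  have "\<forall>\<^sub>F n in sequentially. measure (normalized_pullback n k) UNIV \<le> 7 * C ^ N / (3 * w)" for k
    by (rule eventually_sequentiallyI[of "N + k"]) (rule mass_normalized_pullback_le)
  then show "\<forall>\<^sub>F i in sequentially. measure (normalized_pullback (r i) k) UNIV
      \<le> 7 * C ^ N / (3 * w)"
    for k by (rule eventually_subseq[OF r])
  fix s \<mu> assume s: "strict_mono s" and \<mu>: "bdd_conformal \<mu>"
    and lim: "\<And>k v. (\<lambda>i. measure (normalized_pullback (r (s i)) k) (cyl v))
        \<longlonglongrightarrow> measure (\<mu> k) (cyl v)"
  have "\<forall>\<^sub>F n in sequentially. measure (normalized_pullback n 0) (cyl []) = 1"
    by (rule eventually_sequentiallyI[of N]) (simp add: mass_normalized_pullback)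
  then have "measure (\<mu> 0) (cyl []) = 1"
    by (intro tendsto_unique[OF sequentially_bot lim tendsto_eventually])
      (rule eventually_subseq[OF s eventually_subseq[OF r]])
  with s \<mu> lim show ?thesis by auto
qed (use conformal_normalized_pullback filterlim_subseq[OF r] in auto)

theorem normalized_pullback_tendsto:
  "\<exists>\<mu>. bdd_conformal \<mu> \<and> measure (\<mu> 0) UNIV = 1 \<and>
     (\<forall>k v. (\<lambda>n. measure (normalized_pullback n k) (cyl v)) \<longlonglongrightarrow> measure (\<mu> k) (cyl v))"
proof -
  obtain \<mu> where \<mu>: "bdd_conformal \<mu>" "measure (\<mu> 0) UNIV = 1"
    using normalized_pullback_subseq_tendsto[OF strict_mono_id] by blast
  have "(\<lambda>n. measure (normalized_pullback n k) (cyl v)) \<longlonglongrightarrow> measure (\<mu> k) (cyl v)" for k v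
  proof (rule tendsto_of_subsubseq)
    fix r :: "nat \<Rightarrow> nat" assume "strict_mono r"
    from normalized_pullback_subseq_tendsto[OF this] bounded_conformal_unique[OF \<mu>]
    show "\<exists>s. strict_mono s \<and> (\<lambda>i. measure (normalized_pullback (r (s i)) k) (cyl v))
        \<longlonglongrightarrow> measure (\<mu> k) (cyl v)"
      by metis
  qed
  with \<mu> show ?thesis by blast
qed

lemma measure_normalized_pullback_cyl:
  "measure (normalized_pullback n 0) (cyl v)
     = enn2real (Lpow 0 n (indicator (cyl v)) (p n)) / enn2real (Lpow 0 n (\<lambda>_. 1) (p n))"
proof -
  have "emeasure (pullback n 0) B = Lpow 0 n (indicator B) (p n)" if "B \<in> sets borel" for B
  proof -
    have "emeasure (pullback n 0) B = (\<integral>\<^sup>+ \<omega>. Lpow 0 n (indicator B) \<omega> \<partial>return borel (p n))"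
      using emeasure_conformal[OF conformal_pullback, of n 0 n B] that by (simp add: pullback_self)
    also have "\<dots> = Lpow 0 n (indicator B) (p n)"
      using that by (intro nn_integral_return measurable_transfer_pow) (auto simp: phi_measurable)
    finally show ?thesis .
  qed
  from this[of "cyl v"] this[of UNIV] show ?thesis
    by (simp add: normalized_pullback_def) (simp add: measure_def)
qed

lemma bounded_conformal_theta:
  assumes orbit': "fine_orbit \<theta> A \<phi> (\<theta> x) D' \<eta>' C' w' N' F' p'"
    and \<mu>: "bdd_conformal \<mu>" "measure (\<mu> 0) UNIV = 1"
    and \<mu>': "bounded_conformal \<theta> A \<phi> (\<theta> x) \<mu>'" "measure (\<mu>' 0) UNIV = 1"
  obtains z where "1 / C \<le> z" "z \<le> mass_const"
    "\<And>k. \<mu>' k = scale_measure (ennreal (1 / z)) (\<mu> (Suc k))"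
proof
  interpret orbit': fine_orbit \<theta> A \<phi> "\<theta> x" D' \<eta>' C' w' N' F' p' by (rule orbit')
  let ?z = "measure (\<mu> 1) UNIV"
  show z_ge: "1 / C \<le> ?z"
    using mass_le_pow[OF bounded_imp_conformal[OF \<mu>(1)] order_refl, of 0 1] \<mu>(2) C_ge_1
    by (simp add: field_simps)
  show "?z \<le> mass_const" using bounded_mass_le[OF \<mu>(1), of 0 1] \<mu>(2) by simp
  have "0 < 1 / C" using C_ge_1 by simp
  also note z_ge
  finally have "0 < ?z" .
  then have "\<mu>' = (\<lambda>k. scale_measure (ennreal (1 / ?z)) (\<mu> (Suc k)))"
    by (intro orbit'.bounded_conformal_unique \<mu>' bounded_conformal_shift \<mu>(1) orbit'.phi_measurable)
      simp_all
  then show "\<mu>' k = scale_measure (ennreal (1 / ?z)) (\<mu> (Suc k))" for k by simp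
qed

end


section \<open>Random shifts\<close>

definition admissible :: "('a \<Rightarrow> 'a) \<Rightarrow> ('a \<Rightarrow> nat \<Rightarrow> nat \<Rightarrow> bool) \<Rightarrow> 'a \<Rightarrow> nat \<Rightarrow> (nat \<Rightarrow> nat) \<Rightarrow> bool" where
  "admissible \<theta> A x n u \<longleftrightarrow> (\<forall>i<n. A ((\<theta> ^^ i) x) (u i) (u (Suc i)))"

locale random_shift = prob_space M + complete_measure M for M :: "'a measure" +
  fixes \<theta> :: "'a \<Rightarrow> 'a" and A :: "'a \<Rightarrow> nat \<Rightarrow> nat \<Rightarrow> bool" and \<phi> :: "'a \<Rightarrow> (nat \<Rightarrow> nat) \<Rightarrow> real"
    and succs :: "nat \<Rightarrow> nat set" and lo hi :: "nat \<Rightarrow> real" and V \<alpha> :: real and H :: "nat \<Rightarrow> ennreal"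
  assumes theta_measurable [measurable]: "\<theta> \<in> M \<rightarrow>\<^sub>M M"
    and theta_invariant: "distr M M \<theta> = M"
    and A_measurable [measurable]: "(\<lambda>x. A x i j) \<in> M \<rightarrow>\<^sub>M count_space UNIV"
    and mixing: "\<exists>n0. \<forall>n\<ge>n0. \<forall>x\<in>space M. \<exists>u. u 0 = a \<and> u n = b \<and> admissible \<theta> A x n u"
    and phi_measurable: "(\<lambda>q. \<phi> (fst q) (snd q)) \<in> borel_measurable (OmegaM M \<theta> A)"
    and succs_finite: "finite (succs e)" and AE_succs: "AE x in M. \<forall>j. A x e j \<longrightarrow> j \<in> succs e"
    and lo_pos: "0 < lo e"
    and AE_exp_bounds: "AE x in M. \<forall>\<omega>\<in>Einf \<theta> A x. \<omega> 0 = e \<longrightarrow> lo e \<le> exp (\<phi> x \<omega>) \<and> exp (\<phi> x \<omega>) \<le> hi e"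
    and alpha_pos: "0 < \<alpha>" and V_nonneg: "0 \<le> V"
    and AE_holder_var: "AE x in M. holder_var \<theta> A \<alpha> x (\<phi> x) \<le> ereal V"
    and H_tendsto: "H \<longlonglongrightarrow> 0"
    and AE_tail: "AE x in M. \<forall>\<omega>\<in>Einf \<theta> A (\<theta> x).
        transfer A \<phi> x (indicator (Einf \<theta> A x - {\<tau>. \<tau> 0 \<le> l})) \<omega> \<le> H l"
begin

definition regular_pt :: "'a \<Rightarrow> bool" where
  "regular_pt x \<longleftrightarrow> (\<forall>e j. A x e j \<longrightarrow> j \<in> succs e) \<and> holder_var \<theta> A \<alpha> x (\<phi> x) \<le> ereal V \<and>
     (\<forall>\<omega>\<in>Einf \<theta> A x. lo (\<omega> 0) \<le> exp (\<phi> x \<omega>) \<and> exp (\<phi> x \<omega>) \<le> hi (\<omega> 0)) \<and>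
     (\<forall>l. \<forall>\<omega>\<in>Einf \<theta> A (\<theta> x). transfer A \<phi> x (indicator (Einf \<theta> A x - {\<tau>. \<tau> 0 \<le> l})) \<omega> \<le> H l)"

definition good_pt :: "'a \<Rightarrow> bool" where
  "good_pt x \<longleftrightarrow> x \<in> space M \<and> (\<forall>k. regular_pt ((\<theta> ^^ k) x))"

lemma funpow_measurable [measurable]: "(\<theta> ^^ k) \<in> M \<rightarrow>\<^sub>M M"
  by (induction k) (auto simp: o_def)

lemma funpow_in_space: "x \<in> space M \<Longrightarrow> (\<theta> ^^ k) x \<in> space M"
  using measurable_space[OF funpow_measurable] .

lemma distr_funpow: "distr M M (\<theta> ^^ k) = M"
proof (induction k)
  case (Suc k)
  have "distr M M (\<theta> ^^ Suc k) = distr (distr M M (\<theta> ^^ k)) M \<theta>"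
    by (subst distr_distr) (auto simp: o_def)
  then show ?case by (simp only: Suc theta_invariant)
qed (simp add: id_def distr_id)

lemma AE_good_pt: "AE x in M. good_pt x"
proof -
  have "AE x in M. \<forall>e j. A x e j \<longrightarrow> j \<in> succs e"
    using AE_succs by (simp add: AE_all_countable)
  moreover have "AE x in M. \<forall>e. \<forall>\<omega>\<in>Einf \<theta> A x. \<omega> 0 = e \<longrightarrow> lo e \<le> exp (\<phi> x \<omega>) \<and> exp (\<phi> x \<omega>) \<le> hi e"
    using AE_exp_bounds by (simp only: AE_all_countable) blast
  moreover have "AE x in M. \<forall>l. \<forall>\<omega>\<in>Einf \<theta> A (\<theta> x).
      transfer A \<phi> x (indicator (Einf \<theta> A x - {\<tau>. \<tau> 0 \<le> l})) \<omega> \<le> H l"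
    using AE_tail by (simp only: AE_all_countable) blast
  ultimately have regular: "AE x in M. regular_pt x"
    using AE_holder_var by eventually_elim (auto simp: regular_pt_def)
  have "AE x in M. regular_pt ((\<theta> ^^ k) x)" for k
    by (rule AE_distrD[OF funpow_measurable[of k]]) (simp only: distr_funpow regular)
  then have "AE x in M. \<forall>k. regular_pt ((\<theta> ^^ k) x)" by (simp add: AE_all_countable)
  then show ?thesis using AE_space by eventually_elim (simp add: good_pt_def)
qed

lemma good_pt_space: "good_pt x \<Longrightarrow> x \<in> space M"
  by (simp add: good_pt_def)

lemma good_pt_regular: "good_pt x \<Longrightarrow> regular_pt ((\<theta> ^^ k) x)"
  by (simp add: good_pt_def)

lemma good_pt_funpow: "good_pt x \<Longrightarrow> good_pt ((\<theta> ^^ k) x)"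
  unfolding good_pt_def using funpow_in_space by (metis funpow_add comp_apply)

lemma good_pt_theta: "good_pt x \<Longrightarrow> good_pt (\<theta> x)"
  using good_pt_funpow[of x 1] by simp


subsection \<open>Uniform lower bounds between letters\<close>

lemma finite_ex_pos_lower_bound:
  fixes f :: "'i \<Rightarrow> real"
  assumes "finite S" "\<And>i. i \<in> S \<Longrightarrow> 0 < f i"
  shows "\<exists>c>0. \<forall>i\<in>S. c \<le> f i"
  using assms by (intro exI[of _ "Min (insert 1 (f ` S))"]) (simp add: Min_gr_iff)

primrec reach :: "nat \<Rightarrow> nat \<Rightarrow> nat set" where
  "reach a 0 = {a}"
| "reach a (Suc n) = (\<Union>e\<in>reach a n. succs e)"

lemma finite_reach: "finite (reach a n)"
  by (induction n) (auto simp: succs_finite)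

lemma path_in_reach:
  assumes "good_pt x" "u 0 = a" "admissible \<theta> A x n u"
  shows "u n \<in> reach a n"
  using assms(3)
proof (induction n)
  case (Suc n)
  have "u (Suc n) \<in> succs (u n)"
    using good_pt_regular[OF assms(1), of n] Suc.prems by (simp add: regular_pt_def admissible_def)
  then show ?case using Suc by (auto simp: admissible_def)
qed (use assms(2) in simp)

lemma ex_path_lower_bound:
  "\<exists>r>0. \<forall>x u. good_pt x \<longrightarrow> u 0 = a \<longrightarrow> admissible \<theta> A x n u \<longrightarrow>
     (\<forall>\<omega>\<in>Einf \<theta> A ((\<theta> ^^ n) x). \<omega> 0 = u n \<longrightarrow>
        ennreal r \<le> transfer_pow \<theta> A \<phi> x n (indicator {\<tau>. \<tau> 0 = a}) \<omega>)"
proof (induction n)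
  case 0
  show ?case by (intro exI[of _ 1]) auto
next
  case (Suc n)
  then obtain r where "0 < r" and r: "\<And>x u \<omega>. \<lbrakk>good_pt x; u 0 = a; admissible \<theta> A x n u;
        \<omega> \<in> Einf \<theta> A ((\<theta> ^^ n) x); \<omega> 0 = u n\<rbrakk>
      \<Longrightarrow> ennreal r \<le> transfer_pow \<theta> A \<phi> x n (indicator {\<tau>. \<tau> 0 = a}) \<omega>"
    by blast
  obtain c where c: "0 < c" "\<And>e. e \<in> reach a n \<Longrightarrow> c \<le> lo e"
    using finite_ex_pos_lower_bound[of "reach a n" lo] finite_reach lo_pos by blast
  have "ennreal (r * c) \<le> transfer_pow \<theta> A \<phi> x (Suc n) (indicator {\<tau>. \<tau> 0 = a}) \<omega>"
    if x: "good_pt x" and u: "u 0 = a" "admissible \<theta> A x (Suc n) u"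
      and \<omega>: "\<omega> \<in> Einf \<theta> A ((\<theta> ^^ Suc n) x)" "\<omega> 0 = u (Suc n)" for x u \<omega>
  proof -
    let ?x = "(\<theta> ^^ n) x" and ?\<tau> = "case_nat (u n) \<omega>"
    have step: "A ?x (u n) (\<omega> 0)" and u_n: "admissible \<theta> A x n u"
      using u(2) \<omega>(2) by (simp_all add: admissible_def)
    then have \<tau>: "?\<tau> \<in> Einf \<theta> A ?x" using \<omega>(1) by (intro case_nat_in_Einf) auto
    have "c \<le> lo (u n)" by (intro c path_in_reach[OF x u(1) u_n])
    also have "\<dots> \<le> exp (\<phi> ?x ?\<tau>)" using good_pt_regular[OF x, of n] \<tau>
      by (force simp: regular_pt_def)
    finally have "ennreal (r * c) \<le> transfer_pow \<theta> A \<phi> x n (indicator {\<tau>. \<tau> 0 = a}) ?\<tau>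
        * ennreal (exp (\<phi> ?x ?\<tau>))"
      unfolding ennreal_mult[OF less_imp_le[OF \<open>0 < r\<close>] less_imp_le[OF c(1)]]
      using r[OF x u(1) u_n \<tau>] by (intro mult_mono ennreal_leI) auto
    also have "\<dots> \<le> transfer_pow \<theta> A \<phi> x (Suc n) (indicator {\<tau>. \<tau> 0 = a}) \<omega>"
      unfolding transfer_pow.simps by (rule transfer_ge_term) (rule step)
    finally show ?thesis .
  qed
  moreover have "0 < r * c" using \<open>0 < r\<close> c(1) by simp
  ultimately show ?case by blast
qed

definition access_bound :: "nat \<Rightarrow> nat \<Rightarrow> nat \<Rightarrow> real \<Rightarrow> bool" where
  "access_bound a b n r \<longleftrightarrow> (\<forall>x \<omega>. good_pt x \<longrightarrow> \<omega> \<in> Einf \<theta> A ((\<theta> ^^ n) x) \<longrightarrow> \<omega> 0 = b \<longrightarrow>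
     ennreal r \<le> transfer_pow \<theta> A \<phi> x n (indicator {\<tau>. \<tau> 0 = a}) \<omega>)"

lemma access_bound_mono: "access_bound a b n r \<Longrightarrow> r' \<le> r \<Longrightarrow> access_bound a b n r'"
  unfolding access_bound_def by (auto intro: order_trans[OF ennreal_leI])

lemma access_bound_trans:
  assumes ab: "access_bound a b m r" and bc: "access_bound b c n s" and "0 \<le> r" "0 \<le> s"
  shows "access_bound a c (m + n) (r * s)"
  unfolding access_bound_def
proof (intro allI impI)
  fix x \<omega> assume x: "good_pt x" and "\<omega> \<in> Einf \<theta> A ((\<theta> ^^ (m + n)) x)" and "\<omega> 0 = c"
  then have \<omega>: "\<omega> \<in> Einf \<theta> A ((\<theta> ^^ n) ((\<theta> ^^ m) x))" by (simp add: add.commute[of m] funpow_add)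
  have "ennreal (r * s) \<le> ennreal r * transfer_pow \<theta> A \<phi> ((\<theta> ^^ m) x) n (indicator {\<tau>. \<tau> 0 = b}) \<omega>"
    unfolding ennreal_mult[OF assms(3,4)]
    using bc good_pt_funpow[OF x] \<omega> \<open>\<omega> 0 = c\<close>
    by (intro mult_left_mono) (auto simp: access_bound_def)
  also have "\<dots> = transfer_pow \<theta> A \<phi> ((\<theta> ^^ m) x) n (\<lambda>\<tau>. ennreal r * indicator {\<tau>. \<tau> 0 = b} \<tau>) \<omega>"
    by (simp add: transfer_pow_cmult)
  also have "\<dots> \<le> transfer_pow \<theta> A \<phi> ((\<theta> ^^ m) x) n
      (transfer_pow \<theta> A \<phi> x m (indicator {\<tau>. \<tau> 0 = a})) \<omega>"
    by (rule transfer_pow_mono_Einf[OF \<omega>]) (use ab x in \<open>auto simp: access_bound_def indicator_def\<close>)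
  finally show "ennreal (r * s) \<le> transfer_pow \<theta> A \<phi> x (m + n) (indicator {\<tau>. \<tau> 0 = a}) \<omega>"
    by (simp add: transfer_pow_add)
qed

lemma access_bound_power:
  assumes "access_bound a a p q" "0 \<le> q"
  shows "access_bound a a (s * p) (q ^ s)"
proof (induction s)
  case 0
  show ?case by (simp add: access_bound_def)
next
  case (Suc s)
  then show ?case
    using access_bound_trans[OF assms(1) Suc assms(2)] assms(2) by simp
qed

lemma access_bound_via_loop:
  assumes "access_bound a z m r" "0 \<le> r" and loop: "access_bound z z p (c ^ p)" "0 \<le> c" "c \<le> 1"
    and "access_bound z b n r'" "0 \<le> r'"
  shows "access_bound a b (m + s * p + n) (r * r' * c ^ (m + s * p + n))"
proof -
  have "access_bound a b (m + s * p + n) (r * (c ^ p) ^ s * r')"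
    using assms by (intro access_bound_trans[where b = z] access_bound_power) auto
  then show ?thesis
  proof (rule access_bound_mono)
    have "c ^ (m + s * p + n) \<le> c ^ (p * s)" using loop by (intro power_decreasing) auto
    then have "r * r' * c ^ (m + s * p + n) \<le> r * r' * (c ^ p) ^ s"
      using assms(2,7) by (simp add: mult_left_mono power_mult)
    then show "r * r' * c ^ (m + s * p + n) \<le> r * (c ^ p) ^ s * r'" by (simp only: ac_simps)
  qed
qed

lemma ex_access_bound: "\<exists>n0. \<forall>n\<ge>n0. \<exists>r>0. access_bound a b n r"
proof -
  obtain n0 where n0: "\<And>n x. n0 \<le> n \<Longrightarrow> x \<in> space M \<Longrightarrow>
      \<exists>u. u 0 = a \<and> u n = b \<and> admissible \<theta> A x n u"
    using mixing[of a b] by blast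
  have "\<exists>r>0. access_bound a b n r" if n: "n0 \<le> n" for n
  proof -
    obtain r where "0 < r" and r: "\<And>x u \<omega>. \<lbrakk>good_pt x; u 0 = a; admissible \<theta> A x n u;
        \<omega> \<in> Einf \<theta> A ((\<theta> ^^ n) x); \<omega> 0 = u n\<rbrakk>
      \<Longrightarrow> ennreal r \<le> transfer_pow \<theta> A \<phi> x n (indicator {\<tau>. \<tau> 0 = a}) \<omega>"
      using ex_path_lower_bound[of a n] by blast
    have "access_bound a b n r"
      unfolding access_bound_def
    proof (intro allI impI)
      fix x \<omega> assume x: "good_pt x" "\<omega> \<in> Einf \<theta> A ((\<theta> ^^ n) x)" "\<omega> 0 = b"
      then obtain u where "u 0 = a" "u n = b" "admissible \<theta> A x n u" using n0[OF n good_pt_space]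
        by blast
      with x show "ennreal r \<le> transfer_pow \<theta> A \<phi> x n (indicator {\<tau>. \<tau> 0 = a}) \<omega>"
        using r[of x u \<omega>] by simp
    qed
    then show ?thesis using \<open>0 < r\<close> by blast
  qed
  then show ?thesis by blast
qed

text \<open>The growth rate \<open>c\<close> comes from loops at the letter 0, so it does not depend on \<open>l\<close>. This allows one
  to choose \<open>l\<close> afterwards with an arbitrarily small tail \<open>H l\<close>.\<close>

lemma uniform_access:
  obtains c where "0 < c" "\<And>l. \<exists>w>0. \<exists>N. \<forall>m\<ge>N. \<forall>a\<le>l. \<forall>b\<le>l. access_bound a b m (w * c ^ m)"
proof -
  obtain n0 r where r: "\<And>a b n. n0 a b \<le> n \<Longrightarrow> 0 < r a b n \<and> access_bound a b n (r a b n)"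
    using ex_access_bound by metis
  define p where "p = Suc (n0 0 0)"
  define c where "c = root p (min 1 (r 0 0 p))"
  have "0 < r 0 0 p" "access_bound 0 0 p (r 0 0 p)" using r[of 0 0 p] by (simp_all add: p_def)
  then have c: "0 < c" "c \<le> 1" "access_bound 0 0 p (c ^ p)"
    by (auto simp: c_def p_def real_root_pow_pos intro: access_bound_mono simp del: power_Suc)
  have "\<exists>w>0. \<exists>N. \<forall>m\<ge>N. \<forall>a\<le>l. \<forall>b\<le>l. access_bound a b m (w * c ^ m)" for l
  proof -
    define K where "K = (\<Sum>a\<le>l. n0 a 0 + n0 0 a)"
    have K: "n0 a 0 \<le> K" "n0 0 a \<le> K" if "a \<le> l" for a
      using member_le_sum[of a "{..l}" "\<lambda>a. n0 a 0 + n0 0 a"] that by (auto simp: K_def)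
    have r_pos: "0 < r a 0 K" "0 < r 0 b (K + j)" if "a \<le> l" "b \<le> l" for a b j
      using K that r[of a 0 K] r[of 0 b "K + j"] by (auto simp: trans_le_add1)
    have "\<exists>w>0. \<forall>i\<in>{..l} \<times> {..l} \<times> {..<p}. w \<le> (\<lambda>(a, b, j). r a 0 K * r 0 b (K + j)) i"
      by (rule finite_ex_pos_lower_bound) (use r_pos in auto)
    then obtain w where "0 < w" and w: "\<And>a b j. \<lbrakk>a \<le> l; b \<le> l; j < p\<rbrakk> \<Longrightarrow> w \<le> r a 0 K * r 0 b (K + j)"
      by auto
    have "access_bound a b m (w * c ^ m)" if m: "2 * K \<le> m" and ab: "a \<le> l" "b \<le> l" for m a b
    proof -
      define s where "s = (m - 2 * K) div p"
      define j where "j = (m - 2 * K) mod p"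
      have m_eq: "K + s * p + (K + j) = m" using m by (simp add: s_def j_def)
      have "j < p" by (simp add: j_def p_def)
      have "access_bound a b (K + s * p + (K + j))
          (r a 0 K * r 0 b (K + j) * c ^ (K + s * p + (K + j)))"
        using r[of a 0 K] r[of 0 b "K + j"] K ab c r_pos[OF ab]
        by (intro access_bound_via_loop[where z = 0]) (auto simp: less_imp_le trans_le_add1)
      moreover have "w * c ^ m \<le> r a 0 K * r 0 b (K + j) * c ^ m"
        using w[OF ab \<open>j < p\<close>] c(1) by (intro mult_right_mono) auto
      ultimately show ?thesis unfolding m_eq by (rule access_bound_mono)
    qed
    then show ?thesis using \<open>0 < w\<close> by blast
  qed
  with c(1) that show thesis by blast
qed


subsection \<open>Normalization of the potential\<close>

text \<open>Outside \<open>Omega\<close> the potential need not be measurable, hence the indicator.\<close>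

definition normalized_potential :: "real \<Rightarrow> 'a \<Rightarrow> (nat \<Rightarrow> nat) \<Rightarrow> real" where
  "normalized_potential c x \<omega> = indicator (Einf \<theta> A x) \<omega> * \<phi> x \<omega> - ln c"

lemma transfer_normalized:
  assumes c: "0 < c" and \<omega>: "\<omega> \<in> Einf \<theta> A (\<theta> x)"
  shows "transfer A (normalized_potential c) x u \<omega> = ennreal (1 / c) * transfer A \<phi> x u \<omega>"
proof -
  have "ennreal (exp (normalized_potential c x (case_nat e \<omega>)))
      = ennreal (1 / c) * ennreal (exp (\<phi> x (case_nat e \<omega>)))"
    if "A x e (\<omega> 0)" for e
    using case_nat_in_Einf[OF \<omega> that] c
    by (simp add: normalized_potential_def exp_diff ennreal_mult[symmetric])
  then have "transfer A (normalized_potential c) x u \<omega>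
      = transfer A \<phi> x (\<lambda>\<tau>. ennreal (1 / c) * u \<tau>) \<omega>"
    unfolding transfer_def by (intro arg_cong[where f=suminf]) (auto simp: fun_eq_iff ac_simps)
  then show ?thesis by (simp add: transfer_cmult)
qed

lemma transfer_normalized_le:
  assumes "0 < c" "\<omega> \<in> Einf \<theta> A (\<theta> x)" "transfer A \<phi> x u \<omega> \<le> ennreal (c * b)" "0 \<le> b"
  shows "transfer A (normalized_potential c) x u \<omega> \<le> ennreal b"
proof -
  have "ennreal (1 / c) * transfer A \<phi> x u \<omega> \<le> ennreal (1 / c) * ennreal (c * b)"
    by (rule mult_left_mono[OF assms(3)]) simp
  then show ?thesis using assms by (simp add: transfer_normalized ennreal_mult[symmetric])
qed

lemma transfer_pow_normalized:
  assumes c: "0 < c" and \<omega>: "\<omega> \<in> Einf \<theta> A ((\<theta> ^^ n) x)"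
  shows "transfer_pow \<theta> A (normalized_potential c) x n u \<omega>
      = ennreal ((1 / c) ^ n) * transfer_pow \<theta> A \<phi> x n u \<omega>"
  using \<omega>
proof (induction n arbitrary: \<omega>)
  case (Suc n)
  have \<omega>: "\<omega> \<in> Einf \<theta> A (\<theta> ((\<theta> ^^ n) x))" using Suc.prems by simp
  have "transfer_pow \<theta> A (normalized_potential c) x (Suc n) u \<omega>
      = ennreal (1 / c) * transfer A \<phi> ((\<theta> ^^ n) x)
        (transfer_pow \<theta> A (normalized_potential c) x n u) \<omega>"
    using transfer_normalized[OF c \<omega>] by simp
  also have "transfer A \<phi> ((\<theta> ^^ n) x) (transfer_pow \<theta> A (normalized_potential c) x n u) \<omega>
      = transfer A \<phi> ((\<theta> ^^ n) x) (\<lambda>\<tau>. ennreal ((1 / c) ^ n) * transfer_pow \<theta> A \<phi> x n u \<tau>) \<omega>"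
    by (intro antisym transfer_mono_Einf[OF \<omega>]) (simp_all add: Suc.IH)
  finally show ?case
    using c by (simp add: transfer_cmult mult.assoc[symmetric] ennreal_mult[symmetric])
qed simp

lemma sets_Omega: "Omega \<theta> A \<inter> space (M \<Otimes>\<^sub>M borel) \<in> sets (M \<Otimes>\<^sub>M borel)"
proof -
  have "Omega \<theta> A \<inter> space (M \<Otimes>\<^sub>M borel) = {q \<in> space (M \<Otimes>\<^sub>M (borel :: (nat \<Rightarrow> nat) measure)).
      \<forall>i. A ((\<theta> ^^ i) (fst q)) (snd q i) (snd q (Suc i))}"
    by (auto simp: Omega_def Einf_def)
  also have "\<dots> \<in> sets (M \<Otimes>\<^sub>M borel)" by measurable
  finally show ?thesis .
qed

lemma measurable_normalized_potential_pair:
  "(\<lambda>q. normalized_potential c (fst q) (snd q)) \<in> borel_measurable (M \<Otimes>\<^sub>M borel)"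
proof -
  have "(\<lambda>q. indicator (Omega \<theta> A) q *\<^sub>R \<phi> (fst q) (snd q)) \<in> borel_measurable (M \<Otimes>\<^sub>M borel)"
    using phi_measurable sets_Omega unfolding OmegaM_def
    by (subst borel_measurable_restrict_space_iff[symmetric]) auto
  moreover have "indicator (Omega \<theta> A) q = (indicator (Einf \<theta> A (fst q)) (snd q) :: real)" for q
    by (cases q) (auto simp: Omega_def indicator_def)
  ultimately show ?thesis unfolding normalized_potential_def by simp
qed

lemma measurable_normalized_potential:
  "x \<in> space M \<Longrightarrow> normalized_potential c x \<in> borel_measurable borel"
  using measurable_compose[OF measurable_Pair1'[where x=x and ?M1.0=M and ?M2.0=borel]
      measurable_normalized_potential_pair[of c]] by simp

lemma dual_transfer_normalized:
  assumes x: "x \<in> space M" and c: "0 < c"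
    and \<rho>: "sets \<rho> = sets borel" "AE \<omega> in \<rho>. \<omega> \<in> Einf \<theta> A (\<theta> x)"
  shows "dual_transfer A (normalized_potential 1) x \<rho>
    = scale_measure (ennreal c) (dual_transfer A (normalized_potential c) x \<rho>)"
proof (rule measure_eqI)
  fix B assume "B \<in> sets (dual_transfer A (normalized_potential 1) x \<rho>)"
  then have B: "B \<in> sets borel" by simp
  have measurable: "transfer A (normalized_potential c) x (indicator B) \<in> borel_measurable \<rho>"
    unfolding measurable_cong_sets[OF \<rho>(1) refl]
    using B measurable_normalized_potential[OF x] by (intro measurable_transfer) auto
  have "(\<integral>\<^sup>+ \<omega>. transfer A (normalized_potential 1) x (indicator B) \<omega> \<partial>\<rho>)
      = (\<integral>\<^sup>+ \<omega>. ennreal c * transfer A (normalized_potential c) x (indicator B) \<omega> \<partial>\<rho>)"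
    using \<rho>(2) c by (intro nn_integral_cong_AE)
      (auto elim!: eventually_mono simp: transfer_normalized mult.assoc[symmetric]
        ennreal_mult[symmetric])
  then show "emeasure (dual_transfer A (normalized_potential 1) x \<rho>) B
      = emeasure (scale_measure (ennreal c) (dual_transfer A (normalized_potential c) x \<rho>)) B"
    using B measurable \<rho>(1) by (simp add: emeasure_dual_transfer
      measurable_normalized_potential[OF x]
      nn_integral_cmult)
qed simp


subsection \<open>Orbits of good points\<close>

primrec base_path :: "'a \<Rightarrow> nat \<Rightarrow> nat" where
  "base_path x 0 = 0"
| "base_path x (Suc i) = (LEAST j. A ((\<theta> ^^ i) x) (base_path x i) j)"

lemma base_path_in_Einf:
  assumes x: "x \<in> space M"
  shows "base_path x \<in> Einf \<theta> A x"
  unfolding mem_Einf_iff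
proof
  fix i
  obtain n0 where "\<And>n y. n0 \<le> n \<Longrightarrow> y \<in> space M
      \<Longrightarrow> \<exists>u. u 0 = base_path x i \<and> u n = 0 \<and> admissible \<theta> A y n u"
    using mixing[of "base_path x i" 0] by blast
  from this[of "Suc n0" "(\<theta> ^^ i) x"] obtain u where "u 0 = base_path x i"
    "admissible \<theta> A ((\<theta> ^^ i) x) (Suc n0) u"
    using funpow_in_space[OF x] by auto
  then have "A ((\<theta> ^^ i) x) (base_path x i) (u 1)" by (auto simp: admissible_def)
  then show "A ((\<theta> ^^ i) x) (base_path x i) (base_path x (Suc i))"
    by (simp add: LeastI[of "A ((\<theta> ^^ i) x) (base_path x i)"])
qed

lemma regular_pt_distortion:
  assumes "regular_pt x" "\<tau> \<in> Einf \<theta> A x" "\<omega> \<in> Einf \<theta> A x" "\<forall>i\<le>r. \<tau> i = \<omega> i"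
  shows "\<phi> x \<tau> \<le> \<phi> x \<omega> + V * exp (- \<alpha>) ^ Suc r"
proof (cases "\<tau> = \<omega>")
  case True
  then show ?thesis using V_nonneg by simp
next
  case False
  define n where "n = (LEAST n. \<tau> n \<noteq> \<omega> n)"
  have "\<exists>n. \<tau> n \<noteq> \<omega> n" using False by auto
  then have "\<tau> n \<noteq> \<omega> n" unfolding n_def by (rule LeastI_ex)
  then have n: "Suc r \<le> n" using assms(4) by (metis not_less_eq_eq)
  have "ereal (\<bar>\<phi> x \<tau> - \<phi> x \<omega>\<bar> / (seq_dist \<tau> \<omega> powr \<alpha>)) \<le> holder_var \<theta> A \<alpha> x (\<phi> x)"
    unfolding holder_var_def using assms False by (intro SUP_upper2[of "(\<tau>, \<omega>)"]) auto
  also have "\<dots> \<le> ereal V" using assms(1) by (simp add: regular_pt_def)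
  finally have "\<bar>\<phi> x \<tau> - \<phi> x \<omega>\<bar> / (seq_dist \<tau> \<omega> powr \<alpha>) \<le> V" by simp
  moreover have "seq_dist \<tau> \<omega> powr \<alpha> = exp (- \<alpha>) ^ n"
    using False by (simp add: seq_dist_def n_def[symmetric] powr_def exp_of_nat_mult[symmetric]
      mult.commute)
  ultimately have "\<bar>\<phi> x \<tau> - \<phi> x \<omega>\<bar> \<le> V * exp (- \<alpha>) ^ n" by (simp add: divide_simps)
  also have "\<dots> \<le> V * exp (- \<alpha>) ^ Suc r"
    using n alpha_pos V_nonneg by (intro mult_left_mono power_decreasing) auto
  finally show ?thesis by simp
qed

lemma regular_pt_transfer_tail:
  assumes "regular_pt x" "\<omega> \<in> Einf \<theta> A (\<theta> x)"
  shows "transfer A \<phi> x (indicator {\<tau>. l < \<tau> 0}) \<omega> \<le> H l"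
proof -
  have "transfer A \<phi> x (indicator {\<tau>. l < \<tau> 0}) \<omega>
      \<le> transfer A \<phi> x (indicator (Einf \<theta> A x - {\<tau>. \<tau> 0 \<le> l})) \<omega>"
    by (rule transfer_mono_Einf[OF assms(2)]) (auto simp: indicator_def)
  also have "\<dots> \<le> H l" using assms by (simp add: regular_pt_def)
  finally show ?thesis .
qed

lemma regular_pt_transfer_one:
  assumes x: "regular_pt x" and \<omega>: "\<omega> \<in> Einf \<theta> A (\<theta> x)"
  shows "transfer A \<phi> x (\<lambda>_. 1) \<omega> \<le> (\<Sum>e\<le>l. ennreal (hi e)) + H l"
proof -
  let ?head = "indicator {\<tau> :: nat \<Rightarrow> nat. \<tau> 0 \<le> l} :: _ \<Rightarrow> ennreal"
    and ?tail = "indicator {\<tau> :: nat \<Rightarrow> nat. l < \<tau> 0} :: _ \<Rightarrow> ennreal"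
  have "transfer A \<phi> x ?head \<omega> = (\<Sum>e\<le>l. if A x e (\<omega> 0)
      then ?head (case_nat e \<omega>) * ennreal (exp (\<phi> x (case_nat e \<omega>))) else 0)"
    unfolding transfer_def by (rule suminf_finite) auto
  also have "\<dots> \<le> (\<Sum>e\<le>l. ennreal (hi e))"
  proof (rule sum_mono)
    fix e
    have "exp (\<phi> x (case_nat e \<omega>)) \<le> hi e" if "A x e (\<omega> 0)"
      using x case_nat_in_Einf[OF \<omega> that] by (force simp: regular_pt_def)
    then show "(if A x e (\<omega> 0) then ?head (case_nat e \<omega>) * ennreal (exp (\<phi> x (case_nat e \<omega>)))
        else 0) \<le> ennreal (hi e)"
      by (auto simp: indicator_def intro: ennreal_leI)
  qed
  finally have head: "transfer A \<phi> x ?head \<omega> \<le> (\<Sum>e\<le>l. ennreal (hi e))" .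
  have "transfer A \<phi> x (\<lambda>_. 1) \<omega> = transfer A \<phi> x (\<lambda>\<tau>. ?head \<tau> + ?tail \<tau>) \<omega>"
    by (rule arg_cong[where f="\<lambda>u. transfer A \<phi> x u \<omega>"]) (auto simp: indicator_def fun_eq_iff)
  also have "\<dots> = transfer A \<phi> x ?head \<omega> + transfer A \<phi> x ?tail \<omega>" by (rule transfer_add)
  also have "\<dots> \<le> (\<Sum>e\<le>l. ennreal (hi e)) + H l"
    by (rule add_mono[OF head regular_pt_transfer_tail[OF x \<omega>]])
  finally show ?thesis .
qed

lemma access_bound_normalized:
  assumes "access_bound a b m (w * c ^ m)" and c: "0 < c" and "0 \<le> w" and x: "good_pt x"
    and \<omega>: "\<omega> \<in> Einf \<theta> A ((\<theta> ^^ m) x)" "\<omega> 0 = b"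
  shows "ennreal w \<le> transfer_pow \<theta> A (normalized_potential c) x m (indicator {\<tau>. \<tau> 0 = a}) \<omega>"
proof -
  have "ennreal w = ennreal ((1 / c) ^ m) * ennreal (w * c ^ m)"
    using c \<open>0 \<le> w\<close> by (subst ennreal_mult[symmetric]) (auto simp: power_divide)
  also have "\<dots> \<le> ennreal ((1 / c) ^ m) * transfer_pow \<theta> A \<phi> x m (indicator {\<tau>. \<tau> 0 = a}) \<omega>"
    using assms by (intro mult_left_mono) (auto simp: access_bound_def)
  finally show ?thesis unfolding transfer_pow_normalized[OF c \<omega>(1)] .
qed

text \<open>\<open>H l\<close> may be infinite for small \<open>l\<close>, hence the truncation.\<close>

definition tail_bound :: "real \<Rightarrow> real \<Rightarrow> nat \<Rightarrow> real" where
  "tail_bound c C l = enn2real (min (H l) (ennreal (c * C))) / c"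

lemma tail_bound_tendsto: "0 < c \<Longrightarrow> tail_bound c C \<longlonglongrightarrow> 0"
proof -
  assume "0 < c"
  have "(\<lambda>l. min (H l) (ennreal (c * C))) \<longlonglongrightarrow> ennreal 0"
    using tendsto_min[OF H_tendsto tendsto_const[of "ennreal (c * C)"]] by simp
  then have "(\<lambda>l. enn2real (min (H l) (ennreal (c * C)))) \<longlonglongrightarrow> 0" by (rule tendsto_enn2real) simp
  from tendsto_divide[OF this tendsto_const[of c]] show ?thesis
    using \<open>0 < c\<close> by (simp add: tail_bound_def[abs_def])
qed

lemma transfer_tail_normalized_le:
  assumes x: "regular_pt x" and c: "0 < c" and \<omega>: "\<omega> \<in> Einf \<theta> A (\<theta> x)"
    and transfer_one: "transfer A \<phi> x (\<lambda>_. 1) \<omega> \<le> ennreal (c * C)"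
  shows "transfer A (normalized_potential c) x (indicator {\<tau>. l < \<tau> 0}) \<omega>
      \<le> ennreal (tail_bound c C l)"
proof (rule transfer_normalized_le[OF c \<omega>])
  have "transfer A \<phi> x (indicator {\<tau>. l < \<tau> 0}) \<omega> \<le> ennreal (c * C)"
    by (rule order_trans[OF transfer_mono_Einf[OF \<omega>] transfer_one]) (auto simp: indicator_def)
  then have "transfer A \<phi> x (indicator {\<tau>. l < \<tau> 0}) \<omega> \<le> min (H l) (ennreal (c * C))"
    using regular_pt_transfer_tail[OF x \<omega>] by simp
  also have "min (H l) (ennreal (c * C)) < top" by (simp add: min_less_iff_disj)
  then have "min (H l) (ennreal (c * C)) = ennreal (c * tail_bound c C l)"
    using c by (simp add: tail_bound_def)
  finally show "transfer A \<phi> x (indicator {\<tau>. l < \<tau> 0}) \<omega> \<le> ennreal (c * tail_bound c C l)" .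
qed (use c in \<open>simp add: tail_bound_def\<close>)

lemma good_pt_fine_orbit:
  assumes x: "good_pt x" and c: "0 < c"
    and C: "1 \<le> C" "(\<Sum>e\<le>l. ennreal (hi e)) + H l \<le> ennreal (c * C)"
    and l: "H l \<le> ennreal (c * (1/4))" and w: "0 < w"
    and access: "\<And>m a b. \<lbrakk>N \<le> m; a \<le> l; b \<le> l\<rbrakk> \<Longrightarrow> access_bound a b m (w * c ^ m)"
  shows "fine_orbit \<theta> A (normalized_potential c) x (\<lambda>r. V * exp (- \<alpha>) ^ Suc r)
      (tail_bound c C) C w N {..l} (\<lambda>k. base_path ((\<theta> ^^ k) x))"
proof (rule fine_orbit.intro)
  note regular = good_pt_regular[OF x] and space = good_pt_space[OF good_pt_funpow[OF x]]
  fix k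
  show "normalized_potential c ((\<theta> ^^ k) x) \<in> borel_measurable borel"
    by (rule measurable_normalized_potential[OF space])
  show "finite {j. A ((\<theta> ^^ k) x) e j}" for e
    by (rule finite_subset[OF _ succs_finite[of e]])
      (use regular[of k] in \<open>auto simp: regular_pt_def\<close>)
  show "normalized_potential c ((\<theta> ^^ k) x) \<tau>
      \<le> normalized_potential c ((\<theta> ^^ k) x) \<omega> + V * exp (- \<alpha>) ^ Suc r"
    if "\<tau> \<in> Einf \<theta> A ((\<theta> ^^ k) x)" "\<omega> \<in> Einf \<theta> A ((\<theta> ^^ k) x)" "\<forall>i\<le>r. \<tau> i = \<omega> i" for \<tau> \<omega> r
    using regular_pt_distortion[OF regular that] that by (simp add: normalized_potential_def)
  show "base_path ((\<theta> ^^ k) x) \<in> Einf \<theta> A ((\<theta> ^^ k) x)" by (rule base_path_in_Einf[OF space])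
  show "ennreal w \<le> transfer_pow \<theta> A (normalized_potential c) ((\<theta> ^^ k) x) m
      (indicator {\<tau>. \<tau> 0 = f}) \<omega>"
    if "N \<le> m" "f \<in> {..l}" "\<omega> \<in> Einf \<theta> A ((\<theta> ^^ (m + k)) x)" "\<omega> 0 \<in> {..l}" for m f \<omega>
    using that w by (intro access_bound_normalized[OF access c _ good_pt_funpow[OF x]])
      (auto simp: funpow_add)
  fix \<omega> assume "\<omega> \<in> Einf \<theta> A ((\<theta> ^^ Suc k) x)"
  then have \<omega>: "\<omega> \<in> Einf \<theta> A (\<theta> ((\<theta> ^^ k) x))" by simp
  have transfer_one: "transfer A \<phi> ((\<theta> ^^ k) x) (\<lambda>_. 1) \<omega> \<le> ennreal (c * C)"
    by (rule order_trans[OF regular_pt_transfer_one[OF regular \<omega>] C(2)])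
  then show "transfer A (normalized_potential c) ((\<theta> ^^ k) x) (\<lambda>_. 1) \<omega> \<le> ennreal C"
    using C(1) by (intro transfer_normalized_le[OF c \<omega>]) auto
  show "transfer A (normalized_potential c) ((\<theta> ^^ k) x) (indicator {\<tau>. \<tau> 0 \<notin> {..l}}) \<omega>
      \<le> ennreal (1/4)"
    using order_trans[OF regular_pt_transfer_tail[OF regular \<omega>] l]
    by (intro transfer_normalized_le[OF c \<omega>]) (auto simp: not_le)
  show "transfer A (normalized_potential c) ((\<theta> ^^ k) x) (indicator {\<tau>. i < \<tau> 0}) \<omega>
      \<le> ennreal (tail_bound c C i)" for i
    by (rule transfer_tail_normalized_le[OF regular c \<omega> transfer_one])
next
  show "0 \<le> V * exp (- \<alpha>) ^ Suc r" for r using V_nonneg by simp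
  show "summable (\<lambda>r. V * exp (- \<alpha>) ^ Suc r)"
    using alpha_pos summable_geometric[of "exp (- \<alpha>)"]
    by (intro summable_mult summable_Suc_iff[THEN iffD2]) simp
  show "0 \<le> tail_bound c C i" for i using c by (simp add: tail_bound_def)
qed (use C w tail_bound_tendsto[OF c] in simp_all)

lemma ex_fine_orbit_constants:
  obtains c C w \<eta> N l where "0 < c" "\<And>x. good_pt x \<Longrightarrow>
    fine_orbit \<theta> A (normalized_potential c) x (\<lambda>r. V * exp (- \<alpha>) ^ Suc r) \<eta> C w N {..l}
      (\<lambda>k. base_path ((\<theta> ^^ k) x))"
proof -
  obtain c where c: "0 < c" and access: "\<And>l. \<exists>w>0. \<exists>N. \<forall>m\<ge>N. \<forall>a\<le>l. \<forall>b\<le>l. access_bound a b m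
      (w * c ^ m)"
    using uniform_access by blast
  have "\<forall>\<^sub>F l in sequentially. H l < ennreal (c * (1/4))"
    using H_tendsto c by (intro order_tendstoD(2)) auto
  then obtain l where l: "H l < ennreal (c * (1/4))" by (auto simp: eventually_sequentially)
  obtain w N where w: "0 < w" "\<And>m a b. \<lbrakk>N \<le> m; a \<le> l; b \<le> l\<rbrakk> \<Longrightarrow> access_bound a b m (w * c ^ m)"
    using access[of l] by blast
  let ?b = "(\<Sum>e\<le>l. ennreal (hi e)) + H l"
  define C where "C = max 1 (enn2real ?b / c)"
  have "?b < top" using order.strict_trans[OF l ennreal_less_top] by simp
  then have "?b = ennreal (enn2real ?b)" by simp
  also have "\<dots> \<le> ennreal (c * C)" using c
    by (intro ennreal_leI) (simp add: C_def field_simps max_def)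
  finally have C: "?b \<le> ennreal (c * C)" .
  have "1 \<le> C" by (simp add: C_def)
  from good_pt_fine_orbit[OF _ c this C less_imp_le[OF l] w] c that show thesis by blast
qed

definition cyl_ratio :: "real \<Rightarrow> 'a \<Rightarrow> nat \<Rightarrow> nat list \<Rightarrow> real" where
  "cyl_ratio c x n v =
     enn2real (transfer_pow \<theta> A (normalized_potential c) x n (indicator (cyl v))
       (base_path ((\<theta> ^^ n) x))) /
     enn2real (transfer_pow \<theta> A (normalized_potential c) x n (\<lambda>_. 1) (base_path ((\<theta> ^^ n) x)))"

lemma cyl_ratio_tendsto:
  assumes "fine_orbit \<theta> A (normalized_potential c) x D \<eta> C w N F (\<lambda>k. base_path ((\<theta> ^^ k) x))"
  shows "\<exists>\<mu>. bounded_conformal \<theta> A (normalized_potential c) x \<mu> \<and> measure (\<mu> 0) UNIV = 1 \<and>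
    (\<forall>v. (\<lambda>n. cyl_ratio c x n v) \<longlonglongrightarrow> measure (\<mu> 0) (cyl v))"
proof -
  interpret orbit: fine_orbit \<theta> A "normalized_potential c" x D \<eta> C w N F
    "\<lambda>k. base_path ((\<theta> ^^ k) x)"
    by (rule assms)
  obtain \<mu> where \<mu>: "orbit.bdd_conformal \<mu>" "measure (\<mu> 0) UNIV = 1"
    and lim: "\<And>v. (\<lambda>n. measure (orbit.normalized_pullback n 0) (cyl v)) \<longlonglongrightarrow> measure (\<mu> 0) (cyl v)"
    using orbit.normalized_pullback_tendsto by blast
  have "(\<lambda>n. cyl_ratio c x n v) \<longlonglongrightarrow> measure (\<mu> 0) (cyl v)" for v
    using lim[of v] by (simp add: cyl_ratio_def orbit.measure_normalized_pullback_cyl)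
  with \<mu> show ?thesis by blast
qed

lemma dual_transfer_conformal_scaled:
  assumes \<mu>: "conformal_seq \<theta> A (normalized_potential c) x \<mu>" and x: "x \<in> space M" and c: "0 < c"
  shows "dual_transfer A (normalized_potential 1) x (scale_measure r (\<mu> 1))
      = scale_measure (ennreal c * r) (\<mu> 0)"
proof -
  note \<mu>_props = conformal_seqD[OF \<mu>, of 1]
  have "dual_transfer A (normalized_potential 1) x (scale_measure r (\<mu> 1))
      = scale_measure (ennreal c) (dual_transfer A (normalized_potential c) x
        (scale_measure r (\<mu> 1)))"
    using \<mu>_props(2,3) by (subst dual_transfer_normalized[OF x c])
      (simp_all add: AE_mem_iff_emeasure_Compl)
  also have "dual_transfer A (normalized_potential c) x (scale_measure r (\<mu> 1))
      = scale_measure r (\<mu> 0)"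
    using \<mu>_props(2) conformal_seqD(5)[OF \<mu>, of 0] measurable_normalized_potential[OF x]
    by (simp add: dual_transfer_scale_measure)
  finally show ?thesis by simp
qed

lemma abs_ln_le:
  fixes a b t :: real
  assumes "0 < a" "a \<le> t" "t \<le> b"
  shows "\<bar>ln t\<bar> \<le> \<bar>ln a\<bar> + \<bar>ln b\<bar>"
proof -
  have "ln a \<le> ln t" "ln t \<le> ln b" using assms by auto
  then show ?thesis by linarith
qed

lemma dual_transfer_fibre_measures:
  assumes orbit: "fine_orbit \<theta> A (normalized_potential c) x D \<eta> C w N F p"
    and orbit': "fine_orbit \<theta> A (normalized_potential c) (\<theta> x) D' \<eta>' C' w' N' F' p'"
    and \<mu>: "bounded_conformal \<theta> A (normalized_potential c) x \<mu>" "measure (\<mu> 0) UNIV = 1"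
    and \<mu>': "bounded_conformal \<theta> A (normalized_potential c) (\<theta> x) \<mu>'" "measure (\<mu>' 0) UNIV = 1"
    and x: "x \<in> space M" and c: "0 < c"
  shows "\<exists>t>0. \<bar>ln t\<bar> \<le> \<bar>ln (c / fine_orbit.mass_const C w N)\<bar> + \<bar>ln (c * C)\<bar> \<and>
    dual_transfer A (normalized_potential 1) x (\<mu>' 0) = scale_measure (ennreal t) (\<mu> 0)"
proof -
  interpret orbit: fine_orbit \<theta> A "normalized_potential c" x D \<eta> C w N F p by (rule orbit)
  obtain z where z: "1 / C \<le> z" "z \<le> orbit.mass_const"
    and shift: "\<And>k. \<mu>' k = scale_measure (ennreal (1 / z)) (\<mu> (Suc k))"
    using orbit.bounded_conformal_theta[OF orbit' \<mu> \<mu>'] by blast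
  have "0 < C" using orbit.C_ge_1 by simp
  then have "0 < z" using z(1) by (intro less_le_trans[OF _ z(1)]) simp
  have "conformal_seq \<theta> A (normalized_potential c) x \<mu>" using \<mu>(1)
    by (simp add: bounded_conformal_def)
  from dual_transfer_conformal_scaled[OF this x c, of "ennreal (1 / z)"]
  have "dual_transfer A (normalized_potential 1) x (\<mu>' 0) = scale_measure (ennreal (c / z)) (\<mu> 0)"
    using c \<open>0 < z\<close> by (simp add: shift ennreal_mult[symmetric])
  moreover have "\<bar>ln (c / z)\<bar> \<le> \<bar>ln (c / orbit.mass_const)\<bar> + \<bar>ln (c * C)\<bar>"
    by (rule abs_ln_le) (use z c \<open>0 < z\<close> \<open>0 < C\<close> orbit.mass_const_pos in \<open>auto simp: field_simps\<close>)
  ultimately show ?thesis using c \<open>0 < z\<close> by (intro exI[of _ "c / z"]) simp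
qed

lemma ex_fibre_measures:
  obtains c K \<nu> where
    "\<And>x. good_pt x \<Longrightarrow> prob_space (\<nu> x) \<and> sets (\<nu> x) = sets borel \<and> (AE \<omega> in \<nu> x. \<omega> \<in> Einf \<theta> A x)"
    "\<And>x v. good_pt x \<Longrightarrow> (\<lambda>n. cyl_ratio c x n v) \<longlonglongrightarrow> measure (\<nu> x) (cyl v)"
    "\<And>x. good_pt x \<Longrightarrow> \<exists>t>0. \<bar>ln t\<bar> \<le> K \<and>
       dual_transfer A (normalized_potential 1) x (\<nu> (\<theta> x)) = scale_measure (ennreal t) (\<nu> x)"
proof -
  obtain c C w \<eta> N l where c: "0 < c" and fine: "\<And>x. good_pt x \<Longrightarrow>
    fine_orbit \<theta> A (normalized_potential c) x (\<lambda>r. V * exp (- \<alpha>) ^ Suc r) \<eta> C w N {..l}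
      (\<lambda>k. base_path ((\<theta> ^^ k) x))"
    by (rule ex_fine_orbit_constants) (rule that)
  obtain \<mu> where \<mu>: "\<And>x. good_pt x \<Longrightarrow> bounded_conformal \<theta> A (normalized_potential c) x (\<mu> x)"
    and mass_one: "\<And>x. good_pt x \<Longrightarrow> measure (\<mu> x 0) UNIV = 1"
    and lim: "\<And>x v. good_pt x \<Longrightarrow> (\<lambda>n. cyl_ratio c x n v) \<longlonglongrightarrow> measure (\<mu> x 0) (cyl v)"
    using cyl_ratio_tendsto[OF fine] by metis
  show thesis
  proof (rule that)
    fix x assume x: "good_pt x"
    have "conformal_seq \<theta> A (normalized_potential c) x (\<mu> x)"
      using \<mu>[OF x] by (simp add: bounded_conformal_def)
    note \<mu>_props = conformal_seqD[OF this, of 0]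
    show "prob_space (\<mu> x 0) \<and> sets (\<mu> x 0) = sets borel \<and> (AE \<omega> in \<mu> x 0. \<omega> \<in> Einf \<theta> A x)"
      using \<mu>_props(2,3) mass_one[OF x] by (auto intro!: prob_spaceI
        simp: finite_measure.emeasure_eq_measure[OF \<mu>_props(1)] \<mu>_props(4))
    show "(\<lambda>n. cyl_ratio c x n v) \<longlonglongrightarrow> measure (\<mu> x 0) (cyl v)" for v by (rule lim[OF x])
    note \<theta>x = good_pt_theta[OF x]
    show "\<exists>t>0. \<bar>ln t\<bar> \<le> \<bar>ln (c / fine_orbit.mass_const C w N)\<bar> + \<bar>ln (c * C)\<bar> \<and>
        dual_transfer A (normalized_potential 1) x (\<mu> (\<theta> x) 0) = scale_measure (ennreal t) (\<mu> x 0)"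
      by (rule dual_transfer_fibre_measures[OF fine[OF x] fine[OF \<theta>x] \<mu>[OF x] mass_one[OF x]
            \<mu>[OF \<theta>x] mass_one[OF \<theta>x] good_pt_space[OF x] c])
  qed
qed


subsection \<open>Measurable dependence on the base point\<close>

lemma base_path_measurable [measurable]: "base_path \<in> M \<rightarrow>\<^sub>M borel"
proof (rule measurable_borel_seqI)
  fix i show "(\<lambda>x. base_path x i) \<in> M \<rightarrow>\<^sub>M count_space UNIV"
  proof (induction i)
    case (Suc i)
    note [measurable] = Suc
    show ?case by simp
  qed simp
qed

lemma measurable_transfer_pair:
  assumes [measurable]: "(\<lambda>q. u (fst q) (snd q)) \<in> borel_measurable (M \<Otimes>\<^sub>M borel)"
  shows "(\<lambda>q. transfer A (normalized_potential c) ((\<theta> ^^ n) (fst q)) (u (fst q)) (snd q))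
      \<in> borel_measurable (M \<Otimes>\<^sub>M borel)"
proof -
  have u: "(\<lambda>q. u (fst q) (case_nat e (snd q))) \<in> borel_measurable (M \<Otimes>\<^sub>M borel)" for e
  proof -
    have "(\<lambda>q. (fst q, case_nat e (snd q))) \<in> M \<Otimes>\<^sub>M borel \<rightarrow>\<^sub>M M \<Otimes>\<^sub>M borel" by measurable
    from measurable_compose[OF this assms] show ?thesis by simp
  qed
  have \<phi>: "(\<lambda>q. normalized_potential c ((\<theta> ^^ n) (fst q)) (case_nat e (snd q)))
      \<in> borel_measurable (M \<Otimes>\<^sub>M borel)" for e
  proof -
    have "(\<lambda>q. ((\<theta> ^^ n) (fst q), case_nat e (snd q))) \<in> M \<Otimes>\<^sub>M borel \<rightarrow>\<^sub>M M \<Otimes>\<^sub>M borel" by measurable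
    from measurable_compose[OF this measurable_normalized_potential_pair[of c]] show ?thesis by simp
  qed
  note [measurable] = u \<phi>
  show ?thesis unfolding transfer_def by measurable
qed

lemma measurable_transfer_pow_pair:
  assumes [measurable]: "u \<in> borel_measurable borel"
  shows "(\<lambda>q. transfer_pow \<theta> A (normalized_potential c) (fst q) n u (snd q))
      \<in> borel_measurable (M \<Otimes>\<^sub>M borel)"
proof (induction n)
  case (Suc n)
  then show ?case using measurable_transfer_pair[OF Suc, of c n] by simp
qed simp

lemma measurable_cyl_ratio: "(\<lambda>x. cyl_ratio c x n v) \<in> borel_measurable M"
proof -
  have "(\<lambda>x. (x, base_path ((\<theta> ^^ n) x))) \<in> M \<rightarrow>\<^sub>M M \<Otimes>\<^sub>M borel" by measurable
  from measurable_compose[OF this measurable_transfer_pow_pair[of _ c n]]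
  have [measurable]: "(\<lambda>x. transfer_pow \<theta> A (normalized_potential c) x n u (base_path ((\<theta> ^^ n) x)))
      \<in> borel_measurable M"
    if "u \<in> borel_measurable borel" for u using that by simp
  show ?thesis unfolding cyl_ratio_def by measurable
qed

end

lemma (in complete_measure) borel_measurable_AE_cong:
  fixes f g :: "'a \<Rightarrow> 'b :: topological_space"
  assumes g: "g \<in> borel_measurable M" and AE_eq: "AE x in M. f x = g x"
  shows "f \<in> borel_measurable M"
proof (rule measurableI)
  fix S :: "'b set" assume "S \<in> sets borel"
  then have S: "g -` S \<inter> space M \<in> sets M" using g by (rule measurable_sets[rotated])
  have "AE x in M. x \<in> g -` S \<inter> space M \<longleftrightarrow> x \<in> f -` S \<inter> space M"
    using AE_eq by eventually_elim auto
  then show "f -` S \<inter> space M \<in> sets M" by (rule in_sets_AE) (simp_all add: S)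
qed simp

lemma measurable_prob_algebra_cyl:
  assumes "\<And>x. x \<in> space M \<Longrightarrow> prob_space (\<kappa> x)" "\<And>x. x \<in> space M \<Longrightarrow> sets (\<kappa> x) = sets borel"
    and "\<And>v. (\<lambda>x. emeasure (\<kappa> x) (cyl v)) \<in> borel_measurable M"
  shows "\<kappa> \<in> M \<rightarrow>\<^sub>M prob_algebra (borel :: (nat \<Rightarrow> nat) measure)"
  by (rule measurable_prob_algebra_generated[OF sets_borel_eq_sigma_sets_cyl Int_stable_cyl])
    (use assms in auto)


section \<open>The random conformal measure\<close>

lemma prob_algebra_kernelD:
  assumes "\<kappa> \<in> M \<rightarrow>\<^sub>M prob_algebra N" "x \<in> space M"
  shows "prob_space (\<kappa> x)" "sets (\<kappa> x) = sets N"
  using measurable_space[OF assms] by (auto simp: space_prob_algebra)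

definition fibred_measure :: "'a measure \<Rightarrow> ('a \<Rightarrow> 'a) \<Rightarrow> ('a \<Rightarrow> nat \<Rightarrow> nat \<Rightarrow> bool)
    \<Rightarrow> ('a \<Rightarrow> (nat \<Rightarrow> nat) measure) \<Rightarrow> ('a \<times> (nat \<Rightarrow> nat)) measure" where
  "fibred_measure M \<theta> A \<kappa> = measure_of (space (OmegaM M \<theta> A)) (sets (OmegaM M \<theta> A))
     (\<lambda>B. \<integral>\<^sup>+ x. emeasure (\<kappa> x) (Pair x -` B) \<partial>M)"

lemma sets_fibred_measure [simp]: "sets (fibred_measure M \<theta> A \<kappa>) = sets (OmegaM M \<theta> A)"
  by (simp add: fibred_measure_def)

context
  fixes M :: "'a measure" and \<theta> :: "'a \<Rightarrow> 'a" and A :: "'a \<Rightarrow> nat \<Rightarrow> nat \<Rightarrow> bool"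
    and \<kappa> :: "'a \<Rightarrow> (nat \<Rightarrow> nat) measure"
  assumes Omega: "Omega \<theta> A \<inter> space (M \<Otimes>\<^sub>M borel) \<in> sets (M \<Otimes>\<^sub>M borel)"
    and \<kappa>: "\<kappa> \<in> M \<rightarrow>\<^sub>M prob_algebra borel"
begin

lemma sets_OmegaM_iff: "B \<in> sets (OmegaM M \<theta> A) \<longleftrightarrow> B \<in> sets (M \<Otimes>\<^sub>M borel) \<and> B \<subseteq> Omega \<theta> A"
  unfolding OmegaM_def using sets_restrict_space_iff[OF Omega, of B] by auto

lemma measurable_emeasure_section:
  assumes B: "B \<in> sets (M \<Otimes>\<^sub>M borel)"
  shows "(\<lambda>x. emeasure (\<kappa> x) (Pair x -` B)) \<in> borel_measurable M"
proof (rule emeasure_measurable_subprob_algebra2[OF _ measurable_prob_algebraD[OF \<kappa>]])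
  have "(SIGMA x:space M. Pair x -` B) = B"
    using sets.sets_into_space[OF B] by (auto simp: space_pair_measure)
  with B show "(SIGMA x:space M. Pair x -` B) \<in> sets (M \<Otimes>\<^sub>M borel)" by simp
qed

lemma emeasure_fibred_measure:
  assumes "B \<in> sets (OmegaM M \<theta> A)"
  shows "emeasure (fibred_measure M \<theta> A \<kappa>) B = (\<integral>\<^sup>+ x. emeasure (\<kappa> x) (Pair x -` B) \<partial>M)"
  unfolding fibred_measure_def
proof (rule emeasure_measure_of_sigma[OF sets.sigma_algebra_axioms _ _ assms])
  show "countably_additive (sets (OmegaM M \<theta> A)) (\<lambda>B. \<integral>\<^sup>+ x. emeasure (\<kappa> x) (Pair x -` B) \<partial>M)"
  proof (rule countably_additiveI)
    fix Y :: "nat \<Rightarrow> ('a \<times> (nat \<Rightarrow> nat)) set" assume Y_Omega: "range Y \<subseteq> sets (OmegaM M \<theta> A)"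
      and disjoint: "disjoint_family Y"
    have Y: "Y i \<in> sets (M \<Otimes>\<^sub>M borel)" for i using Y_Omega sets_OmegaM_iff by blast
    have "(\<Sum>i. \<integral>\<^sup>+ x. emeasure (\<kappa> x) (Pair x -` Y i) \<partial>M)
        = (\<integral>\<^sup>+ x. (\<Sum>i. emeasure (\<kappa> x) (Pair x -` Y i)) \<partial>M)"
      by (intro nn_integral_suminf[symmetric] measurable_emeasure_section Y)
    also have "\<dots> = (\<integral>\<^sup>+ x. emeasure (\<kappa> x) (Pair x -` (\<Union>i. Y i)) \<partial>M)"
    proof (rule nn_integral_cong)
      fix x assume x: "x \<in> space M"
      have "(\<Sum>i. emeasure (\<kappa> x) (Pair x -` Y i)) = emeasure (\<kappa> x) (\<Union>i. Pair x -` Y i)"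
        by (rule suminf_emeasure)
          (use disjoint in \<open>auto simp: disjoint_family_on_def prob_algebra_kernelD(2)[OF \<kappa> x]
            intro: sets_Pair1[OF Y]\<close>)
      then show "(\<Sum>i. emeasure (\<kappa> x) (Pair x -` Y i)) = emeasure (\<kappa> x) (Pair x -` (\<Union>i. Y i))"
        by (simp add: vimage_UN)
    qed
    finally show "(\<Sum>i. \<integral>\<^sup>+ x. emeasure (\<kappa> x) (Pair x -` Y i) \<partial>M)
      = (\<integral>\<^sup>+ x. emeasure (\<kappa> x) (Pair x -` (\<Union>i. Y i)) \<partial>M)" .
  qed
qed (simp add: positive_def)

context
  assumes M: "prob_space M" and supp: "\<And>x. x \<in> space M \<Longrightarrow> AE \<omega> in \<kappa> x. \<omega> \<in> Einf \<theta> A x"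
begin

lemma emeasure_kernel_Einf: "x \<in> space M \<Longrightarrow> emeasure (\<kappa> x) (Einf \<theta> A x) = 1"
  using prob_space.emeasure_eq_1_AE[OF prob_algebra_kernelD(1)[OF \<kappa>] _ supp]
    prob_algebra_kernelD(2)[OF \<kappa>] by simp

lemma random_measure_fibred_measure: "random_measure M \<theta> A (fibred_measure M \<theta> A \<kappa>)"
proof -
  let ?\<nu> = "fibred_measure M \<theta> A \<kappa>"
  have fst: "fst \<in> ?\<nu> \<rightarrow>\<^sub>M M"
    unfolding measurable_cong_sets[OF sets_fibred_measure refl] OmegaM_def
    by (intro measurable_restrict_space1 measurable_fst)
  have space: "space ?\<nu> = Omega \<theta> A \<inter> (space M \<times> UNIV)"
    using sets_eq_imp_space_eq[OF sets_fibred_measure, of M \<theta> A \<kappa>]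
    by (auto simp: OmegaM_def space_restrict_space space_pair_measure)
  have marginal: "emeasure ?\<nu> (fst -` S \<inter> space ?\<nu>) = emeasure M S" if S: "S \<in> sets M" for S
  proof -
    have "emeasure ?\<nu> (fst -` S \<inter> space ?\<nu>)
        = (\<integral>\<^sup>+ x. emeasure (\<kappa> x) (Pair x -` (fst -` S \<inter> space ?\<nu>)) \<partial>M)"
      using measurable_sets[OF fst S] by (intro emeasure_fibred_measure) simp
    also have "\<dots> = (\<integral>\<^sup>+ x. indicator S x \<partial>M)"
    proof (rule nn_integral_cong)
      fix x assume x: "x \<in> space M"
      then have "Pair x -` (fst -` S \<inter> space ?\<nu>) = (if x \<in> S then Einf \<theta> A x else {})"
        by (auto simp: space Omega_def)
      then show "emeasure (\<kappa> x) (Pair x -` (fst -` S \<inter> space ?\<nu>)) = indicator S x"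
        using emeasure_kernel_Einf[OF x] by simp
    qed
    finally show ?thesis using S by simp
  qed
  have "prob_space ?\<nu>"
  proof (rule prob_spaceI)
    have "fst -` space M \<inter> space ?\<nu> = space ?\<nu>" by (auto simp: space)
    then show "emeasure ?\<nu> (space ?\<nu>) = 1"
      using marginal[OF sets.top] prob_space.emeasure_space_1[OF M] by simp
  qed
  moreover have "distr ?\<nu> M fst = M"
    by (rule measure_eqI) (simp_all add: emeasure_distr[OF fst] marginal)
  ultimately show ?thesis by (simp add: random_measure_def)
qed

lemma disintegration_fibred_measure:
  "disintegration M \<theta> A (fibred_measure M \<theta> A \<kappa>) (\<lambda>x. restrict_space (\<kappa> x) (Einf \<theta> A x))"
  unfolding disintegration_def
proof (intro conjI ballI)
  fix x assume x: "x \<in> space M"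
  show "prob_space (restrict_space (\<kappa> x) (Einf \<theta> A x))"
    by (rule prob_space_restrict_space)
      (simp_all add: prob_algebra_kernelD(2)[OF \<kappa> x] emeasure_kernel_Einf[OF x])
  show "sets (restrict_space (\<kappa> x) (Einf \<theta> A x)) = sets (restrict_space borel (Einf \<theta> A x))"
    by (rule sets_restrict_space_cong[OF prob_algebra_kernelD(2)[OF \<kappa> x]])
next
  fix B assume "B \<in> sets (fibred_measure M \<theta> A \<kappa>)"
  then have B: "B \<in> sets (OmegaM M \<theta> A)" "B \<in> sets (M \<Otimes>\<^sub>M borel)" "B \<subseteq> Omega \<theta> A"
    by (simp_all add: sets_OmegaM_iff)
  have section_eq: "emeasure (restrict_space (\<kappa> x) (Einf \<theta> A x)) (Pair x -` B)
      = emeasure (\<kappa> x) (Pair x -` B)"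
    if "x \<in> space M" for x
    by (rule emeasure_restrict_space)
      (use B(3) prob_algebra_kernelD(2)[OF \<kappa> that] in \<open>auto simp: Omega_def\<close>)
  show "(\<lambda>x. emeasure (restrict_space (\<kappa> x) (Einf \<theta> A x)) (Pair x -` B)) \<in> borel_measurable M"
    using measurable_emeasure_section[OF B(2)] by (simp add: section_eq cong: measurable_cong)
  show "emeasure (fibred_measure M \<theta> A \<kappa>) B
      = (\<integral>\<^sup>+ x. emeasure (restrict_space (\<kappa> x) (Einf \<theta> A x)) (Pair x -` B) \<partial>M)"
    unfolding emeasure_fibred_measure[OF B(1)] by (rule nn_integral_cong) (simp add: section_eq)
qed

end

end


context random_shift begin

lemma measurable_limit_kernel:
  assumes \<kappa>: "\<And>x. prob_space (\<kappa> x)" "\<And>x. sets (\<kappa> x) = sets borel"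
    and lim: "AE x in M. \<forall>v. (\<lambda>n. cyl_ratio c x n v) \<longlonglongrightarrow> measure (\<kappa> x) (cyl v)"
  shows "\<kappa> \<in> M \<rightarrow>\<^sub>M prob_algebra borel"
proof (rule measurable_prob_algebra_cyl)
  fix v
  show "(\<lambda>x. emeasure (\<kappa> x) (cyl v)) \<in> borel_measurable M"
  proof (rule borel_measurable_AE_cong)
    show "(\<lambda>x. ennreal (lim (\<lambda>n. cyl_ratio c x n v))) \<in> borel_measurable M"
      using measurable_cyl_ratio by measurable
    show "AE x in M. emeasure (\<kappa> x) (cyl v) = ennreal (lim (\<lambda>n. cyl_ratio c x n v))"
      using lim
    proof eventually_elim
      case (elim x)
      then show ?case
        using limI[OF spec[OF elim, of v]]
        by (simp add: finite_measure.emeasure_eq_measure[OF prob_space.finite_measure[OF \<kappa>(1)]])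
    qed
  qed
qed (rule \<kappa>)+

lemma measurable_dual_transfer_mass:
  assumes \<kappa>: "\<kappa> \<in> M \<rightarrow>\<^sub>M prob_algebra borel"
  shows "(\<lambda>x. measure (dual_transfer A (normalized_potential c) x (\<kappa> (\<theta> x))) UNIV)
      \<in> borel_measurable M"
proof -
  have "(\<lambda>q. transfer A (normalized_potential c) ((\<theta> ^^ 0) (fst q)) (\<lambda>_. 1) (snd q))
      \<in> borel_measurable (M \<Otimes>\<^sub>M borel)"
    by (rule measurable_transfer_pair) simp
  then have "(\<lambda>x. \<integral>\<^sup>+ \<omega>. transfer A (normalized_potential c) x (\<lambda>_. 1) \<omega> \<partial>\<kappa> (\<theta> x))
      \<in> borel_measurable M"
    using nn_integral_measurable_subprob_algebra2[OF _
      measurable_compose[OF theta_measurable measurable_prob_algebraD[OF \<kappa>]],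
        of "\<lambda>x. transfer A (normalized_potential c) x (\<lambda>_. 1)"] by (simp add: split_beta')
  then have "(\<lambda>x. enn2real (\<integral>\<^sup>+ \<omega>. transfer A (normalized_potential c) x (\<lambda>_. 1) \<omega> \<partial>\<kappa> (\<theta> x)))
      \<in> borel_measurable M"
    by measurable
  moreover have "measure (dual_transfer A (normalized_potential c) x (\<kappa> (\<theta> x))) UNIV
      = enn2real (\<integral>\<^sup>+ \<omega>. transfer A (normalized_potential c) x (\<lambda>_. 1) \<omega> \<partial>\<kappa> (\<theta> x))"
        if x: "x \<in> space M" for x
    using prob_algebra_kernelD(2)[OF \<kappa> measurable_space[OF theta_measurable x]]
      measurable_normalized_potential[OF x]
    by (simp add: measure_def emeasure_dual_transfer)
  ultimately show ?thesis by (simp cong: measurable_cong)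
qed

lemma ex_measurable_conformal_scalar:
  assumes \<kappa>: "\<kappa> \<in> M \<rightarrow>\<^sub>M prob_algebra borel"
    and conformal: "AE x in M. \<exists>t>0. \<bar>ln t\<bar> \<le> K \<and>
      dual_transfer A (normalized_potential c) x (\<kappa> (\<theta> x)) = scale_measure (ennreal t) (\<kappa> x)"
  obtains lam where "lam \<in> borel_measurable M" "\<And>x. 0 < lam x" "AE x in M. \<bar>ln (lam x)\<bar> \<le> K"
    "AE x in M. dual_transfer A (normalized_potential c) x (\<kappa> (\<theta> x))
        = scale_measure (ennreal (lam x)) (\<kappa> x)"
proof -
  let ?mass = "\<lambda>x. measure (dual_transfer A (normalized_potential c) x (\<kappa> (\<theta> x))) UNIV"
  define lam where "lam x = (if 0 < ?mass x then ?mass x else 1)" for x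
  have "AE x in M. \<bar>ln (lam x)\<bar> \<le> K \<and>
      dual_transfer A (normalized_potential c) x (\<kappa> (\<theta> x)) = scale_measure (ennreal (lam x)) (\<kappa> x)"
    using conformal AE_space
  proof eventually_elim
    case (elim x)
    then obtain t where t: "0 < t" "\<bar>ln t\<bar> \<le> K"
      "dual_transfer A (normalized_potential c) x (\<kappa> (\<theta> x)) = scale_measure (ennreal t) (\<kappa> x)"
        by blast
    have "measure (\<kappa> x) UNIV = 1"
      using prob_space.prob_space[OF prob_algebra_kernelD(1)[OF \<kappa> elim(2)]]
        sets_eq_imp_space_eq[OF prob_algebra_kernelD(2)[OF \<kappa> elim(2)]] by simp
    with t have "lam x = t" by (simp add: lam_def)
    with t show ?case by simp
  qed
  moreover have "lam \<in> borel_measurable M"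
    unfolding lam_def using measurable_dual_transfer_mass[OF \<kappa>, of c] by measurable
  moreover have "0 < lam x" for x by (simp add: lam_def)
  ultimately show thesis using that by simp
qed

lemma ex_conformal_kernel:
  obtains \<kappa> lam K where "\<kappa> \<in> M \<rightarrow>\<^sub>M prob_algebra borel"
    "\<And>x. x \<in> space M \<Longrightarrow> AE \<omega> in \<kappa> x. \<omega> \<in> Einf \<theta> A x"
    "lam \<in> borel_measurable M" "\<And>x. 0 < lam x" "AE x in M. \<bar>ln (lam x)\<bar> \<le> K"
    "AE x in M. dual_transfer A (normalized_potential 1) x (\<kappa> (\<theta> x))
        = scale_measure (ennreal (lam x)) (\<kappa> x)"
proof -
  obtain c K \<nu> where
    \<nu>: "\<And>x. good_pt x \<Longrightarrow> prob_space (\<nu> x) \<and> sets (\<nu> x) = sets borel \<and> (AE \<omega> in \<nu> x. \<omega> \<in> Einf \<theta> A x)"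
    and lim: "\<And>x v. good_pt x \<Longrightarrow> (\<lambda>n. cyl_ratio c x n v) \<longlonglongrightarrow> measure (\<nu> x) (cyl v)"
    and conformal: "\<And>x. good_pt x \<Longrightarrow> \<exists>t>0. \<bar>ln t\<bar> \<le> K \<and>
       dual_transfer A (normalized_potential 1) x (\<nu> (\<theta> x)) = scale_measure (ennreal t) (\<nu> x)"
    by (rule ex_fibre_measures) (rule that)
  \<comment> \<open>\<open>M\<close> is complete, so the choice on the null set of bad points does not affect measurability.\<close>
  define \<kappa> where "\<kappa> x = (if good_pt x then \<nu> x else return borel (base_path x))" for x
  have \<kappa>_prob: "prob_space (\<kappa> x)" "sets (\<kappa> x) = sets borel" for x
    using \<nu>[of x] by (auto simp: \<kappa>_def prob_space_return)
  have "AE x in M. \<forall>v. (\<lambda>n. cyl_ratio c x n v) \<longlonglongrightarrow> measure (\<kappa> x) (cyl v)"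
    using AE_good_pt by eventually_elim (simp add: \<kappa>_def lim)
  then have \<kappa>: "\<kappa> \<in> M \<rightarrow>\<^sub>M prob_algebra borel" by (rule measurable_limit_kernel[OF \<kappa>_prob])
  have "AE x in M. \<exists>t>0. \<bar>ln t\<bar> \<le> K \<and>
      dual_transfer A (normalized_potential 1) x (\<kappa> (\<theta> x)) = scale_measure (ennreal t) (\<kappa> x)"
    using AE_good_pt by eventually_elim (use conformal good_pt_theta in \<open>simp add: \<kappa>_def\<close>)
  from ex_measurable_conformal_scalar[OF \<kappa> this] obtain lam where
    "lam \<in> borel_measurable M" "\<And>x. 0 < lam x" "AE x in M. \<bar>ln (lam x)\<bar> \<le> K"
    "AE x in M. dual_transfer A (normalized_potential 1) x (\<kappa> (\<theta> x))
        = scale_measure (ennreal (lam x)) (\<kappa> x)"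
    by blast
  moreover have "AE \<omega> in \<kappa> x. \<omega> \<in> Einf \<theta> A x" if "x \<in> space M" for x
  proof (cases "good_pt x")
    case False
    then have "\<kappa> x = return borel (base_path x)" by (simp add: \<kappa>_def)
    then show ?thesis using base_path_in_Einf[OF that] by (simp only:) (subst AE_return; simp)
  next
    case True
    then have "\<kappa> x = \<nu> x" by (simp add: \<kappa>_def)
    then show ?thesis using \<nu>[OF True] by (simp only:)
  qed
  ultimately show thesis using \<kappa> that by blast
qed

lemma conformal_eq_restrict_space:
  assumes \<kappa>: "\<And>x. x \<in> space M \<Longrightarrow> sets (\<kappa> x) = sets borel"
    and supp: "\<And>x. x \<in> space M \<Longrightarrow> AE \<omega> in \<kappa> x. \<omega> \<in> Einf \<theta> A x"
    and dual: "AE x in M. dual_transfer A (normalized_potential 1) x (\<kappa> (\<theta> x))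
        = scale_measure (ennreal (lam x)) (\<kappa> x)"
  shows "conformal_eq M \<theta> A \<phi> (\<lambda>x. restrict_space (\<kappa> x) (Einf \<theta> A x)) lam"
  unfolding conformal_eq_def using dual AE_space
proof (eventually_elim, intro ballI)
  fix x B assume dual: "dual_transfer A (normalized_potential 1) x (\<kappa> (\<theta> x))
      = scale_measure (ennreal (lam x)) (\<kappa> x)"
    and x: "x \<in> space M" and "B \<in> sets (restrict_space (\<kappa> x) (Einf \<theta> A x))"
  then have B: "B \<in> sets borel" "B \<subseteq> Einf \<theta> A x"
    by (simp_all add: sets_restrict_space_iff \<kappa>)
  note \<theta>x = measurable_space[OF theta_measurable x]
  have "(\<integral>\<^sup>+ \<omega>. transfer A \<phi> x (indicator B) \<omega> \<partial>restrict_space (\<kappa> (\<theta> x)) (Einf \<theta> A (\<theta> x)))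
      = (\<integral>\<^sup>+ \<omega>. transfer A \<phi> x (indicator B) \<omega> * indicator (Einf \<theta> A (\<theta> x)) \<omega> \<partial>\<kappa> (\<theta> x))"
    by (rule nn_integral_restrict_space) (simp add: \<kappa>[OF \<theta>x])
  also have "\<dots> = (\<integral>\<^sup>+ \<omega>. transfer A (normalized_potential 1) x (indicator B) \<omega> \<partial>\<kappa> (\<theta> x))"
    by (rule nn_integral_cong_AE, rule eventually_mono[OF supp[OF \<theta>x]])
      (simp add: transfer_normalized)
  also have "\<dots> = emeasure (dual_transfer A (normalized_potential 1) x (\<kappa> (\<theta> x))) B"
    using B by (simp add: emeasure_dual_transfer \<kappa>[OF \<theta>x] measurable_normalized_potential[OF x])
  also have "\<dots> = ennreal (lam x) * emeasure (restrict_space (\<kappa> x) (Einf \<theta> A x)) B"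
    using B by (simp add: dual emeasure_restrict_space \<kappa>[OF x])
  finally show "(\<integral>\<^sup>+ \<omega>. transfer A \<phi> x (indicator B) \<omega> \<partial>restrict_space (\<kappa> (\<theta> x)) (Einf \<theta> A (\<theta> x)))
    = ennreal (lam x) * emeasure (restrict_space (\<kappa> x) (Einf \<theta> A x)) B" .
qed

theorem conformal_measure_exists:
  "\<exists>\<nu> \<nu>x lam. random_measure M \<theta> A \<nu> \<and> disintegration M \<theta> A \<nu> \<nu>x \<and>
     lam \<in> borel_measurable M \<and> (\<forall>x \<in> space M. 0 < lam x) \<and>
     conformal_eq M \<theta> A \<phi> \<nu>x lam \<and> esssup M (\<lambda>x. ereal \<bar>ln (lam x)\<bar>) < \<infinity>"
proof -
  obtain \<kappa> lam K where \<kappa>: "\<kappa> \<in> M \<rightarrow>\<^sub>M prob_algebra borel"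
    and supp: "\<And>x. x \<in> space M \<Longrightarrow> AE \<omega> in \<kappa> x. \<omega> \<in> Einf \<theta> A x"
    and lam: "lam \<in> borel_measurable M" "\<And>x. 0 < lam x" "AE x in M. \<bar>ln (lam x)\<bar> \<le> K"
    and dual: "AE x in M. dual_transfer A (normalized_potential 1) x (\<kappa> (\<theta> x))
        = scale_measure (ennreal (lam x)) (\<kappa> x)"
    by (rule ex_conformal_kernel) (rule that)
  have "esssup M (\<lambda>x. ereal \<bar>ln (lam x)\<bar>) \<le> ereal K" by (rule esssup_I) (use lam in simp_all)
  then have "esssup M (\<lambda>x. ereal \<bar>ln (lam x)\<bar>) < \<infinity>" by (rule le_less_trans) simp
  moreover have "conformal_eq M \<theta> A \<phi> (\<lambda>x. restrict_space (\<kappa> x) (Einf \<theta> A x)) lam"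
    by (rule conformal_eq_restrict_space[OF prob_algebra_kernelD(2)[OF \<kappa>] supp dual])
  ultimately show ?thesis
    using random_measure_fibred_measure[OF sets_Omega \<kappa> prob_space_axioms supp]
      disintegration_fibred_measure[OF sets_Omega \<kappa> prob_space_axioms supp] lam(1,2) by blast
qed

end

lemma standing_setup_admissible:
  assumes "standing_setup M \<theta> A"
  shows "\<exists>N. \<forall>n\<ge>N. \<forall>x\<in>space M. \<exists>u. u 0 = a \<and> u n = b \<and> admissible \<theta> A x n u"
proof -
  have "\<exists>N. \<forall>n\<ge>N. \<forall>x\<in>space M. \<exists>u. u 0 = a \<and> u (n + 2) = b \<and> admissible \<theta> A x (n + 2) u"
    using assms unfolding standing_setup_def admissible_def by blast
  then obtain N where N: "\<And>n x. N \<le> n \<Longrightarrow> x \<in> space M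
      \<Longrightarrow> \<exists>u. u 0 = a \<and> u (n + 2) = b \<and> admissible \<theta> A x (n + 2) u"
    by blast
  show ?thesis
  proof (intro exI[of _ "N + 2"] allI impI ballI)
    fix n x assume "N + 2 \<le> n" "x \<in> space M"
    then have "n - 2 + 2 = n" "N \<le> n - 2" by auto
    with N[of "n - 2" x] \<open>x \<in> space M\<close> show "\<exists>u. u 0 = a \<and> u n = b \<and> admissible \<theta> A x n u" by simp
  qed
qed

lemma AE_le_esssup_SUP:
  fixes f :: "'a \<Rightarrow> 'b \<Rightarrow> 'c :: {second_countable_topology, dense_linorder, linorder_topology,
      complete_linorder}"
  shows "AE x in M. \<forall>\<omega>\<in>S x. f x \<omega> \<le> esssup M (\<lambda>x. SUP \<omega>\<in>S x. f x \<omega>)"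
  using esssup_AE[of "\<lambda>x. SUP \<omega>\<in>S x. f x \<omega>" M] by (simp add: SUP_le_iff)

lemma random_shift_of_fine:
  assumes standing: "standing_setup M \<theta> A" and "0 < \<alpha>" and "is_fine M \<theta> A \<alpha> \<phi>"
  obtains succs lo hi V H where "random_shift M \<theta> A \<phi> succs lo hi V \<alpha> H"
proof -
  have potential: "summable_potential M \<theta> A \<alpha> \<phi>" using assms(3) by (simp add: is_fine_def)
  note potential = potential[unfolded summable_potential_def]
  have "\<forall>e. \<exists>D. finite D \<and> (AE x in M. \<forall>j. A x e j \<longrightarrow> j \<in> D)"
    using standing by (simp add: standing_setup_def)
  then obtain succs where succs: "\<And>e. finite (succs e)" "\<And>e. AE x in M. \<forall>j. A x e j \<longrightarrow> j \<in> succs e"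
    unfolding choice_iff by blast
  have "\<forall>e. \<exists>c C. 0 < c \<and> (AE x in M. \<forall>\<omega>\<in>Einf \<theta> A x. \<omega> 0 = e \<longrightarrow> c \<le> exp (\<phi> x \<omega>) \<and> exp (\<phi> x \<omega>) \<le> C)"
    using potential by blast
  then obtain lo hi where lo_hi: "\<And>e. 0 < lo e"
    "\<And>e. AE x in M. \<forall>\<omega>\<in>Einf \<theta> A x. \<omega> 0 = e \<longrightarrow> lo e \<le> exp (\<phi> x \<omega>) \<and> exp (\<phi> x \<omega>) \<le> hi e"
    unfolding choice_iff by blast
  define s where "s = esssup M (\<lambda>x. holder_var \<theta> A \<alpha> x (\<phi> x))"
  define V where "V = max 0 (real_of_ereal s)"
  have "s < \<infinity>" using potential by (simp add: s_def)
  then have V: "s \<le> ereal V" "0 \<le> V" by (cases s; auto simp: V_def)+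
  have AE_V: "AE x in M. holder_var \<theta> A \<alpha> x (\<phi> x) \<le> ereal V"
    using esssup_AE[of "\<lambda>x. holder_var \<theta> A \<alpha> x (\<phi> x)" M]
    by (rule eventually_mono) (use V(1) s_def in auto)
  define H where "H l = esssup M (\<lambda>x. SUP \<omega> \<in> Einf \<theta> A (\<theta> x).
    transfer A \<phi> x (indicator (Einf \<theta> A x - {\<tau>. \<tau> 0 \<le> l})) \<omega>)" for l
  have "H \<longlonglongrightarrow> 0" using potential unfolding H_def by blast
  have AE_H: "AE x in M. \<forall>\<omega>\<in>Einf \<theta> A (\<theta> x). transfer A \<phi> x (indicator (Einf \<theta> A x - {\<tau>. \<tau> 0 \<le> l})) \<omega>
      \<le> H l" for l
    unfolding H_def by (rule AE_le_esssup_SUP)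
  have "random_shift M \<theta> A \<phi> succs lo hi V \<alpha> H"
    unfolding random_shift_def random_shift_axioms_def
    using standing[unfolded standing_setup_def] potential \<open>0 < \<alpha>\<close> succs lo_hi V(2) AE_V \<open>H \<longlonglongrightarrow> 0\<close> AE_H
      standing_setup_admissible[OF standing] by simp
  then show thesis by (rule that)
qed

theorem theorem1:
  fixes M :: "'a measure" and \<theta> :: "'a \<Rightarrow> 'a" and A :: "'a \<Rightarrow> nat \<Rightarrow> nat \<Rightarrow> bool"
    and \<alpha> :: real and \<phi> :: "'a \<Rightarrow> (nat \<Rightarrow> nat) \<Rightarrow> real"
  assumes "standing_setup M \<theta> A"
    and "0 < \<alpha>"
    and "is_fine M \<theta> A \<alpha> \<phi>"
  shows "\<exists>\<nu> \<nu>x lam. random_measure M \<theta> A \<nu> \<and> disintegration M \<theta> A \<nu> \<nu>x \<and>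
           lam \<in> borel_measurable M \<and> (\<forall>x \<in> space M. 0 < lam x) \<and>
           conformal_eq M \<theta> A \<phi> \<nu>x lam \<and>
           esssup M (\<lambda>x. ereal \<bar>ln (lam x)\<bar>) < \<infinity>"
proof -
  obtain succs lo hi V H where "random_shift M \<theta> A \<phi> succs lo hi V \<alpha> H"
    using random_shift_of_fine[OF assms] .
  then show ?thesis by (rule random_shift.conformal_measure_exists)
qed

end
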